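(* Suppose assumption A1 holds: the eigenvalues of $M_g$ and of $M_e$ are non-degenerate. Then, given any $\epsilon>0$ and $C>0$, there exist constants $\delta>0$ and $\bar\alpha>0$ such that for every probability measure $\mu$ on $\bar B_1$ satisfying $\mathbb{E}_\mu[V]\le C$, the sequence $\Gamma_k(\mu)=\Gamma_k^{\bar\alpha,\delta}(\mu)$ of laws of the controlled Markov process $|\psi_k\rangle$ converges (weak-$\ast$) to a limit set $\Omega$. Moreover, for all $\mu_\infty\in\Omega$: $|\psi\rangle\in\mathrm{supp}(\mu_\infty)$ only if $|\psi\rangle$ is one of the Fock states $|n\rangle$, $n\ge 0$; and $$\mu_\infty(\{|\bar n\rangle\})\ge 1-\epsilon .$$
   Context: **Space and operators.** $\mathcal H$ is a complex Hilbert (Fock) space with orthonormal basis $\{|n\rangle:n=0,1,2,\dots\}$ (the Fock states). The operators $a,a^\dagger,N=a^\dagger a$ satisfy $a|n\rangle=\sqrt n|n-1\rangle$, $a^\dagger|n\rangle=\sqrt{n+1}|n+1\rangle$, $N|n\rangle=n|n\rangle$. $\bar B_1=\{x\in\mathcal H:\|x\|=1\}$ carries the topology inherited from $\mathcal H$. Fix real numbers $\theta,\phi$ and put $\phi_n=\theta+n\phi$. Let $M_g=\cos(\theta+N\phi)$, $M_e=\sin(\theta+N\phi)$, i.e. $M_g|n\rangle=\cos\phi_n|n\rangle$, $M_e|n\rangle=\sin\phi_n|n\rangle$. For $\alpha\in\mathbb R$, $D_\alpha=\exp(\alpha(a^\dagger-a))$ (strongly continuous unitary group on $\mathcal H$).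 **Lyapunov function.** Fix a target integer $\bar n\ge2$. For $\delta>0$ define $V=V_\delta$ on $\bar B_1$, with values possibly $+\infty$, by $$V(|\psi\rangle)=\sum_{n=0}^\infty\sigma_n|\langle\psi|n\rangle|^2+\delta\left(\cos^4\phi_{\bar n}+\sin^4\phi_{\bar n}-\|M_g|\psi\rangle\|^4-\|M_e|\psi\rangle\|^4\right),$$ where $\sigma_0=\frac18+\sum_{k=1}^{\bar n}(\frac1k-\frac1{k^2})$; $\sigma_n=\sum_{k=n+1}^{\bar n}(\frac1k-\frac1{k^2})$ for $1\le n<\bar n$; $\sigma_{\bar n}=0$; $\sigma_n=\sum_{k=\bar n+1}^{n}(\frac1k+\frac1{k^2})$ for $n>\bar n$. The constant $\delta$ is always taken small enough that $V\ge0$. **Markov process.** Given $|\psi_k\rangle\in\bar B_1$, for $s\in\{g,e\}$: $|\psi_{k+1/2}\rangle=M_s|\psi_k\rangle/\|M_s|\psi_k\rangle\|$ with probability $\|M_s|\psi_k\rangle\|^2$, and then $|\psi_{k+1}\rangle=D_{\alpha_k}|\psi_{k+1/2}\rangle$, where $\alpha_k$ is the feedback $\alpha_k=\operatorname{argmin}_{\alpha\in[-\bar\alpha,\bar\alpha]}V(D_\alpha|\psi_{k+1/2}\rangle)$ ($\bar\alpha>0$ a constant; $\alpha_k$ is a measurably selected minimizer). $\Gamma_k(\mu)$ is the probability distribution of $|\psi_k\rangle$ when $|\psi_0\rangle$ has distribution $\mu$. **Measures.** $\mathcal M_1$ is the set of Borel probability measures on $\bar B_1$; $\mathbb E_\mu[f]=\int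 f\,d\mu$. $\mu_n$ converges weak-$\ast$ to $\mu$ if $\mathbb E_{\mu_n}[f]\to\mathbb E_\mu[f]$ for every bounded continuous $f$ on $\bar B_1$. $\Omega$ is the set of all $\mu_\infty\in\mathcal M_1$ that are weak-$\ast$ limits of a subsequence of $(\Gamma_k(\mu))_k$; "$\Gamma_k(\mu)$ converges to $\Omega$" means that every subsequence has a further subsequence converging weak-$\ast$ to an element of $\Omega$ (in particular $\Omega\neq\emptyset$). $\mathrm{supp}(\mu)=\{x\in\bar B_1:\mu(W)>0$ for all open neighborhoods $W$ of $x\}$. **Conventions.** Unit vectors differing by a scalar of modulus one represent the same state; so "$|\psi\rangle$ is a Fock state $|n\rangle$" means $|\psi\rangle=c|n\rangle$ with $|c|=1$, and $\{|\bar n\rangle\}$ denotes $\{c|\bar n\rangle:|c|=1\}$. Assumption A1 is described in the paper also as the condition that $\pi/\phi$ is not rational, and as implying that the only eigenvectors of $M_g$ and $M_e$ are the Fock states. *)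

theory Defs
  imports "HOL-Probability.Probability"
begin

text \<open>The Fock space is realised as the space of square-summable complex sequences; the
  Fock states are the standard unit vectors.\<close>

typedef ell2 = "{x :: nat \<Rightarrow> complex. summable (\<lambda>n. (cmod (x n))\<^sup>2)}"
  morphisms coord Abs_ell2
  by (intro exI[of _ "\<lambda>_. 0"]) simp

setup_lifting type_definition_ell2

lemma ell2_eqI: "(\<And>n. coord x n = coord y n) \<Longrightarrow> x = y"
  by (metis coord_inject ext)

lemma summable_coord: "summable (\<lambda>n. (cmod (coord x n))\<^sup>2)"
  using coord[of x] by simp

lemma summable_sq_mult:
  fixes x y :: "nat \<Rightarrow> complex"
  assumes "summable (\<lambda>n. (cmod (x n))\<^sup>2)" "summable (\<lambda>n. (cmod (y n))\<^sup>2)"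
  shows "summable (\<lambda>n. cmod (x n) * cmod (y n))"
proof (rule summable_comparison_test')
  show "summable (\<lambda>n. (cmod (x n))\<^sup>2 + (cmod (y n))\<^sup>2)"
    using assms by (rule summable_add)
  fix n :: nat
  have "2 * cmod (x n) * cmod (y n) \<le> (cmod (x n))\<^sup>2 + (cmod (y n))\<^sup>2"
    by (rule sum_squares_bound)
  moreover have "0 \<le> cmod (x n) * cmod (y n)" by simp
  ultimately show "norm (cmod (x n) * cmod (y n)) \<le> (cmod (x n))\<^sup>2 + (cmod (y n))\<^sup>2"
    unfolding real_norm_def by linarith
qed

lemma summable_sq_add:
  fixes x y :: "nat \<Rightarrow> complex"
  assumes "summable (\<lambda>n. (cmod (x n))\<^sup>2)" "summable (\<lambda>n. (cmod (y n))\<^sup>2)"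
  shows "summable (\<lambda>n. (cmod (x n + y n))\<^sup>2)"
proof (rule summable_comparison_test')
  show "summable (\<lambda>n. 2 * (cmod (x n))\<^sup>2 + 2 * (cmod (y n))\<^sup>2)"
    using assms by (intro summable_add summable_mult)
  fix n :: nat
  have "(cmod (x n + y n))\<^sup>2 \<le> (cmod (x n) + cmod (y n))\<^sup>2"
    by (simp add: norm_triangle_ineq power_mono)
  also have "\<dots> \<le> 2 * (cmod (x n))\<^sup>2 + 2 * (cmod (y n))\<^sup>2"
    using sum_squares_bound[of "cmod (x n)" "cmod (y n)"] by (simp add: power2_sum)
  finally show "norm ((cmod (x n + y n))\<^sup>2) \<le> 2 * (cmod (x n))\<^sup>2 + 2 * (cmod (y n))\<^sup>2"
    by simp
qed

lemma summable_sq_bounded_mult: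
  fixes x :: "nat \<Rightarrow> complex"
  assumes "summable (\<lambda>n. (cmod (x n))\<^sup>2)" "\<And>n. cmod (b n) \<le> B"
  shows "summable (\<lambda>n. (cmod (b n * x n))\<^sup>2)"
proof (rule summable_comparison_test')
  show "summable (\<lambda>n. B\<^sup>2 * (cmod (x n))\<^sup>2)"
    using assms(1) by (rule summable_mult)
  fix n :: nat
  have "(cmod (b n))\<^sup>2 \<le> B\<^sup>2" using assms(2)[of n] by (intro power_mono) auto
  then show "norm ((cmod (b n * x n))\<^sup>2) \<le> B\<^sup>2 * (cmod (x n))\<^sup>2"
    by (simp add: norm_mult power_mult_distrib mult_right_mono)
qed

lift_definition scaleC :: "complex \<Rightarrow> ell2 \<Rightarrow> ell2" (infixr "*\<^sub>C" 75)
  is "\<lambda>c x n. c * x n"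
  by (rule summable_sq_bounded_mult) auto

definition cinner :: "ell2 \<Rightarrow> ell2 \<Rightarrow> complex" where
  "cinner x y = (\<Sum>n. cnj (coord x n) * coord y n)"

lift_definition fock :: "nat \<Rightarrow> ell2" is "\<lambda>m n. if n = m then 1 else 0"
  by (rule summable_finite[of "{_}"]) auto

lemma summable_cinner: "summable (\<lambda>n. cnj (coord x n) * coord y n)"
  by (rule summable_norm_cancel)
    (simp add: norm_mult summable_sq_mult summable_coord)

instantiation ell2 :: real_inner
begin

lift_definition zero_ell2 :: ell2 is "\<lambda>_. 0" by simp
lift_definition plus_ell2 :: "ell2 \<Rightarrow> ell2 \<Rightarrow> ell2" is "\<lambda>x y n. x n + y n"
  by (rule summable_sq_add)
lift_definition uminus_ell2 :: "ell2 \<Rightarrow> ell2" is "\<lambda>x n. - x n" by simp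
lift_definition minus_ell2 :: "ell2 \<Rightarrow> ell2 \<Rightarrow> ell2" is "\<lambda>x y n. x n - y n"
  using summable_sq_add[of _ "\<lambda>n. - _ n"] by simp
lift_definition scaleR_ell2 :: "real \<Rightarrow> ell2 \<Rightarrow> ell2" is "\<lambda>r x n. of_real r * x n"
  by (rule summable_sq_bounded_mult) auto

definition inner_ell2 :: "ell2 \<Rightarrow> ell2 \<Rightarrow> real" where
  "inner_ell2 x y = Re (cinner x y)"
definition norm_ell2 :: "ell2 \<Rightarrow> real" where
  "norm_ell2 x = sqrt (inner x x)"
definition sgn_ell2 :: "ell2 \<Rightarrow> ell2" where
  "sgn_ell2 x = inverse (norm x) *\<^sub>R x"
definition dist_ell2 :: "ell2 \<Rightarrow> ell2 \<Rightarrow> real" where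
  "dist_ell2 x y = norm (x - y)"
definition uniformity_ell2 :: "(ell2 \<times> ell2) filter" where
  "uniformity_ell2 = (INF e\<in>{0<..}. principal {(x, y). dist x y < e})"
definition open_ell2 :: "ell2 set \<Rightarrow> bool" where
  "open_ell2 U = (\<forall>x\<in>U. \<forall>\<^sub>F (x', y) in uniformity. x' = x \<longrightarrow> y \<in> U)"

lemma inner_ell2_sums: "(\<lambda>n. Re (cnj (coord x n) * coord y n)) sums inner x y"
  unfolding inner_ell2_def cinner_def
  by (intro sums_Re summable_sums summable_cinner)

lemma inner_self_sums: "(\<lambda>n. (cmod (coord x n))\<^sup>2) sums inner x x"
proof -
  have "Re (cnj z * z) = (cmod z)\<^sup>2" for z
    unfolding cmod_power2 by (simp add: power2_eq_square)
  then show ?thesis using inner_ell2_sums[of x x] by simp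
qed

instance
proof
  fix x y z :: ell2 and r s :: real
  show "x + y + z = x + (y + z)" "x + y = y + x" "0 + x = x" "- x + x = 0"
    "x - y = x + - y"
    by (transfer; auto simp: algebra_simps)+
  show "r *\<^sub>R (x + y) = r *\<^sub>R x + r *\<^sub>R y" "(r + s) *\<^sub>R x = r *\<^sub>R x + s *\<^sub>R x"
    "r *\<^sub>R s *\<^sub>R x = (r * s) *\<^sub>R x" "1 *\<^sub>R x = x"
    by (transfer; auto simp: algebra_simps)+
  show "dist x y = norm (x - y)" by (rule dist_ell2_def)
  show "sgn x = inverse (norm x) *\<^sub>R x" by (rule sgn_ell2_def)
  show "uniformity = (INF e\<in>{0<..}. principal {(x, y :: ell2). dist x y < e})"
    by (rule uniformity_ell2_def)
  show "open U = (\<forall>x\<in>U. \<forall>\<^sub>F (x', y) in uniformity. x' = x \<longrightarrow> y \<in> U)" for U :: "ell2 set"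
    by (rule open_ell2_def)
  have "(\<lambda>n. Re (cnj (coord x n) * coord y n)) = (\<lambda>n. Re (cnj (coord y n) * coord x n))"
    by (simp add: mult.commute)
  then show "inner x y = inner y x"
    using inner_ell2_sums[of x y] inner_ell2_sums[of y x] by (auto dest: sums_unique2)
  show "inner (x + y) z = inner x z + inner y z"
  proof (rule sums_unique2[OF inner_ell2_sums])
    show "(\<lambda>n. Re (cnj (coord (x + y) n) * coord z n)) sums (inner x z + inner y z)"
      using sums_add[OF inner_ell2_sums[of x z] inner_ell2_sums[of y z]]
      by (simp add: plus_ell2.rep_eq algebra_simps)
  qed
  show "inner (r *\<^sub>R x) y = r * inner x y"
  proof (rule sums_unique2[OF inner_ell2_sums])
    show "(\<lambda>n. Re (cnj (coord (r *\<^sub>R x) n) * coord y n)) sums (r * inner x y)"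
      using sums_mult[OF inner_ell2_sums[of x y], of r]
      by (simp add: scaleR_ell2.rep_eq algebra_simps)
  qed
  show "0 \<le> inner x x"
    by (rule sums_le[OF _ sums_zero inner_self_sums]) simp
  show "(inner x x = 0) = (x = 0)"
  proof
    assume "inner x x = 0"
    then have "(\<Sum>n. (cmod (coord x n))\<^sup>2) = 0"
      using sums_unique[OF inner_self_sums[of x]] by simp
    then have "\<forall>n. (cmod (coord x n))\<^sup>2 = 0"
      using suminf_eq_zero_iff[OF summable_coord[of x]] by simp
    then show "x = 0" by (intro ell2_eqI) (simp add: zero_ell2.rep_eq)
  next
    assume "x = 0"
    then have "(\<lambda>n. 0) sums inner x x"
      using inner_self_sums[of x] by (simp add: zero_ell2.rep_eq)
    then show "inner x x = 0" by (rule sums_unique2[OF _ sums_zero])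
  qed
  show "norm x = sqrt (inner x x)" by (rule norm_ell2_def)
qed

end

lemma norm_ell2_sums: "(\<lambda>n. (cmod (coord x n))\<^sup>2) sums (norm x)\<^sup>2"
  using inner_self_sums[of x] by (simp add: power2_norm_eq_inner)

lemma coord_le_norm: "cmod (coord x n) \<le> norm x"
proof -
  have "(\<Sum>k\<in>{n}. (cmod (coord x k))\<^sup>2) \<le> (norm x)\<^sup>2"
    unfolding sums_unique[OF norm_ell2_sums[of x]] by (rule sum_le_suminf) (auto simp: summable_coord)
  then have "(cmod (coord x n))\<^sup>2 \<le> (norm x)\<^sup>2" by simp
  then show ?thesis by (rule power2_le_imp_le) simp
qed

instance ell2 :: complete_space
proof
  fix X :: "nat \<Rightarrow> ell2"
  assume X: "Cauchy X"
  have "Cauchy (\<lambda>k. coord (X k) n)" for n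
  proof (rule metric_CauchyI)
    fix e :: real assume "e > 0"
    then obtain M where M: "\<And>i j. i \<ge> M \<Longrightarrow> j \<ge> M \<Longrightarrow> dist (X i) (X j) < e"
      using metric_CauchyD[OF X, of e] by auto
    have "dist (coord (X i) n) (coord (X j) n) < e" if "i \<ge> M" "j \<ge> M" for i j
      using M[OF that] coord_le_norm[of "X i - X j" n]
      by (simp add: dist_norm minus_ell2.rep_eq)
    then show "\<exists>M. \<forall>i\<ge>M. \<forall>j\<ge>M. dist (coord (X i) n) (coord (X j) n) < e" by blast
  qed
  then have "convergent (\<lambda>k. coord (X k) n)" for n
    by (rule Cauchy_convergent)
  then have "\<forall>n. \<exists>z. (\<lambda>k. coord (X k) n) \<longlonglongrightarrow> z"
    by (simp add: convergent_def)
  from choice[OF this] obtain l where l: "\<And>n. (\<lambda>k. coord (X k) n) \<longlonglongrightarrow> l n"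
    by blast
  have bound: "summable (\<lambda>n. (cmod (coord (X i) n - l n))\<^sup>2) \<and>
      (\<Sum>n. (cmod (coord (X i) n - l n))\<^sup>2) \<le> e\<^sup>2"
    if e: "e > 0" and M: "\<And>i j. i \<ge> M \<Longrightarrow> j \<ge> M \<Longrightarrow> dist (X i) (X j) < e" and i: "i \<ge> M" for e M i
  proof -
    have part: "(\<Sum>n<m. (cmod (coord (X i) n - l n))\<^sup>2) \<le> e\<^sup>2" for m
    proof (rule tendsto_upperbound)
      show "(\<lambda>j. \<Sum>n<m. (cmod (coord (X i) n - coord (X j) n))\<^sup>2)
          \<longlonglongrightarrow> (\<Sum>n<m. (cmod (coord (X i) n - l n))\<^sup>2)"
        by (intro tendsto_intros l)
      show "\<forall>\<^sub>F j in sequentially. (\<Sum>n<m. (cmod (coord (X i) n - coord (X j) n))\<^sup>2) \<le> e\<^sup>2"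
      proof (rule eventually_sequentiallyI[of M])
        fix j assume j: "j \<ge> M"
        have "(\<Sum>n<m. (cmod (coord (X i - X j) n))\<^sup>2) \<le> (norm (X i - X j))\<^sup>2"
          unfolding sums_unique[OF norm_ell2_sums[of "X i - X j"]]
          by (rule sum_le_suminf) (auto simp: summable_coord)
        also have "\<dots> \<le> e\<^sup>2"
          using M[OF i j] by (intro power_mono) (auto simp: dist_norm)
        finally show "(\<Sum>n<m. (cmod (coord (X i) n - coord (X j) n))\<^sup>2) \<le> e\<^sup>2"
          by (simp add: minus_ell2.rep_eq)
      qed
    qed simp
    have s: "summable (\<lambda>n. (cmod (coord (X i) n - l n))\<^sup>2)"
      by (rule summableI_nonneg_bounded[OF _ part]) simp
    then show ?thesis using suminf_le_const[OF s part] by blast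
  qed
  obtain M1 where "\<And>i j. i \<ge> M1 \<Longrightarrow> j \<ge> M1 \<Longrightarrow> dist (X i) (X j) < 1"
    using metric_CauchyD[OF X, of 1] by auto
  then have "summable (\<lambda>n. (cmod (coord (X M1) n - l n))\<^sup>2)"
    using bound[of 1 M1 M1] by simp
  then have "summable (\<lambda>n. (cmod (l n - coord (X M1) n))\<^sup>2)" by (simp add: norm_minus_commute)
  from summable_sq_add[OF this summable_coord[of "X M1"]]
  have "summable (\<lambda>n. (cmod (l n))\<^sup>2)" by simp
  then have L: "coord (Abs_ell2 l) = l" by (simp add: Abs_ell2_inverse)
  have "X \<longlonglongrightarrow> Abs_ell2 l"
  proof (rule metric_LIMSEQ_I)
    fix e :: real assume e: "e > 0"
    then obtain M where M: "\<And>i j. i \<ge> M \<Longrightarrow> j \<ge> M \<Longrightarrow> dist (X i) (X j) < e / 2"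
      using metric_CauchyD[OF X, of "e/2"] by auto
    have "dist (X i) (Abs_ell2 l) < e" if "i \<ge> M" for i
    proof -
      have "(norm (X i - Abs_ell2 l))\<^sup>2 \<le> (e/2)\<^sup>2"
      proof -
        have "(\<Sum>n. (cmod (coord (X i) n - l n))\<^sup>2) \<le> (e/2)\<^sup>2"
          by (rule conjunct2, rule bound[where M = M]) (use e M that in auto)
        moreover have "(norm (X i - Abs_ell2 l))\<^sup>2 = (\<Sum>n. (cmod (coord (X i) n - l n))\<^sup>2)"
          using sums_unique[OF norm_ell2_sums[of "X i - Abs_ell2 l"]]
          by (simp only: minus_ell2.rep_eq L)
        ultimately show ?thesis by simp
      qed
      then have "norm (X i - Abs_ell2 l) \<le> e/2"
        by (rule power2_le_imp_le) (use e in simp)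
      then show ?thesis using e by (simp add: dist_norm)
    qed
    then show "\<exists>M. \<forall>i\<ge>M. dist (X i) (Abs_ell2 l) < e" by blast
  qed
  then show "convergent X" by (rule convergentI)
qed

text \<open>The common domain of \<open>a\<close> and \<open>a\<^sup>\<dagger>\<close>, i.e. the domain of the square root of the number
  operator. Outside of it both operators are set to \<open>0\<close>.\<close>

definition ladder_dom :: "ell2 set" where
  "ladder_dom = {x. summable (\<lambda>n. real n * (cmod (coord x n))\<^sup>2)}"

lift_definition annihilation :: "ell2 \<Rightarrow> ell2" is
  "\<lambda>(x :: nat \<Rightarrow> complex) n. if summable (\<lambda>m. real m * (cmod (x m))\<^sup>2)
     then sqrt (real (n + 1)) * x (n + 1) else 0"
  subgoal for x
    using summable_ignore_initial_segment[of "\<lambda>m. real m * (cmod (x m))\<^sup>2" 1]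
    by (cases "summable (\<lambda>m. real m * (cmod (x m))\<^sup>2)")
      (simp_all add: norm_mult power_mult_distrib)
  done

lift_definition creation :: "ell2 \<Rightarrow> ell2" is
  "\<lambda>(x :: nat \<Rightarrow> complex) n. if summable (\<lambda>m. real m * (cmod (x m))\<^sup>2)
     then sqrt (real n) * x (n - 1) else 0"
  subgoal for x
    using summable_add[of "\<lambda>m. (cmod (x m))\<^sup>2" "\<lambda>m. real m * (cmod (x m))\<^sup>2"]
    by (subst summable_Suc_iff[symmetric], cases "summable (\<lambda>m. real m * (cmod (x m))\<^sup>2)")
      (simp_all add: norm_mult power_mult_distrib distrib_right)
  done

lemma fock_in_ladder_dom: "fock n \<in> ladder_dom"
  unfolding ladder_dom_def mem_Collect_eq
  by (rule summable_finite[of "{n}"]) (auto simp: fock.rep_eq)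

lemma annihilation_fock: "annihilation (fock n) = sqrt (real n) *\<^sub>R fock (n - 1)"
  using fock_in_ladder_dom[of n] unfolding ladder_dom_def
  by (intro ell2_eqI)
    (cases n; auto simp: annihilation.rep_eq scaleR_ell2.rep_eq zero_ell2.rep_eq fock.rep_eq)

lemma creation_fock: "creation (fock n) = sqrt (real (n + 1)) *\<^sub>R fock (n + 1)"
  using fock_in_ladder_dom[of n] unfolding ladder_dom_def
  by (intro ell2_eqI) (auto simp: creation.rep_eq scaleR_ell2.rep_eq fock.rep_eq)

definition unitary_op :: "(ell2 \<Rightarrow> ell2) \<Rightarrow> bool" where
  "unitary_op U \<longleftrightarrow> surj U \<and> (\<forall>x y. U (x + y) = U x + U y) \<and> (\<forall>c x. U (c *\<^sub>C x) = c *\<^sub>C U x)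
     \<and> (\<forall>x y. cinner (U x) (U y) = cinner x y)"

text \<open>\<open>exp (\<alpha> (a\<^sup>\<dagger> - a))\<close> is the strongly continuous unitary group whose generator extends
  \<open>a\<^sup>\<dagger> - a\<close>. Because \<open>a\<^sup>\<dagger> - a\<close> is essentially skew-adjoint on \<^const>\<open>ladder_dom\<close> (already on the
  span of the Fock states, which are analytic vectors), there is exactly one such group.\<close>

definition displacement_group :: "(real \<Rightarrow> ell2 \<Rightarrow> ell2) \<Rightarrow> bool" where
  "displacement_group D \<longleftrightarrow>
     (\<forall>\<alpha>. unitary_op (D \<alpha>)) \<and> D 0 = id \<and> (\<forall>\<alpha> \<beta>. D (\<alpha> + \<beta>) = D \<alpha> \<circ> D \<beta>)
     \<and> (\<forall>x. continuous_on UNIV (\<lambda>\<alpha>. D \<alpha> x))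
     \<and> (\<forall>x\<in>ladder_dom. ((\<lambda>\<alpha>. D \<alpha> x) has_vector_derivative (creation x - annihilation x)) (at 0))"

definition displacement :: "real \<Rightarrow> ell2 \<Rightarrow> ell2" where
  "displacement = (THE D. displacement_group D)"

datatype outcome = Ground | Excited

fun angle_fun :: "outcome \<Rightarrow> real \<Rightarrow> real" where
  "angle_fun Ground = cos"
| "angle_fun Excited = sin"

text \<open>\<open>M\<^sub>g = cos (\<theta> + N \<phi>)\<close> and \<open>M\<^sub>e = sin (\<theta> + N \<phi>)\<close>, diagonal in the Fock basis.\<close>

lift_definition meas_op :: "real \<Rightarrow> real \<Rightarrow> outcome \<Rightarrow> ell2 \<Rightarrow> ell2" is
  "\<lambda>\<theta> \<phi> s (x :: nat \<Rightarrow> complex) n. of_real (angle_fun s (\<theta> + real n * \<phi>)) * x n"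
  subgoal for \<theta> \<phi> s x
    by (rule summable_sq_bounded_mult[where B = 1]) (cases s; auto)+
  done

lemma meas_op_fock:
  "meas_op \<theta> \<phi> s (fock n) = angle_fun s (\<theta> + real n * \<phi>) *\<^sub>R fock n"
  by (intro ell2_eqI) (auto simp: meas_op.rep_eq scaleR_ell2.rep_eq fock.rep_eq)

definition nondegenerate_eigenvalues :: "(ell2 \<Rightarrow> ell2) \<Rightarrow> bool" where
  "nondegenerate_eigenvalues T \<longleftrightarrow>
     (\<forall>l x y. x \<noteq> 0 \<and> T x = l *\<^sub>C x \<and> T y = l *\<^sub>C y \<longrightarrow> (\<exists>c. y = c *\<^sub>C x))"

definition sigma :: "nat \<Rightarrow> nat \<Rightarrow> real" where
  "sigma nbar n =
     (if n = 0 then 1 / 8 + (\<Sum>k=1..nbar. 1 / real k - 1 / (real k)\<^sup>2)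
      else if n < nbar then \<Sum>k=n+1..nbar. 1 / real k - 1 / (real k)\<^sup>2
      else if n = nbar then 0
      else \<Sum>k=nbar+1..n. 1 / real k + 1 / (real k)\<^sup>2)"

definition lyapunov :: "real \<Rightarrow> real \<Rightarrow> nat \<Rightarrow> real \<Rightarrow> ell2 \<Rightarrow> ereal" where
  "lyapunov \<theta> \<phi> nbar \<delta> \<psi> =
     (\<Sum>n. ereal (sigma nbar n * (cmod (cinner \<psi> (fock n)))\<^sup>2))
     + ereal (\<delta> * (cos (\<theta> + real nbar * \<phi>) ^ 4 + sin (\<theta> + real nbar * \<phi>) ^ 4
                   - norm (meas_op \<theta> \<phi> Ground \<psi>) ^ 4 - norm (meas_op \<theta> \<phi> Excited \<psi>) ^ 4))"

abbreviation unit_sphere :: "ell2 set" where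
  "unit_sphere \<equiv> sphere 0 1"

definition sphere_borel :: "ell2 measure" where
  "sphere_borel = restrict_space borel unit_sphere"

definition prob_measures :: "ell2 measure set" where
  "prob_measures = {\<mu>. prob_space \<mu> \<and> sets \<mu> = sets sphere_borel}"

definition feedback :: "real \<Rightarrow> real \<Rightarrow> nat \<Rightarrow> real \<Rightarrow> real \<Rightarrow> (ell2 \<Rightarrow> real) \<Rightarrow> bool" where
  "feedback \<theta> \<phi> nbar \<delta> \<alpha>bar f \<longleftrightarrow> f \<in> borel_measurable sphere_borel \<and>
     (\<forall>\<psi>\<in>unit_sphere. is_arg_min (\<lambda>\<alpha>. lyapunov \<theta> \<phi> nbar \<delta> (displacement \<alpha> \<psi>))
                                 (\<lambda>\<alpha>. \<alpha> \<in> {-\<alpha>bar..\<alpha>bar}) (f \<psi>))"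

text \<open>If \<open>M\<^sub>s \<psi> = 0\<close>, the outcome \<open>s\<close> has probability zero; the value \<open>\<psi>\<close> then
  only serves to stay on the unit sphere.\<close>

definition post_meas :: "real \<Rightarrow> real \<Rightarrow> outcome \<Rightarrow> ell2 \<Rightarrow> ell2" where
  "post_meas \<theta> \<phi> s \<psi> =
     (if meas_op \<theta> \<phi> s \<psi> = 0 then \<psi> else meas_op \<theta> \<phi> s \<psi> /\<^sub>R norm (meas_op \<theta> \<phi> s \<psi>))"

definition transition :: "real \<Rightarrow> real \<Rightarrow> (ell2 \<Rightarrow> real) \<Rightarrow> ell2 \<Rightarrow> ell2 measure" where
  "transition \<theta> \<phi> f \<psi> =
     distr (density (count_space UNIV) (\<lambda>s. ennreal ((norm (meas_op \<theta> \<phi> s \<psi>))\<^sup>2))) sphere_borel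
       (\<lambda>s. displacement (f (post_meas \<theta> \<phi> s \<psi>)) (post_meas \<theta> \<phi> s \<psi>))"

text \<open>The minimizer need not be unique and may be selected differently at each time \<open>k\<close>, hence the
  feedback law \<open>f k\<close>.\<close>

primrec law :: "real \<Rightarrow> real \<Rightarrow> (nat \<Rightarrow> ell2 \<Rightarrow> real) \<Rightarrow> ell2 measure \<Rightarrow> nat \<Rightarrow> ell2 measure" where
  "law \<theta> \<phi> f \<mu> 0 = \<mu>"
| "law \<theta> \<phi> f \<mu> (Suc k) = law \<theta> \<phi> f \<mu> k \<bind> transition \<theta> \<phi> (f k)"

definition weak_star_conv :: "(nat \<Rightarrow> ell2 measure) \<Rightarrow> ell2 measure \<Rightarrow> bool" where
  "weak_star_conv X \<mu> \<longleftrightarrow>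
     (\<forall>g :: ell2 \<Rightarrow> real. continuous_on unit_sphere g \<and> bounded (g ` unit_sphere) \<longrightarrow>
        (\<lambda>n. \<integral>x. g x \<partial>X n) \<longlonglongrightarrow> (\<integral>x. g x \<partial>\<mu>))"

definition limit_set :: "(nat \<Rightarrow> ell2 measure) \<Rightarrow> ell2 measure set" where
  "limit_set X = {\<mu> \<in> prob_measures. \<exists>r. strict_mono r \<and> weak_star_conv (X \<circ> r) \<mu>}"

definition converges_to_limit_set :: "(nat \<Rightarrow> ell2 measure) \<Rightarrow> bool" where
  "converges_to_limit_set X \<longleftrightarrow>
     (\<forall>r :: nat \<Rightarrow> nat. strict_mono r \<longrightarrow>
        (\<exists>s :: nat \<Rightarrow> nat. strict_mono s \<and> (\<exists>\<mu>\<in>limit_set X. weak_star_conv (X \<circ> r \<circ> s) \<mu>)))"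

definition supp :: "ell2 measure \<Rightarrow> ell2 set" where
  "supp \<mu> = {x \<in> unit_sphere.
     \<forall>W. openin (top_of_set unit_sphere) W \<and> x \<in> W \<longrightarrow> emeasure \<mu> W > 0}"

definition fock_ray :: "nat \<Rightarrow> ell2 set" where
  "fock_ray n = {c *\<^sub>C fock n | c. cmod c = 1}"

end

theory Submission
  imports Defs
begin

text \<open>The energy \<open>\<Sum>n. \<sigma>\<^sub>n |\<psi>\<^sub>n|\<^sup>2\<close> is a martingale under the measurement, while the term
  \<open>- \<parallel>M\<^sub>g \<psi>\<parallel>\<^sup>4 - \<parallel>M\<^sub>e \<psi>\<parallel>\<^sup>4\<close> decreases in expectation by at least 8 times the squared variance of
  \<open>cos\<^sup>2 \<phi>\<^sub>n\<close> under the distribution \<open>|\<psi>\<^sub>n|\<^sup>2\<close>. Since the feedback can only lower \<open>V\<close>, the expectations of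
  these decreases are summable, so the variance tends to 0 and the laws concentrate near the Fock
  states, where \<open>cos\<^sup>2 \<phi>\<^sub>n\<close> are distinct by A1; mass cannot escape to infinity because \<open>\<sigma>\<^sub>n \<longlonglongrightarrow> \<infinity>\<close>.

  Near \<open>|n\<rangle>\<close>, \<open>n \<noteq> nbar\<close>, a small displacement lowers the energy to second order, by the
  choice of \<open>\<sigma>\<close>. The logarithmic growth of \<open>\<sigma>\<close> makes the commutator of \<open>\<sigma>(N)\<close> with \<open>a\<^sup>\<dagger> - a\<close> bounded, so
  this gain is uniform on a norm neighbourhood of \<open>|n\<rangle>\<close>, even though the energy is not continuous
  there. For small \<open>\<delta>\<close> the gain survives in \<open>V\<close> for all \<open>n \<le> N\<close>, hence these states have no mass
  in the limit, and the states \<open>n > N\<close> carry mass at most \<open>\<epsilon>\<close> by the bound on the expected energy.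

  The displacement group is constructed from its action on coherent states, whose Gram matrix
  \<open>exp (- (b - c)\<^sup>2 / 2)\<close> is translation invariant. Weak limits are obtained from Helly's theorem on
  the real line, after coding the circles of multiples of the Fock states as disjoint intervals.\<close>

section \<open>Square-summable sequences\<close>

text \<open>The order of the constants shapes the argument. C and \<epsilon> fix the level N first;
  \<delta> then has to be small only against the curvatures of the finitely many levels n \<le> N.
  It can be chosen before any displacement a, because at a Fock state the \<delta>-term, like the
  energy, changes only to second order in a.

  The energy is infinite on a dense set and merely lower semicontinuous. Estimates are therefore
  proved for truncated weights, with constants independent of the truncation; they are stated
  additively, since infinite values cannot be subtracted, and V is replaced by the nonnegative V +
  \<delta>. Only the decreases of V, which are minorised by continuous functions, are passed to the
  weak limit.

  The control acts after the measurement, while its gain has to be known as a function of the state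
  before it. The gain near the state n is minorised by a convex function of the population of n.
  That population is a martingale under the measurement, so Jensen's inequality carries the bound
  back.\<close>

instance ell2 :: banach ..

lemmas coord_simps = plus_ell2.rep_eq minus_ell2.rep_eq uminus_ell2.rep_eq zero_ell2.rep_eq
  scaleR_ell2.rep_eq scaleC.rep_eq fock.rep_eq

lemma coord_sum: "coord (\<Sum>i\<in>A. f i) n = (\<Sum>i\<in>A. coord (f i) n)"
  by (induction A rule: infinite_finite_induct) (auto simp: coord_simps)

lemma norm_le_coordI:
  assumes "\<And>n. cmod (coord x n) \<le> cmod (coord y n)"
  shows "norm x \<le> norm y"
proof (rule power2_le_imp_le)
  show "(norm x)\<^sup>2 \<le> (norm y)\<^sup>2"
    by (rule sums_le[OF _ norm_ell2_sums norm_ell2_sums]) (simp add: assms power_mono)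
qed simp

lemma norm_le_coord_lowerI:
  assumes "\<And>n. cmod (coord x n) \<le> cmod (coord y (Suc n))"
  shows "norm x \<le> norm y"
proof (rule power2_le_imp_le)
  have "(\<lambda>n. (cmod (coord y (Suc n)))\<^sup>2) sums ((norm y)\<^sup>2 - (cmod (coord y 0))\<^sup>2)"
    using norm_ell2_sums[of y] by (subst sums_Suc_iff) simp
  then have "(norm x)\<^sup>2 \<le> (norm y)\<^sup>2 - (cmod (coord y 0))\<^sup>2"
    by (rule sums_le[OF _ norm_ell2_sums, rotated]) (simp add: assms power_mono)
  also have "\<dots> \<le> (norm y)\<^sup>2" by simp
  finally show "(norm x)\<^sup>2 \<le> (norm y)\<^sup>2" .
qed simp

lemma norm_le_coord_raiseI:
  assumes "coord x 0 = 0" "\<And>n. cmod (coord x (Suc n)) \<le> cmod (coord y n)"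
  shows "norm x \<le> norm y"
proof (rule power2_le_imp_le)
  have "(\<lambda>n. (cmod (coord x (Suc n)))\<^sup>2) sums (norm x)\<^sup>2"
    using norm_ell2_sums[of x] assms(1) by (subst sums_Suc_iff) simp
  then show "(norm x)\<^sup>2 \<le> (norm y)\<^sup>2"
    by (rule sums_le[OF _ _ norm_ell2_sums, rotated]) (simp add: assms power_mono)
qed simp

lemma norm_scaleC: "norm (c *\<^sub>C x) = cmod c * norm x"
proof (rule power2_eq_imp_eq)
  have "(\<lambda>n. (cmod (coord (c *\<^sub>C x) n))\<^sup>2) sums ((cmod c)\<^sup>2 * (norm x)\<^sup>2)"
    using sums_mult[OF norm_ell2_sums] by (simp add: coord_simps norm_mult power_mult_distrib)
  then show "(norm (c *\<^sub>C x))\<^sup>2 = (cmod c * norm x)\<^sup>2"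
    using sums_unique2[OF norm_ell2_sums] by (simp add: power_mult_distrib)
qed auto

lemma scaleC_simps:
  "c *\<^sub>C (x + y) = c *\<^sub>C x + c *\<^sub>C y" "c *\<^sub>C (x - y) = c *\<^sub>C x - c *\<^sub>C y"
  "c *\<^sub>C 0 = 0" "c *\<^sub>C (d *\<^sub>C x) = (c * d) *\<^sub>C x" "1 *\<^sub>C x = x" "0 *\<^sub>C x = 0"
  "c *\<^sub>C (r *\<^sub>R x) = r *\<^sub>R (c *\<^sub>C x)" "c *\<^sub>C (- x) = - (c *\<^sub>C x)"
  by (auto intro!: ell2_eqI simp: coord_simps algebra_simps)

lemma scaleR_eq_scaleC: "r *\<^sub>R x = of_real r *\<^sub>C x"
  by (auto intro!: ell2_eqI simp: coord_simps)

lemma bounded_linear_scaleC: "bounded_linear (\<lambda>x. c *\<^sub>C x)"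
  by (rule bounded_linear_intro[of _ "cmod c"]) (auto simp: norm_scaleC scaleC_simps)

lemma bounded_linear_coord: "bounded_linear (\<lambda>x. coord x n)"
  by (rule bounded_linear_intro[of _ 1])
     (auto simp: coord_simps coord_le_norm scaleR_conv_of_real)

lemmas tendsto_coord = bounded_linear.tendsto[OF bounded_linear_coord]
lemmas tendsto_scaleC = bounded_linear.tendsto[OF bounded_linear_scaleC]
lemmas continuous_on_coord = bounded_linear.continuous_on[OF bounded_linear_coord]

lemma cinner_sums: "(\<lambda>n. cnj (coord x n) * coord y n) sums cinner x y"
  unfolding cinner_def by (intro summable_sums summable_cinner)

lemma inner_eq_Re_cinner: "inner x y = Re (cinner x y)"
  by (rule inner_ell2_def)

lemma cinner_scaleC_right: "cinner x (c *\<^sub>C y) = c * cinner x y"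
  by (rule sums_unique2[OF cinner_sums])
     (use sums_mult[OF cinner_sums] in \<open>simp add: coord_simps algebra_simps\<close>)

lemma cinner_scaleC_left: "cinner (c *\<^sub>C x) y = cnj c * cinner x y"
  by (rule sums_unique2[OF cinner_sums])
     (use sums_mult[OF cinner_sums] in \<open>simp add: coord_simps algebra_simps\<close>)

lemma cinner_add_right: "cinner x (y + z) = cinner x y + cinner x z"
  by (rule sums_unique2[OF cinner_sums])
     (use sums_add[OF cinner_sums cinner_sums] in \<open>simp add: coord_simps algebra_simps\<close>)

lemma cinner_add_left: "cinner (x + y) z = cinner x z + cinner y z"
  by (rule sums_unique2[OF cinner_sums])
     (use sums_add[OF cinner_sums cinner_sums] in \<open>simp add: coord_simps algebra_simps\<close>)

lemma cinner_zero: "cinner 0 y = 0" "cinner x 0 = 0"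
  by (simp_all add: cinner_def coord_simps)

text \<open>Since Im z = - Re (i z), the real inner product determines the complex one. A
  complex-linear map that preserves \<open>inner\<close> therefore preserves \<open>cinner\<close>,
  which is how \<open>cinner_disp\<close> is obtained.\<close>

lemma cinner_eq_inner: "cinner x y = Complex (inner x y) (- inner x (\<i> *\<^sub>C y))"
  by (simp add: inner_eq_Re_cinner cinner_scaleC_right complex_eq_iff)

lemma cinner_fock: "cinner x (fock n) = cnj (coord x n)"
  by (rule sums_unique2[OF cinner_sums])
     (use sums_single[of n "\<lambda>m. cnj (coord x m)"] in \<open>simp add: coord_simps if_distrib cong: if_cong\<close>)

lemma norm_fock [simp]: "norm (fock n) = 1"
proof -
  have "(\<lambda>m. (cmod (coord (fock n) m))\<^sup>2) = (\<lambda>m. if m = n then 1 else 0)"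
    by (auto simp: coord_simps)
  then have "(norm (fock n))\<^sup>2 = 1"
    using norm_ell2_sums[of "fock n"] sums_single[of n "\<lambda>_. 1 :: real"]
    by (auto dest: sums_unique2)
  then show ?thesis by (simp add: power2_eq_1_iff)
      (use norm_ge_zero[of "fock n"] in linarith)
qed

text \<open>Identities and regularity properties are extended from a total family of vectors to the
  whole space by showing that the vectors satisfying them form such a set.\<close>

definition closed_csubspace :: "ell2 set \<Rightarrow> bool" where
  "closed_csubspace Z \<longleftrightarrow> closed Z \<and> 0 \<in> Z \<and> (\<forall>x\<in>Z. \<forall>y\<in>Z. x + y \<in> Z) \<and> (\<forall>c. \<forall>x\<in>Z. c *\<^sub>C x \<in> Z)"

lemma closed_csubspaceD:
  assumes "closed_csubspace Z"
  shows "closed Z" "0 \<in> Z" "x \<in> Z \<Longrightarrow> y \<in> Z \<Longrightarrow> x + y \<in> Z" "x \<in> Z \<Longrightarrow> c *\<^sub>C x \<in> Z"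
  using assms by (auto simp: closed_csubspace_def)

lemma closed_csubspace_sum:
  assumes "closed_csubspace Z" "\<And>i. i \<in> A \<Longrightarrow> f i \<in> Z"
  shows "sum f A \<in> Z"
  using assms(2) by (induction A rule: infinite_finite_induct)
    (auto intro: closed_csubspaceD[OF assms(1)])

lemma closed_csubspace_diff:
  assumes "closed_csubspace Z" "x \<in> Z" "y \<in> Z"
  shows "x - y \<in> Z"
proof -
  have "x - y = x + (-1) *\<^sub>C y" by (auto intro!: ell2_eqI simp: coord_simps)
  then show ?thesis using assms closed_csubspaceD[OF assms(1)] by metis
qed

lemma coord_fock_sum: "coord (\<Sum>m<N. c m *\<^sub>C fock m) n = (if n < N then c n else 0)"
proof -
  have "coord (\<Sum>m<N. c m *\<^sub>C fock m) n = (\<Sum>m<N. if n = m then c m else 0)"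
    unfolding coord_sum by (rule sum.cong) (auto simp: coord_simps)
  then show ?thesis by simp
qed

lemma fock_expansion: "(\<lambda>N. \<Sum>m<N. coord x m *\<^sub>C fock m) \<longlonglongrightarrow> x"
proof -
  let ?t = "\<lambda>N. \<Sum>m<N. coord x m *\<^sub>C fock m"
  have "(norm (x - ?t N))\<^sup>2 = (norm x)\<^sup>2 - (\<Sum>n<N. (cmod (coord x n))\<^sup>2)" for N
  proof -
    have fin: "(\<lambda>n. if n \<in> {..<N} then (cmod (coord x n))\<^sup>2 else 0) sums (\<Sum>n<N. (cmod (coord x n))\<^sup>2)"
      by (rule sums_If_finite_set) simp
    have "(\<lambda>n. (cmod (coord (x - ?t N) n))\<^sup>2)
        = (\<lambda>n. (cmod (coord x n))\<^sup>2 - (if n \<in> {..<N} then (cmod (coord x n))\<^sup>2 else 0))"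
      by (auto simp: coord_fock_sum minus_ell2.rep_eq)
    then show ?thesis
      using sums_unique2[OF norm_ell2_sums[of "x - ?t N"]] sums_diff[OF norm_ell2_sums[of x] fin] by simp
  qed
  moreover have "(\<lambda>N. (norm x)\<^sup>2 - (\<Sum>n<N. (cmod (coord x n))\<^sup>2)) \<longlonglongrightarrow> (norm x)\<^sup>2 - (norm x)\<^sup>2"
    by (intro tendsto_intros) (use norm_ell2_sums[of x] in \<open>simp add: sums_def\<close>)
  ultimately have "(\<lambda>N. sqrt ((norm (x - ?t N))\<^sup>2)) \<longlonglongrightarrow> sqrt 0"
    by (intro tendsto_real_sqrt) simp
  then have "(\<lambda>N. norm (?t N - x)) \<longlonglongrightarrow> 0" by (simp add: norm_minus_commute)
  then show ?thesis by (simp add: LIM_zero_iff tendsto_norm_zero_iff)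
qed

lemma fock_dense:
  assumes "closed_csubspace Z" "\<And>n. fock n \<in> Z"
  shows "x \<in> Z"
proof (rule closed_sequentially[OF closed_csubspaceD(1)[OF assms(1)] _ fock_expansion])
  show "(\<Sum>m<N. coord x m *\<^sub>C fock m) \<in> Z" for N
    by (intro closed_csubspace_sum assms closed_csubspaceD(4))
qed

text \<open>A fixed square-summable majorant for the tails of the power series below; its ratio 1/2
  is the bound imposed there on b.\<close>

lift_definition geometric_vec :: ell2 is "\<lambda>m. (1/2) ^ m"
proof -
  have "summable (\<lambda>n. (1/4 :: real) ^ n)" by (rule summable_geometric) simp
  moreover have "(cmod ((1/2) ^ n))\<^sup>2 = (1/4) ^ n" for n
  proof -
    have "(cmod ((1/2) ^ n))\<^sup>2 = (cmod (1/2) * cmod (1/2)) ^ n"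
      by (simp only: norm_power power2_eq_square power_mult_distrib)
    then show ?thesis by (simp add: norm_divide)
  qed
  ultimately show "summable (\<lambda>n. (cmod ((1/2) ^ n))\<^sup>2)" by simp
qed

text \<open>Dividing out the first \<open>n\<close> terms of the power series and letting \<open>b \<longlongrightarrow> 0\<close> isolates
  the \<open>n\<close>-th coefficient.\<close>

lemma power_series_dense:
  assumes Z: "closed_csubspace Z"
    and v: "\<And>b. 0 < b \<Longrightarrow> b < 1/2 \<Longrightarrow> v b \<in> Z"
    and co: "\<And>b n. 0 < b \<Longrightarrow> b < 1/2 \<Longrightarrow> coord (v b) n = of_real (c n * b ^ n)"
    and c0: "\<And>n. c n \<noteq> (0::real)" and cK: "\<And>n. \<bar>c n\<bar> \<le> K"
  shows "x \<in> Z"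
proof (rule fock_dense[OF Z])
  fix n show "fock n \<in> Z"
  proof (induction n rule: less_induct)
    case (less n)
    define b where "b k = 1 / (3 + real k)" for k
    have b: "0 < b k" "b k < 1/2" for k by (auto simp: b_def)
    have K0: "0 \<le> K" using cK[of 0] by linarith
    define w where "w k = of_real (1 / b k ^ n) *\<^sub>C (v (b k) - (\<Sum>m<n. of_real (c m * b k ^ m) *\<^sub>C fock m))" for k
    have wZ: "w k \<in> Z" for k
      unfolding w_def using less b
      by (intro closed_csubspaceD(4)[OF Z] closed_csubspace_diff[OF Z] closed_csubspace_sum[OF Z] v) auto
    have wc: "coord (w k) m = (if m < n then 0 else of_real (c m * b k ^ (m - n)))" for k m
      using b[of k] by (auto simp: w_def coord_simps coord_fock_sum co power_diff)
    \<comment> \<open>Every coefficient of index m > n still carries the factor b k, and b k < 1/2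
      bounds the rest by a geometric sequence, so the error is of order b k. The power 2^(n + 1)
      realigns the exponent m - n - 1 with m.\<close>
    have "norm (w k - of_real (c n) *\<^sub>C fock n) \<le> (K * 2 ^ (n + 1) * b k) * norm geometric_vec" for k
    proof -
      have "norm (w k - of_real (c n) *\<^sub>C fock n) \<le> norm ((K * 2 ^ (n + 1) * b k) *\<^sub>R geometric_vec)"
      proof (rule norm_le_coordI)
        fix m
        have pos: "0 \<le> K * 2 ^ (n + 1) * b k" using b[of k] K0 by simp
        consider "m \<le> n" | d where "m = n + Suc d"
          by (metis add_Suc_right less_imp_Suc_add not_le)
        then show "cmod (coord (w k - of_real (c n) *\<^sub>C fock n) m)
            \<le> cmod (coord ((K * 2 ^ (n + 1) * b k) *\<^sub>R geometric_vec) m)"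
        proof cases
          case 1
          then show ?thesis using pos
            by (cases "m = n") (auto simp: coord_simps wc)
        next
          case 2
          have "\<bar>c m\<bar> * b k ^ Suc d \<le> K * (b k * (1/2) ^ d)"
            using b[of k] cK[of m] by (intro mult_mono) (auto intro!: mult_left_mono power_mono)
          also have "\<dots> = (K * 2 ^ (n + 1) * b k) * (1/2) ^ m"
            by (simp add: 2 power_add field_simps)
          finally show ?thesis using pos b[of k] 2
            by (simp add: coord_simps wc geometric_vec.rep_eq norm_mult norm_power norm_divide abs_mult power_abs K0)
        qed
      qed
      then show ?thesis using b[of k] K0 by simp
    qed
    moreover have "(\<lambda>k. (K * 2 ^ (n + 1) * b k) * norm geometric_vec) \<longlonglongrightarrow> 0"
    proof -
      have "b \<longlonglongrightarrow> 0" unfolding b_def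
        by (intro real_tendsto_divide_at_top[OF tendsto_const]
            filterlim_tendsto_add_at_top[OF tendsto_const] filterlim_real_sequentially)
      then show ?thesis by (auto intro!: tendsto_eq_intros)
    qed
    ultimately have "(\<lambda>k. w k - of_real (c n) *\<^sub>C fock n) \<longlonglongrightarrow> 0"
      by (rule_tac tendsto_norm_zero_cancel, rule_tac tendsto_sandwich[OF _ _ tendsto_const])
        (auto intro: always_eventually)
    then have "w \<longlonglongrightarrow> of_real (c n) *\<^sub>C fock n" by (simp add: LIM_zero_iff)
    then have "of_real (c n) *\<^sub>C fock n \<in> Z"
      using closed_sequentially[OF closed_csubspaceD(1)[OF Z], of w] wZ by blast
    then have "of_real (1 / c n) *\<^sub>C (of_real (c n) *\<^sub>C fock n) \<in> Z"
      by (rule closed_csubspaceD(4)[OF Z])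
    then show ?case using c0[of n] by (simp add: scaleC_simps)
  qed
qed

section \<open>Exponential vectors and coherent states\<close>

lemma summable_power2_over_fact: "summable (\<lambda>m. (cmod (of_real ((b::real) ^ m / sqrt (fact m))))\<^sup>2)"
proof -
  have "summable (\<lambda>m. inverse (fact m) * (b\<^sup>2) ^ m)" by (rule summable_exp)
  moreover have "(cmod (of_real (b ^ m / sqrt (fact m))))\<^sup>2 = inverse (fact m) * (b\<^sup>2) ^ m" for m
    unfolding norm_of_real power2_abs by (simp add: power_divide power_mult[symmetric] mult.commute field_simps)
  ultimately show ?thesis by simp
qed

lift_definition exp_vec :: "real \<Rightarrow> ell2" is "\<lambda>b m. of_real (b ^ m / sqrt (fact m))"
  by (rule summable_power2_over_fact)

text \<open>The factor normalises, because \<open>exp_vec b\<close> has squared norm exp (b^2) by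
  \<open>cinner_exp_vec\<close>.\<close>

definition coherent :: "real \<Rightarrow> ell2" where
  "coherent b = exp (- b\<^sup>2 / 2) *\<^sub>R exp_vec b"

lemma cinner_exp_vec: "cinner (exp_vec b) (exp_vec c) = of_real (exp (b * c))"
proof (rule sums_unique2[OF cinner_sums])
  have "(\<lambda>n. of_real ((b * c) ^ n /\<^sub>R fact n)) sums (of_real (exp (b * c)) :: complex)"
    by (rule sums_of_real[OF exp_converges])
  moreover have "complex_of_real ((b * c) ^ n /\<^sub>R fact n) = cnj (coord (exp_vec b) n) * coord (exp_vec c) n" for n
    unfolding exp_vec.rep_eq complex_cnj_complex_of_real of_real_mult[symmetric] of_real_eq_iff
    by (simp add: power_mult_distrib field_simps)
  ultimately show "(\<lambda>n. cnj (coord (exp_vec b) n) * coord (exp_vec c) n) sums of_real (exp (b * c))"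
    by simp
qed

lemma cinner_coherent: "cinner (coherent b) (coherent c) = of_real (exp (- (b - c)\<^sup>2 / 2))"
proof -
  have "cinner (coherent b) (coherent c) = of_real (exp (- b\<^sup>2 / 2) * exp (- c\<^sup>2 / 2) * exp (b * c))"
    by (simp add: coherent_def scaleR_eq_scaleC cinner_scaleC_left cinner_scaleC_right cinner_exp_vec)
  also have "exp (- b\<^sup>2 / 2) * exp (- c\<^sup>2 / 2) * exp (b * c) = exp (- (b - c)\<^sup>2 / 2)"
    by (simp add: exp_add[symmetric] power2_diff field_simps)
  finally show ?thesis .
qed

section \<open>The displacement group\<close>

lemma closed_csubspaceI:
  assumes "closed Z" "0 \<in> Z" "\<And>x y. x \<in> Z \<Longrightarrow> y \<in> Z \<Longrightarrow> x + y \<in> Z" "\<And>c x. x \<in> Z \<Longrightarrow> c *\<^sub>C x \<in> Z"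
  shows "closed_csubspace Z"
  using assms unfolding closed_csubspace_def by blast

text \<open>Lists of pairs (coefficient, parameter) serve as formal linear combinations of coherent
  states; on them translations are defined without a choice of representatives.\<close>

definition comb :: "(complex \<times> real) list \<Rightarrow> ell2" where
  "comb L = (\<Sum>(c, b)\<leftarrow>L. c *\<^sub>C coherent b)"

definition translate :: "real \<Rightarrow> (complex \<times> real) list \<Rightarrow> (complex \<times> real) list" where
  "translate a L = map (\<lambda>(c, b). (c, a + b)) L"

definition scale :: "complex \<Rightarrow> (complex \<times> real) list \<Rightarrow> (complex \<times> real) list" where
  "scale d L = map (\<lambda>(c, b). (d * c, b)) L"

lemma comb_simps [simp]:
  "comb [] = 0" "comb ((c, b) # L) = c *\<^sub>C coherent b + comb L" "comb (L @ L') = comb L + comb L'"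
  by (simp_all add: comb_def)

lemma translate_simps [simp]:
  "translate a [] = []" "translate a ((c, b) # L) = (c, a + b) # translate a L"
  "translate a (L @ L') = translate a L @ translate a L'" "translate 0 L = L" "translate a (translate a' L) = translate (a + a') L"
  by (auto simp: translate_def case_prod_beta o_def add.assoc)

lemma comb_scale [simp]: "comb (scale d L) = d *\<^sub>C comb L"
  by (induction L) (auto simp: scale_def scaleC_simps)

lemma translate_scale: "translate a (scale d L) = scale d (translate a L)"
  by (induction L) (auto simp: scale_def)

lemma cinner_comb_translate: "cinner (comb (translate a L)) (comb (translate a L')) = cinner (comb L) (comb L')"
proof -
  have *: "cinner (coherent (a + b)) (comb (translate a L')) = cinner (coherent b) (comb L')" for b
    by (induction L') (auto simp: cinner_zero cinner_add_right cinner_scaleC_right cinner_coherent)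
  show ?thesis
    by (induction L) (auto simp: cinner_zero cinner_add_left cinner_scaleC_left *)
qed

lemma norm_comb_translate: "norm (comb (translate a L)) = norm (comb L)"
  by (simp add: norm_eq_sqrt_inner inner_eq_Re_cinner cinner_comb_translate)

text \<open>The difference of two combinations is again a combination, that of
  \<open>L @ scale (-1) L'\<close>, so the norm identity applies to it. In particular, lists that
  represent the same vector have translates that represent the same vector.\<close>

lemma dist_comb_translate: "dist (comb (translate a L)) (comb (translate a L')) = dist (comb L) (comb L')"
proof -
  have *: "x - y = x + (-1) *\<^sub>C y" for x y by (auto intro!: ell2_eqI simp: coord_simps)
  have "dist (comb L) (comb L') = norm (comb (L @ scale (-1) L'))" for L L'
    by (simp only: dist_norm * comb_simps comb_scale)
  then show ?thesis
    using norm_comb_translate[of a "L @ scale (-1) L'"] by (simp add: translate_scale)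
qed

lemma comb_dense: "x \<in> closure (range comb)"
proof -
  have "closed_csubspace (closure (range comb))"
  proof (rule closed_csubspaceI)
    show "0 \<in> closure (range comb)"
      by (rule subsetD[OF closure_subset], rule image_eqI[of _ _ "[]"]) simp_all
  next
    fix u v assume "u \<in> closure (range comb)" "v \<in> closure (range comb)"
    then obtain f g where f: "\<And>n. f n \<in> range comb" "f \<longlonglongrightarrow> u" and g: "\<And>n. g n \<in> range comb" "g \<longlonglongrightarrow> v"
      unfolding closure_sequential by blast
    have "f n + g n \<in> range comb" for n
    proof -
      obtain L L' where "f n = comb L" "g n = comb L'" using f(1)[of n] g(1)[of n] by blast
      then have "f n + g n = comb (L @ L')" by simp
      then show ?thesis by (rule range_eqI)
    qed
    with tendsto_add[OF f(2) g(2)] show "u + v \<in> closure (range comb)"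
      unfolding closure_sequential by (intro exI[of _ "\<lambda>n. f n + g n"] conjI allI)
  next
    fix c u assume "u \<in> closure (range comb)"
    then obtain f where f: "\<And>n. f n \<in> range comb" "f \<longlonglongrightarrow> u"
      unfolding closure_sequential by blast
    have "c *\<^sub>C f n \<in> range comb" for n
    proof -
      obtain L where "f n = comb L" using f(1)[of n] by blast
      then have "c *\<^sub>C f n = comb (scale c L)" by simp
      then show ?thesis by (rule range_eqI)
    qed
    with tendsto_scaleC[OF f(2)] show "c *\<^sub>C u \<in> closure (range comb)"
      unfolding closure_sequential by (intro exI[of _ "\<lambda>n. c *\<^sub>C f n"] conjI allI)
  qed simp
  moreover have "exp_vec b \<in> closure (range comb)" for b
  proof -
    have "exp_vec b = (exp (b\<^sup>2 / 2) * exp (- b\<^sup>2 / 2)) *\<^sub>R exp_vec b"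
      by (simp add: exp_add[symmetric])
    also have "\<dots> = comb [(of_real (exp (b\<^sup>2 / 2)), b)]"
      by (simp add: coherent_def scaleR_eq_scaleC[symmetric])
    finally show ?thesis
      using subsetD[OF closure_subset rangeI[of comb "[(of_real (exp (b\<^sup>2 / 2)), b)]"]] by (simp only:)
  qed
  ultimately show ?thesis
    by (rule power_series_dense[where c = "\<lambda>n. 1 / sqrt (fact n)" and K = 1])
      (auto simp: exp_vec.rep_eq)
qed

definition approx :: "ell2 \<Rightarrow> nat \<Rightarrow> (complex \<times> real) list" where
  "approx x j = (SOME L. dist (comb L) x < 1 / Suc j)"

lemma approx_tendsto: "(\<lambda>j. comb (approx x j)) \<longlonglongrightarrow> x"
proof -
  have "\<exists>L. dist (comb L) x < 1 / Suc j" for j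
    using comb_dense[of x] unfolding closure_approachable
    by (metis of_nat_0_less_iff rangeE zero_less_Suc zero_less_divide_1_iff)
  then have "dist (comb (approx x j)) x < 1 / Suc j" for j
    unfolding approx_def by (rule someI_ex)
  then have "(\<lambda>j. dist (comb (approx x j)) x) \<longlonglongrightarrow> 0"
    by (intro tendsto_sandwich[OF _ _ tendsto_const lim_1_over_n[THEN LIMSEQ_Suc]])
      (auto intro!: always_eventually less_imp_le simp del: of_nat_Suc)
  then show ?thesis by (rule tendsto_dist_iff[THEN iffD2])
qed

text \<open>The continuous extension of the isometry that sends \<open>comb L\<close> to
  \<open>comb (translate a L)\<close>; the limit exists because this isometry maps Cauchy sequences
  to Cauchy sequences.\<close>

definition disp :: "real \<Rightarrow> ell2 \<Rightarrow> ell2" where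
  "disp a x = lim (\<lambda>j. comb (translate a (approx x j)))"

text \<open>Independence of the approximating sequence: two sequences with the same limit stay
  equally close after translation. The algebraic laws of \<open>disp\<close> then follow by
  computing one limit in two ways.\<close>

lemma disp_tendsto:
  assumes L: "(\<lambda>j. comb (L j)) \<longlonglongrightarrow> x"
  shows "(\<lambda>j. comb (translate a (L j))) \<longlonglongrightarrow> disp a x"
proof -
  have "Cauchy (\<lambda>j. comb (approx x j))"
    using approx_tendsto by (rule LIMSEQ_imp_Cauchy)
  then have "Cauchy (\<lambda>j. comb (translate a (approx x j)))"
    by (simp add: Cauchy_def dist_comb_translate)
  then have lim: "(\<lambda>j. comb (translate a (approx x j))) \<longlonglongrightarrow> disp a x"
    unfolding disp_def by (simp add: Cauchy_convergent_iff convergent_LIMSEQ_iff)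
  have "(\<lambda>j. dist (comb (L j)) (comb (approx x j))) \<longlonglongrightarrow> 0"
    using tendsto_dist[OF L approx_tendsto[of x]] by simp
  then have "(\<lambda>j. comb (translate a (L j)) - comb (translate a (approx x j))) \<longlonglongrightarrow> 0"
    by (subst tendsto_norm_zero_iff[symmetric]) (simp only: dist_norm[symmetric] dist_comb_translate)
  from tendsto_add[OF this lim] show ?thesis by simp
qed

lemma disp_comb: "disp a (comb L) = comb (translate a L)"
  using disp_tendsto[of "\<lambda>_. L" "comb L" a] by (simp add: LIMSEQ_const_iff)

lemma disp_coherent: "disp a (coherent b) = coherent (a + b)"
  using disp_comb[of a "[(1, b)]"] by (simp add: scaleC_simps)

lemma disp_add_vec: "disp a (x + y) = disp a x + disp a y"
proof (rule LIMSEQ_unique)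
  show "(\<lambda>j. comb (translate a (approx x j @ approx y j))) \<longlonglongrightarrow> disp a (x + y)"
    by (rule disp_tendsto) (unfold comb_simps, intro tendsto_add approx_tendsto)
  show "(\<lambda>j. comb (translate a (approx x j @ approx y j))) \<longlonglongrightarrow> disp a x + disp a y"
    unfolding translate_simps comb_simps by (intro tendsto_add disp_tendsto approx_tendsto)
qed

lemma disp_scaleC: "disp a (c *\<^sub>C x) = c *\<^sub>C disp a x"
proof (rule LIMSEQ_unique)
  show "(\<lambda>j. comb (translate a (scale c (approx x j)))) \<longlonglongrightarrow> disp a (c *\<^sub>C x)"
    by (rule disp_tendsto) (unfold comb_scale, intro tendsto_scaleC approx_tendsto)
  show "(\<lambda>j. comb (translate a (scale c (approx x j)))) \<longlonglongrightarrow> c *\<^sub>C disp a x"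
    unfolding translate_scale comb_scale by (intro tendsto_scaleC disp_tendsto approx_tendsto)
qed

lemma inner_disp: "inner (disp a x) (disp a y) = inner x y"
proof (rule LIMSEQ_unique)
  show "(\<lambda>j. inner (comb (translate a (approx x j))) (comb (translate a (approx y j)))) \<longlonglongrightarrow> inner (disp a x) (disp a y)"
    by (intro tendsto_inner disp_tendsto approx_tendsto)
  show "(\<lambda>j. inner (comb (translate a (approx x j))) (comb (translate a (approx y j)))) \<longlonglongrightarrow> inner x y"
    unfolding inner_eq_Re_cinner cinner_comb_translate unfolding inner_eq_Re_cinner[symmetric]
    by (intro tendsto_inner approx_tendsto)
qed

lemma cinner_disp: "cinner (disp a x) (disp a y) = cinner x y"
  by (simp add: cinner_eq_inner disp_scaleC[symmetric] inner_disp)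

lemma norm_disp: "norm (disp a x) = norm x"
  by (simp add: norm_eq_sqrt_inner inner_disp)

lemma disp_disp: "disp a (disp b x) = disp (a + b) x"
proof (rule LIMSEQ_unique)
  show "(\<lambda>j. comb (translate a (translate b (approx x j)))) \<longlonglongrightarrow> disp a (disp b x)"
    by (intro disp_tendsto approx_tendsto)
  show "(\<lambda>j. comb (translate a (translate b (approx x j)))) \<longlonglongrightarrow> disp (a + b) x"
    using disp_tendsto[OF approx_tendsto] by simp
qed

lemma disp_0: "disp 0 x = x"
  by (rule LIMSEQ_unique[OF disp_tendsto[OF approx_tendsto]]) (simp add: approx_tendsto)

lemma unitary_disp: "unitary_op (disp a)"
  unfolding unitary_op_def
proof (intro conjI allI)
  show "surj (disp a)"
    by (rule surjI[of _ "disp (- a)"]) (simp add: disp_disp disp_0)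
qed (auto simp: disp_add_vec disp_scaleC cinner_disp)

section \<open>The generator on the domain of the ladder operators\<close>

definition gen :: "ell2 \<Rightarrow> ell2" where
  "gen x = creation x - annihilation x"

lemma annihilation_coord:
  "x \<in> ladder_dom \<Longrightarrow> coord (annihilation x) n = sqrt (real (n + 1)) * coord x (n + 1)"
  by (simp add: annihilation.rep_eq ladder_dom_def)

lemma creation_coord:
  "x \<in> ladder_dom \<Longrightarrow> coord (creation x) n = sqrt (real n) * coord x (n - 1)"
  by (simp add: creation.rep_eq ladder_dom_def)

text \<open>The inverse square root of N + 1. Its range is exactly \<open>ladder_dom\<close>, and
  \<open>annihilation\<close>, \<open>creation\<close> and \<open>gen\<close> become bounded after
  composition with it, so that closed-subspace arguments reach the unbounded ladder operators
  too.\<close>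

lift_definition damp :: "ell2 \<Rightarrow> ell2" is "\<lambda>(y :: nat \<Rightarrow> complex) m. of_real (1 / sqrt (real m + 1)) * y m"
  by (rule summable_sq_bounded_mult[where B = 1]) (auto simp: norm_divide)

lemma damp_in_ladder_dom: "damp y \<in> ladder_dom"
  unfolding ladder_dom_def mem_Collect_eq
proof (rule summable_comparison_test'[OF summable_coord[of y]])
  fix n
  have "real n * (cmod (coord (damp y) n))\<^sup>2 = real n / (real n + 1) * (cmod (coord y n))\<^sup>2"
    by (simp add: damp.rep_eq norm_divide norm_mult power_divide)
  also have "\<dots> \<le> 1 * (cmod (coord y n))\<^sup>2" by (intro mult_right_mono) auto
  finally show "norm (real n * (cmod (coord (damp y) n))\<^sup>2) \<le> (cmod (coord y n))\<^sup>2" by simp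
qed

lemma ladder_domE:
  assumes "x \<in> ladder_dom"
  obtains y where "x = damp y" "\<And>n. coord y n = sqrt (real n + 1) * coord x n"
proof -
  have "summable (\<lambda>n. real n * (cmod (coord x n))\<^sup>2 + (cmod (coord x n))\<^sup>2)"
    using assms by (intro summable_add summable_coord) (simp add: ladder_dom_def)
  moreover have "(cmod (of_real (sqrt (real n + 1)) * coord x n))\<^sup>2
      = real n * (cmod (coord x n))\<^sup>2 + (cmod (coord x n))\<^sup>2" for n
    by (simp add: norm_mult power_mult_distrib distrib_right)
  ultimately have "summable (\<lambda>n. (cmod (of_real (sqrt (real n + 1)) * coord x n))\<^sup>2)"
    by simp
  then have *: "coord (Abs_ell2 (\<lambda>n. of_real (sqrt (real n + 1)) * coord x n)) = (\<lambda>n. of_real (sqrt (real n + 1)) * coord x n)"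
    by (intro Abs_ell2_inverse) simp
  show ?thesis
  proof (rule that)
    have "complex_of_real (1 / sqrt (real n + 1)) * complex_of_real (sqrt (real n + 1)) = 1" for n
      unfolding of_real_mult[symmetric] by simp
    then show "x = damp (Abs_ell2 (\<lambda>n. of_real (sqrt (real n + 1)) * coord x n))"
      by (intro ell2_eqI) (simp only: damp.rep_eq * mult.assoc[symmetric] mult_1_left)
  qed (simp add: *)
qed

lemma damp_linear: "damp (x + y) = damp x + damp y" "damp (c *\<^sub>C x) = c *\<^sub>C damp x" "damp 0 = 0"
  "damp (x - y) = damp x - damp y"
  by (auto intro!: ell2_eqI simp: coord_simps damp.rep_eq add_divide_distrib diff_divide_distrib)

lemma norm_damp_le: "norm (damp x) \<le> norm x"
proof (rule norm_le_coordI)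
  fix n
  have "1 / sqrt (real n + 1) * cmod (coord x n) \<le> 1 * cmod (coord x n)"
    by (intro mult_right_mono) auto
  then show "cmod (coord (damp x) n) \<le> cmod (coord x n)"
    by (simp add: damp.rep_eq norm_divide norm_mult)
qed

lemma ladder_dom_closed:
  "x \<in> ladder_dom \<Longrightarrow> y \<in> ladder_dom \<Longrightarrow> x + y \<in> ladder_dom"
  "x \<in> ladder_dom \<Longrightarrow> c *\<^sub>C x \<in> ladder_dom"
proof -
  assume x: "x \<in> ladder_dom"
  then obtain x' where x': "x = damp x'" by (rule ladder_domE)
  show "c *\<^sub>C x \<in> ladder_dom"
    unfolding x' damp_linear(2)[symmetric] by (rule damp_in_ladder_dom)
  assume "y \<in> ladder_dom"
  then obtain y' where y': "y = damp y'" by (rule ladder_domE)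
  show "x + y \<in> ladder_dom"
    unfolding x' y' damp_linear(1)[symmetric] by (rule damp_in_ladder_dom)
qed

lemma annihilation_linear:
  "x \<in> ladder_dom \<Longrightarrow> y \<in> ladder_dom \<Longrightarrow> annihilation (x + y) = annihilation x + annihilation y"
  "x \<in> ladder_dom \<Longrightarrow> annihilation (c *\<^sub>C x) = c *\<^sub>C annihilation x"
  by (auto intro!: ell2_eqI simp: annihilation_coord ladder_dom_closed coord_simps distrib_left)

lemma creation_linear:
  "x \<in> ladder_dom \<Longrightarrow> y \<in> ladder_dom \<Longrightarrow> creation (x + y) = creation x + creation y"
  "x \<in> ladder_dom \<Longrightarrow> creation (c *\<^sub>C x) = c *\<^sub>C creation x"
  by (auto intro!: ell2_eqI simp: creation_coord ladder_dom_closed coord_simps distrib_left)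

lemma gen_linear:
  "x \<in> ladder_dom \<Longrightarrow> y \<in> ladder_dom \<Longrightarrow> gen (x + y) = gen x + gen y"
  "x \<in> ladder_dom \<Longrightarrow> gen (c *\<^sub>C x) = c *\<^sub>C gen x"
  by (simp_all add: gen_def annihilation_linear creation_linear scaleC_simps)

lemma norm_annihilation_damp: "norm (annihilation (damp y)) \<le> norm y"
proof (rule norm_le_coord_lowerI)
  fix n
  have "cmod (coord (annihilation (damp y)) n) = sqrt (real n + 1) / sqrt (real n + 2) * cmod (coord y (Suc n))"
    by (simp add: annihilation_coord damp_in_ladder_dom damp.rep_eq norm_mult norm_divide add.commute)
  also have "\<dots> \<le> 1 * cmod (coord y (Suc n))"
    by (intro mult_right_mono) auto
  finally show "cmod (coord (annihilation (damp y)) n) \<le> cmod (coord y (Suc n))" by simp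
qed

lemma norm_creation_damp: "norm (creation (damp y)) \<le> norm y"
proof (rule norm_le_coord_raiseI)
  fix n
  show "cmod (coord (creation (damp y)) (Suc n)) \<le> cmod (coord y n)"
    by (simp add: creation_coord damp_in_ladder_dom damp.rep_eq norm_mult norm_divide add.commute)
qed (simp add: creation_coord damp_in_ladder_dom)

lemma bounded_linear_damp:
  "bounded_linear damp" "bounded_linear (\<lambda>y. annihilation (damp y))"
  "bounded_linear (\<lambda>y. creation (damp y))" "bounded_linear (\<lambda>y. gen (damp y))"
proof -
  show *: "bounded_linear damp" 
    by (rule bounded_linear_intro[of _ 1])
       (auto simp: damp_linear norm_damp_le scaleR_eq_scaleC)
  show a: "bounded_linear (\<lambda>y. annihilation (damp y))"
    by (rule bounded_linear_intro[of _ 1])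
       (auto simp: damp_linear norm_annihilation_damp scaleR_eq_scaleC annihilation_linear damp_in_ladder_dom)
  show c: "bounded_linear (\<lambda>y. creation (damp y))"
    by (rule bounded_linear_intro[of _ 1])
       (auto simp: damp_linear norm_creation_damp scaleR_eq_scaleC creation_linear damp_in_ladder_dom)
  show "bounded_linear (\<lambda>y. gen (damp y))"
    unfolding gen_def by (intro bounded_linear_sub a c)
qed

lemma coherent_dense:
  assumes "closed_csubspace Z" "\<And>b. coherent b \<in> Z"
  shows "x \<in> Z"
proof -
  have "comb L \<in> Z" for L
    by (induction L) (auto intro!: closed_csubspaceD(2-4)[OF assms(1)] assms(2))
  then have "closure (range comb) \<subseteq> Z"
    by (intro closure_minimal closed_csubspaceD(1)[OF assms(1)]) auto
  then show ?thesis using comb_dense by blast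
qed

lemma exp_vec_in_ladder_dom: "exp_vec b \<in> ladder_dom"
  unfolding ladder_dom_def mem_Collect_eq
proof (rule summable_comparison_test'[OF summable_coord[of "exp_vec (2 * b)"]])
  fix n
  have sq: "(cmod (coord (exp_vec c) n))\<^sup>2 = (c\<^sup>2) ^ n / fact n" for c
    unfolding exp_vec.rep_eq norm_of_real power2_abs
    by (simp add: power_divide power_mult[symmetric] mult.commute)
  have "real n \<le> 4 ^ n"
    using of_nat_less_two_power[of n, where 'a = real] power_mono[of 2 "4::real" n] by simp
  then have "real n * (b\<^sup>2) ^ n \<le> 4 ^ n * (b\<^sup>2) ^ n" by (intro mult_right_mono) auto
  then show "norm (real n * (cmod (coord (exp_vec b) n))\<^sup>2) \<le> (cmod (coord (exp_vec (2 * b)) n))\<^sup>2"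
    unfolding sq by (simp add: divide_right_mono power_mult_distrib)
qed

text \<open>Coherent states are dense even in the graph norm of the ladder operators: up to scalars,
  their preimages under \<open>damp\<close> have the power-series coefficients sqrt (n + 1) / sqrt
  (n!), which are still nonzero and bounded, so \<open>power_series_dense\<close> applies.\<close>

lemma damp_coherent_dense:
  assumes Z: "closed_csubspace Z" and v: "\<And>y b. damp y = coherent b \<Longrightarrow> y \<in> Z"
  shows "x \<in> Z"
proof -
  have "\<exists>y. exp_vec b = damp y \<and> (\<forall>n. coord y n = sqrt (real n + 1) * coord (exp_vec b) n)" for b
    using ladder_domE[OF exp_vec_in_ladder_dom[of b]] by metis
  then obtain v where v1: "\<And>b. exp_vec b = damp (v b)"
    and v2: "\<And>b n. coord (v b) n = sqrt (real n + 1) * coord (exp_vec b) n" by metis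
  show ?thesis
  proof (rule power_series_dense[OF Z, where v = v and c = "\<lambda>n. sqrt (real n + 1) / sqrt (fact n)" and K = 2])
    fix b :: real
    have "damp (of_real (exp (- b\<^sup>2 / 2)) *\<^sub>C v b) = coherent b"
      by (simp add: damp_linear v1[symmetric] coherent_def scaleR_eq_scaleC)
    then have "of_real (exp (- b\<^sup>2 / 2)) *\<^sub>C v b \<in> Z" by (rule v)
    then have "of_real (exp (b\<^sup>2 / 2)) *\<^sub>C of_real (exp (- b\<^sup>2 / 2)) *\<^sub>C v b \<in> Z"
      by (rule closed_csubspaceD(4)[OF Z])
    then show "v b \<in> Z"
      by (simp only: scaleC_simps of_real_mult[symmetric] exp_add[symmetric]) (simp add: scaleC_simps)
    show "coord (v b) n = of_real (sqrt (real n + 1) / sqrt (fact n) * b ^ n)" for n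
      by (simp add: v2 exp_vec.rep_eq)
  next
    fix n
    show "sqrt (real n + 1) / sqrt (fact n) \<noteq> 0" by auto
    have "real n \<le> fact n" using fact_ge_self[of n] by (metis of_nat_fact of_nat_le_iff)
    moreover have "1 \<le> (fact n :: real)" by (rule fact_ge_1)
    ultimately have "real n + 1 \<le> 4 * fact n" by linarith
    then have "(real n + 1) / fact n \<le> 4" by (simp add: divide_le_eq)
    then have "sqrt ((real n + 1) / fact n) \<le> sqrt 4" by (rule real_sqrt_le_mono)
    then show "\<bar>sqrt (real n + 1) / sqrt (fact n)\<bar> \<le> 2" by (simp add: real_sqrt_divide)
  qed
qed

lemma coherent_in_ladder_dom: "coherent b \<in> ladder_dom"
  unfolding coherent_def scaleR_eq_scaleC by (intro ladder_dom_closed exp_vec_in_ladder_dom)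

lemma annihilation_coherent: "annihilation (coherent b) = of_real b *\<^sub>C coherent b"
proof -
  have "annihilation (exp_vec b) = of_real b *\<^sub>C exp_vec b"
  proof (rule ell2_eqI)
    fix n
    have "sqrt (1 + real n) * (b ^ Suc n / sqrt (fact (Suc n))) = b * (b ^ n / sqrt (fact n))"
    proof -
      have "sqrt (fact (Suc n)) = sqrt (1 + real n) * sqrt (fact n)"
        by (simp add: real_sqrt_mult)
      then show ?thesis by simp
    qed
    then show "coord (annihilation (exp_vec b)) n = coord (of_real b *\<^sub>C exp_vec b) n"
      by (simp only: annihilation_coord[OF exp_vec_in_ladder_dom] exp_vec.rep_eq scaleC.rep_eq
          of_real_mult[symmetric] Suc_eq_plus1[symmetric] of_nat_Suc)
  qed
  then show ?thesis
    by (simp add: coherent_def scaleR_eq_scaleC annihilation_linear exp_vec_in_ladder_dom scaleC_simps mult.commute)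
qed

section \<open>Differentiability along the group\<close>

lemma has_vector_derivative_alt:
  fixes f :: "real \<Rightarrow> 'a :: real_normed_vector"
  shows "(f has_vector_derivative D) (at x) \<longleftrightarrow>
    (\<forall>e>0. \<exists>d>0. \<forall>h. \<bar>h\<bar> < d \<longrightarrow> norm (f (x + h) - f x - h *\<^sub>R D) \<le> e * \<bar>h\<bar>)" (is "_ \<longleftrightarrow> ?R")
proof -
  have *: "(\<forall>y. norm (y - x) < d \<longrightarrow> norm (f y - f x - (y - x) *\<^sub>R D) \<le> e * norm (y - x)) =
      (\<forall>h. \<bar>h\<bar> < d \<longrightarrow> norm (f (x + h) - f x - h *\<^sub>R D) \<le> e * \<bar>h\<bar>)" (is "?A = ?B") for d e
  proof
    assume A: ?A
    show ?B using A[rule_format, of "x + _"] by simp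
  next
    assume B: ?B
    show ?A using B[rule_format, of "_ - x"] by simp
  qed
  show ?thesis
    unfolding has_vector_derivative_def has_derivative_at_alt *
    by (simp add: bounded_linear_scaleR_left)
qed

text \<open>The Taylor remainder is estimated coordinatewise. With K = |b| + 1 the remainder of the
  m-th power is at most m (m - 1) K^(m - 2) h^2, and bounding m and m - 1 by 2^m turns this into a
  coefficient of \<open>exp_vec\<close> at 4 K.\<close>

lemma exp_vec_deriv_bound:
  assumes h: "\<bar>h\<bar> \<le> 1"
  shows "norm (exp_vec (b + h) - exp_vec b - h *\<^sub>R creation (exp_vec b)) \<le> h\<^sup>2 * norm (exp_vec (4 * (\<bar>b\<bar> + 1)))"
proof (cases "h = 0")
  case False
  define K where "K = \<bar>b\<bar> + 1"
  have "norm (exp_vec (b + h) - exp_vec b - h *\<^sub>R creation (exp_vec b)) \<le> norm (h\<^sup>2 *\<^sub>R exp_vec (4 * K))"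
  proof (rule norm_le_coordI)
    fix m
    have cr: "coord (creation (exp_vec b)) m = of_real (real m * b ^ (m - 1) / sqrt (fact m))"
    proof (cases m)
      case 0
      then show ?thesis by (simp add: creation_coord exp_vec_in_ladder_dom)
    next
      case (Suc k)
      have "sqrt (1 + real k) * (b ^ k / sqrt (fact k)) = (1 + real k) * b ^ k / sqrt (fact (Suc k))"
      proof -
        have "sqrt (fact (Suc k)) = sqrt (1 + real k) * sqrt (fact k)"
          by (simp add: real_sqrt_mult)
        moreover have "(1 + real k) * b ^ k / (sqrt (1 + real k) * sqrt (fact k))
            = (1 + real k) / sqrt (1 + real k) * (b ^ k / sqrt (fact k))"
          by (simp only: times_divide_times_eq)
        moreover have "(1 + real k) / sqrt (1 + real k) = sqrt (1 + real k)"
          by (rule real_div_sqrt) simp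
        ultimately show ?thesis by simp
      qed
      then show ?thesis using Suc
        by (simp only: creation_coord[OF exp_vec_in_ladder_dom] exp_vec.rep_eq of_real_mult[symmetric] of_nat_Suc diff_Suc_1)
    qed
    have c: "coord (exp_vec (b + h) - exp_vec b - h *\<^sub>R creation (exp_vec b)) m
        = of_real (((b + h) ^ m - b ^ m - h * (real m * b ^ (m - 1))) / sqrt (fact m))"
      by (simp add: coord_simps cr exp_vec.rep_eq diff_divide_distrib)
    have "\<bar>((b + h) ^ m - b ^ m) / h - real m * b ^ (m - Suc 0)\<bar> \<le> real m * real (m - Suc 0) * K ^ (m - 2) * \<bar>h\<bar>"
      using lemma_termdiff3[OF False, of b K m] h unfolding K_def real_norm_def by linarith
    also have "\<dots> \<le> 2 ^ m * 2 ^ m * K ^ m * \<bar>h\<bar>"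
    proof (intro mult_mono)
      show "real m \<le> 2 ^ m" by (simp add: less_imp_le of_nat_less_two_power)
      have "real (m - Suc 0) \<le> real m" by simp
      also have "\<dots> \<le> 2 ^ m" by (simp add: less_imp_le of_nat_less_two_power)
      finally show "real (m - Suc 0) \<le> 2 ^ m" .
      show "K ^ (m - 2) \<le> K ^ m" by (rule power_increasing) (auto simp: K_def)
    qed (auto simp: K_def)
    also have "2 ^ m * 2 ^ m * K ^ m = (2 * 2 * K) ^ m" by (simp only: power_mult_distrib)
    also have "2 * 2 * K = 4 * K" by simp
    finally have "\<bar>h\<bar> * \<bar>((b + h) ^ m - b ^ m) / h - real m * b ^ (m - Suc 0)\<bar> \<le> \<bar>h\<bar> * ((4 * K) ^ m * \<bar>h\<bar>)"
      by (intro mult_left_mono) auto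
    also have "\<bar>h\<bar> * \<bar>((b + h) ^ m - b ^ m) / h - real m * b ^ (m - Suc 0)\<bar> = \<bar>(b + h) ^ m - b ^ m - h * (real m * b ^ (m - 1))\<bar>"
    proof -
      have "h * (u / h - v) = u - h * v" for u v using False by (simp add: field_simps)
      then show ?thesis by (simp only: abs_mult[symmetric] One_nat_def)
    qed
    also have "\<bar>h\<bar> * ((4 * K) ^ m * \<bar>h\<bar>) = \<bar>h\<bar>\<^sup>2 * (4 * K) ^ m"
      by (simp only: power2_eq_square mult_ac)
    also have "\<bar>h\<bar>\<^sup>2 = h\<^sup>2" by simp
    finally have "\<bar>(b + h) ^ m - b ^ m - h * (real m * b ^ (m - 1))\<bar> / sqrt (fact m) \<le> h\<^sup>2 * (4 * K) ^ m / sqrt (fact m)"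
      by (rule divide_right_mono) simp
    moreover have "0 \<le> K" by (simp add: K_def)
    ultimately show "cmod (coord (exp_vec (b + h) - exp_vec b - h *\<^sub>R creation (exp_vec b)) m) \<le> cmod (coord (h\<^sup>2 *\<^sub>R exp_vec (4 * K)) m)"
      unfolding c scaleR_ell2.rep_eq exp_vec.rep_eq norm_of_real of_real_mult[symmetric]
      by (simp add: abs_mult)
  qed
  then show ?thesis by (simp add: K_def)
qed simp

lemma exp_vec_has_vector_derivative: "(exp_vec has_vector_derivative creation (exp_vec b)) (at b)"
  unfolding has_vector_derivative_alt
proof (intro allI impI)
  fix e :: real assume e: "e > 0"
  define N where "N = norm (exp_vec (4 * (\<bar>b\<bar> + 1))) + 1"
  have N: "N > 0" by (simp add: N_def add_nonneg_pos)
  show "\<exists>d>0. \<forall>h. \<bar>h\<bar> < d \<longrightarrow> norm (exp_vec (b + h) - exp_vec b - h *\<^sub>R creation (exp_vec b)) \<le> e * \<bar>h\<bar>"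
  proof (intro exI[of _ "min 1 (e / N)"] conjI allI impI)
    show "0 < min 1 (e / N)" using e N by simp
    fix h assume h: "\<bar>h\<bar> < min 1 (e / N)"
    then have "norm (exp_vec (b + h) - exp_vec b - h *\<^sub>R creation (exp_vec b)) \<le> h\<^sup>2 * (N - 1)"
      using exp_vec_deriv_bound[of h b] by (simp add: N_def)
    also have "\<dots> \<le> h\<^sup>2 * N" by (simp add: mult_left_mono)
    also have "h\<^sup>2 = \<bar>h\<bar>\<^sup>2" by simp
    also have "\<bar>h\<bar>\<^sup>2 * N = \<bar>h\<bar> * (\<bar>h\<bar> * N)" by (simp only: power2_eq_square mult_ac)
    also have "\<dots> \<le> \<bar>h\<bar> * e"
    proof (rule mult_left_mono)
      have "\<bar>h\<bar> < e / N" using h by simp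
      then show "\<bar>h\<bar> * N \<le> e" using N by (simp add: pos_less_divide_eq)
    qed simp
    finally show "norm (exp_vec (b + h) - exp_vec b - h *\<^sub>R creation (exp_vec b)) \<le> e * \<bar>h\<bar>" by (simp add: mult.commute)
  qed
qed

text \<open>Differentiating \<open>exp_vec\<close> gives the creation part. The Gaussian factor
  contributes - b times the state, which is the annihilation part because coherent states are
  eigenvectors of \<open>annihilation\<close>.\<close>

lemma coherent_has_vector_derivative: "(coherent has_vector_derivative gen (coherent b)) (at b)"
proof -
  have "((\<lambda>b. exp (- b\<^sup>2 / 2)) has_field_derivative - b * exp (- b\<^sup>2 / 2)) (at b)"
    by (auto intro!: derivative_eq_intros)
  from has_vector_derivative_scaleR[OF this exp_vec_has_vector_derivative]
  have "(coherent has_vector_derivative exp (- b\<^sup>2 / 2) *\<^sub>R creation (exp_vec b) + (- b * exp (- b\<^sup>2 / 2)) *\<^sub>R exp_vec b) (at b)"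
    by (simp add: coherent_def[abs_def])
  moreover have "exp (- b\<^sup>2 / 2) *\<^sub>R creation (exp_vec b) = creation (coherent b)"
    by (simp add: coherent_def scaleR_eq_scaleC creation_linear exp_vec_in_ladder_dom)
  moreover have "(- b * exp (- b\<^sup>2 / 2)) *\<^sub>R exp_vec b = - annihilation (coherent b)"
    unfolding annihilation_coherent by (simp add: coherent_def scaleR_eq_scaleC[symmetric])
  ultimately show ?thesis by (simp add: gen_def)
qed

lemma dist_disp: "dist (disp a x) (disp a y) = dist x y"
proof -
  have *: "x - y = x + (-1) *\<^sub>C y" for x y by (auto intro!: ell2_eqI simp: coord_simps)
  show ?thesis
    unfolding dist_norm * disp_scaleC[symmetric] disp_add_vec[symmetric] norm_disp ..
qed

lemma disp_zero_vec: "disp a 0 = 0"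
  using norm_disp[of a 0] by simp

lemma bounded_linear_disp: "bounded_linear (disp a)"
  by (rule bounded_linear_intro[of _ 1]) (auto simp: disp_add_vec norm_disp scaleR_eq_scaleC disp_scaleC)

lemma continuous_disp: "continuous_on UNIV (\<lambda>a. disp a x)"
proof -
  let ?Z = "{x. continuous_on UNIV (\<lambda>a. disp a x)}"
  have "closed_csubspace ?Z"
  proof (rule closed_csubspaceI)
    show "closed ?Z"
      unfolding closed_sequential_limits
    proof (intro allI impI, elim conjE)
      fix f x assume f: "\<forall>n. f n \<in> ?Z" and lim: "f \<longlonglongrightarrow> x"
      \<comment> \<open>All \<open>disp a\<close> are isometries, so the convergence is uniform in
        a.\<close>
      have "uniform_limit UNIV (\<lambda>n a. disp a (f n)) (\<lambda>a. disp a x) sequentially"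
        unfolding uniform_limit_iff dist_disp using lim by (simp add: tendsto_iff)
      from uniform_limit_theorem[OF _ this] f show "x \<in> ?Z" by simp
    qed
    show "c *\<^sub>C x \<in> ?Z" if "x \<in> ?Z" for c x
      using that by (simp add: disp_scaleC bounded_linear.continuous_on[OF bounded_linear_scaleC])
  qed (auto simp: disp_zero_vec disp_add_vec intro: continuous_intros)
  moreover have "coherent b \<in> ?Z" for b
  proof -
    have "continuous_on UNIV coherent"
      by (rule continuous_at_imp_continuous_on)
        (auto intro: has_vector_derivative_continuous coherent_has_vector_derivative)
    then have "continuous_on UNIV (coherent \<circ> (\<lambda>a. a + b))"
      by (intro continuous_on_compose continuous_intros) (auto intro: continuous_on_subset)
    then show ?thesis by (simp add: disp_coherent o_def)
  qed
  ultimately have "x \<in> ?Z" by (rule coherent_dense)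
  then show ?thesis by simp
qed

lemma disp_has_vector_derivative_at:
  assumes "((\<lambda>a. disp a x) has_vector_derivative g) (at 0)"
  shows "((\<lambda>a. disp a x) has_vector_derivative disp s g) (at s)"
proof -
  have "((\<lambda>a. a - s) has_vector_derivative 1) (at s)"
    by (auto intro!: derivative_eq_intros)
  from vector_diff_chain_at[OF this] assms
  have "((\<lambda>a. disp (a - s) x) has_vector_derivative g) (at s)" by (simp add: o_def)
  from bounded_linear.has_vector_derivative[OF bounded_linear_disp this, of s]
  show ?thesis by (simp add: disp_disp)
qed

text \<open>Limits of vectors need not preserve differentiability of their orbits; a mean value
  estimate supplies the uniformity. The radius d is taken from the limit vector alone, and the
  dependence on n sits in a term that vanishes as n grows with h fixed.\<close>

lemma disp_damp_has_vector_derivative: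
  "((\<lambda>a. disp a (damp y)) has_vector_derivative gen (damp y)) (at 0)"
proof -
  let ?Z = "{y. ((\<lambda>a. disp a (damp y)) has_vector_derivative gen (damp y)) (at 0)}"
  have "closed_csubspace ?Z"
  proof (rule closed_csubspaceI)
    show "closed ?Z"
      unfolding closed_sequential_limits
    proof (intro allI impI, elim conjE)
      fix f y assume f: "\<forall>n. f n \<in> ?Z" and lim: "f \<longlonglongrightarrow> y"
      let ?g = "\<lambda>y. gen (damp y)"
      show "y \<in> ?Z" unfolding mem_Collect_eq has_vector_derivative_alt
      proof (intro allI impI)
        fix e :: real assume e: "e > 0"
        have "isCont (\<lambda>s. disp s (?g y)) 0"
          using continuous_disp by (simp add: continuous_on_eq_continuous_at)
        then obtain d where d: "d > 0" "\<And>s. \<bar>s\<bar> < d \<Longrightarrow> norm (disp s (?g y) - ?g y) < e"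
          using e unfolding continuous_at_eps_delta dist_norm by (metis diff_zero disp_0 real_norm_def)
        have "norm (disp h (damp y) - damp y - h *\<^sub>R ?g y) \<le> e * \<bar>h\<bar>" if h: "\<bar>h\<bar> < d" for h
        proof -
          have "norm (disp h (damp (f n)) - damp (f n) - h *\<^sub>R ?g (f n)) \<le> \<bar>h\<bar> * (e + 2 * norm (?g (f n) - ?g y))" for n
          proof -
            have "norm (disp h (damp (f n)) - disp 0 (damp (f n)) - (h - 0) *\<^sub>R disp 0 (?g (f n)))
              \<le> norm (h - 0) * (e + 2 * norm (?g (f n) - ?g y))"
            proof (rule vector_differentiable_bound_linearization[where S = "{-\<bar>h\<bar>..\<bar>h\<bar>}"])
              show "((\<lambda>a. disp a (damp (f n))) has_vector_derivative disp s (?g (f n))) (at s within {-\<bar>h\<bar>..\<bar>h\<bar>})" for s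
                using f disp_has_vector_derivative_at has_vector_derivative_at_within by blast
              show "closed_segment 0 h \<subseteq> {-\<bar>h\<bar>..\<bar>h\<bar>}"
                by (auto simp: closed_segment_eq_real_ivl)
              fix s assume "s \<in> {-\<bar>h\<bar>..\<bar>h\<bar>}"
              then have "\<bar>s\<bar> < d" using h by auto
              then have "norm (disp s (?g y) - ?g y) \<le> e" using d(2) less_imp_le by blast
              moreover have "norm (disp s (?g (f n)) - disp s (?g y)) = norm (?g (f n) - ?g y)"
                using dist_disp by (simp add: dist_norm)
              ultimately show "norm (disp s (?g (f n)) - disp 0 (?g (f n))) \<le> e + 2 * norm (?g (f n) - ?g y)"
                unfolding disp_0
                using norm_triangle_ineq[of "disp s (?g (f n)) - disp s (?g y)" "disp s (?g y) - ?g y"]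
                  norm_triangle_ineq4[of "disp s (?g (f n)) - ?g y" "?g (f n) - ?g y"] by simp
            qed simp
            then show ?thesis by (simp add: disp_0)
          qed
          moreover have "(\<lambda>n. norm (disp h (damp (f n)) - damp (f n) - h *\<^sub>R ?g (f n))) \<longlonglongrightarrow> norm (disp h (damp y) - damp y - h *\<^sub>R ?g y)"
            by (intro tendsto_intros bounded_linear.tendsto[OF bounded_linear_disp]
                bounded_linear.tendsto[OF bounded_linear_damp(1)] bounded_linear.tendsto[OF bounded_linear_damp(4)] lim)
          moreover have "(\<lambda>n. \<bar>h\<bar> * (e + 2 * norm (?g (f n) - ?g y))) \<longlonglongrightarrow> \<bar>h\<bar> * (e + 2 * norm (?g y - ?g y))"
            by (intro tendsto_intros bounded_linear.tendsto[OF bounded_linear_damp(4)] lim)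
          ultimately have "norm (disp h (damp y) - damp y - h *\<^sub>R ?g y) \<le> \<bar>h\<bar> * (e + 2 * norm (?g y - ?g y))"
            by (intro LIMSEQ_le) auto
          then show ?thesis by (simp add: mult.commute)
        qed
        then show "\<exists>d>0. \<forall>h. \<bar>h\<bar> < d \<longrightarrow> norm (disp (0 + h) (damp y) - disp 0 (damp y) - h *\<^sub>R ?g y) \<le> e * \<bar>h\<bar>"
          using d(1) by (auto simp: disp_0)
      qed
    qed
    show "0 \<in> ?Z" using bounded_linear_damp(4) by (simp add: damp_linear disp_zero_vec linear_0 bounded_linear.linear)
       (metis damp_linear(3) linear_0 bounded_linear.linear has_vector_derivative_const)
    show "x + y \<in> ?Z" if "x \<in> ?Z" "y \<in> ?Z" for x y
      using that by (simp add: damp_linear disp_add_vec gen_linear damp_in_ladder_dom has_vector_derivative_add)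
    show "c *\<^sub>C x \<in> ?Z" if "x \<in> ?Z" for c x
      using that by (simp add: damp_linear disp_scaleC gen_linear damp_in_ladder_dom bounded_linear.has_vector_derivative[OF bounded_linear_scaleC])
  qed
  then have "y \<in> ?Z"
  proof (rule damp_coherent_dense)
    fix y b assume y: "damp y = coherent b"
    have "((\<lambda>a. a + b) has_vector_derivative 1) (at 0)"
      by (auto intro!: derivative_eq_intros)
    from vector_diff_chain_at[OF this, of coherent "gen (coherent b)"] coherent_has_vector_derivative[of b]
    show "y \<in> ?Z" by (simp add: y disp_coherent o_def)
  qed
  then show ?thesis by simp
qed

lemma displacement_group_disp: "displacement_group disp"
  unfolding displacement_group_def
proof (intro conjI allI ballI)
  show "disp 0 = id" by (auto simp: disp_0)
  show "disp (a + b) = disp a \<circ> disp b" for a b by (auto simp: disp_disp)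
  fix x assume "x \<in> ladder_dom"
  then obtain y where "x = damp y" by (rule ladder_domE)
  then show "((\<lambda>a. disp a x) has_vector_derivative creation x - annihilation x) (at 0)"
    using disp_damp_has_vector_derivative[of y] by (simp add: gen_def)
qed (auto intro: unitary_disp continuous_disp)

section \<open>Commutation with the annihilation operator, and uniqueness of the group\<close>

lemma annihilation_closed:
  assumes f: "\<And>n. f n \<in> ladder_dom" and x: "f \<longlonglongrightarrow> x" and z: "(\<lambda>n. annihilation (f n)) \<longlonglongrightarrow> z"
  shows "x \<in> ladder_dom" "annihilation x = z"
proof -
  have zx: "coord z m = sqrt (real (Suc m)) * coord x (Suc m)" for m
  proof (rule LIMSEQ_unique)
    show "(\<lambda>n. coord (annihilation (f n)) m) \<longlonglongrightarrow> coord z m"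
      by (rule tendsto_coord[OF z])
    show "(\<lambda>n. coord (annihilation (f n)) m) \<longlonglongrightarrow> sqrt (real (Suc m)) * coord x (Suc m)"
      unfolding annihilation_coord[OF f] Suc_eq_plus1 by (intro tendsto_intros tendsto_coord x)
  qed
  \<comment> \<open>Membership in the domain is read off from z, whose squared coordinates are the
    weighted squared coordinates of x with the index shifted by one.\<close>
  show dom: "x \<in> ladder_dom"
  proof -
    have "(cmod (coord z m))\<^sup>2 = real (Suc m) * (cmod (coord x (Suc m)))\<^sup>2" for m
      unfolding zx norm_mult power_mult_distrib norm_of_real power2_abs real_sqrt_pow2[OF of_nat_0_le_iff] ..
    then have "summable (\<lambda>m. real (Suc m) * (cmod (coord x (Suc m)))\<^sup>2)"
      using summable_coord[of z] by (simp only:)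
    then show ?thesis
      unfolding ladder_dom_def mem_Collect_eq by (subst (asm) summable_Suc_iff)
  qed
  show "annihilation x = z"
    by (rule ell2_eqI) (simp add: annihilation_coord[OF dom] zx)
qed

text \<open>The relation D(-s) a D(s) = a + s. For the coherent state with parameter b, both sides
  of the second claim are s + b times the shifted state; the relation extends because
  \<open>annihilation\<close> is a closed operator. Invariance of the domain is needed to
  differentiate orbits at times other than 0.\<close>

lemma disp_annihilation:
  assumes "x \<in> ladder_dom"
  shows "disp s x \<in> ladder_dom" "annihilation (disp s x) = disp s (annihilation x + of_real s *\<^sub>C x)"
proof -
  let ?R = "\<lambda>y. disp s (annihilation (damp y) + of_real s *\<^sub>C damp y)"
  let ?Z = "{y. disp s (damp y) \<in> ladder_dom \<and> annihilation (disp s (damp y)) = ?R y}"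
  have "closed_csubspace ?Z"
  proof (rule closed_csubspaceI)
    show "closed ?Z"
      unfolding closed_sequential_limits
    proof (intro allI impI, elim conjE)
      fix f y assume f: "\<forall>n. f n \<in> ?Z" and lim: "f \<longlonglongrightarrow> y"
      have 1: "disp s (damp (f n)) \<in> ladder_dom" for n using f by blast
      have 2: "(\<lambda>n. disp s (damp (f n))) \<longlonglongrightarrow> disp s (damp y)"
        by (intro bounded_linear.tendsto[OF bounded_linear_disp] bounded_linear.tendsto[OF bounded_linear_damp(1)] lim)
      have "(\<lambda>n. ?R (f n)) \<longlonglongrightarrow> ?R y"
        by (intro bounded_linear.tendsto[OF bounded_linear_disp] tendsto_add tendsto_scaleC
            bounded_linear.tendsto[OF bounded_linear_damp(1)] bounded_linear.tendsto[OF bounded_linear_damp(2)] lim)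
      then have 3: "(\<lambda>n. annihilation (disp s (damp (f n)))) \<longlonglongrightarrow> ?R y" using f by simp
      show "y \<in> ?Z" using annihilation_closed[OF 1 2 3] by blast
    qed
    have a0: "annihilation 0 = 0"
      using damp_linear(3) bounded_linear_damp(2) linear_0[OF bounded_linear.linear] by metis
    show "0 \<in> ?Z"
      using damp_in_ladder_dom[of 0] by (simp add: damp_linear disp_zero_vec a0 scaleC_simps)
    show "x + y \<in> ?Z" if "x \<in> ?Z" "y \<in> ?Z" for x y
      using that by (simp add: damp_linear disp_add_vec annihilation_linear damp_in_ladder_dom ladder_dom_closed scaleC_simps)
    show "c *\<^sub>C x \<in> ?Z" if "x \<in> ?Z" for c x
      using that by (simp add: damp_linear disp_scaleC disp_add_vec annihilation_linear damp_in_ladder_dom ladder_dom_closed scaleC_simps mult.commute)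
  qed
  then have "y \<in> ?Z" for y
  proof (rule damp_coherent_dense)
    fix y b assume y: "damp y = coherent b"
    have "(of_real s + of_real b) *\<^sub>C z = of_real b *\<^sub>C z + of_real s *\<^sub>C z" for z
      by (rule ell2_eqI) (simp add: coord_simps algebra_simps)
    then show "y \<in> ?Z"
      by (simp add: y disp_coherent coherent_in_ladder_dom annihilation_coherent disp_scaleC disp_add_vec)
  qed
  moreover obtain y where "x = damp y" using ladder_domE[OF assms] by metis
  ultimately show "disp s x \<in> ladder_dom" "annihilation (disp s x) = disp s (annihilation x + of_real s *\<^sub>C x)"
    by auto
qed

text \<open>The curve of coherent states, pulled back by the group, is constant: its derivative
  vanishes because that curve and the orbits of D have the same velocity at every coherent
  state.\<close>

lemma displacement_group_coherent:
  assumes D: "displacement_group D"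
  shows "D a (coherent b) = coherent (a + b)"
proof -
  have U: "unitary_op (D a)" for a using D by (simp add: displacement_group_def)
  have add: "D a (x + y) = D a x + D a y" and sc: "D a (c *\<^sub>C x) = c *\<^sub>C D a x"
    and ci: "cinner (D a x) (D a y) = cinner x y" for a x y c
    using U[of a] by (auto simp: unitary_op_def)
  have nD: "norm (D a x) = norm x" for a x
    by (simp add: norm_eq_sqrt_inner inner_eq_Re_cinner ci)
  have bl: "bounded_linear (D a)" for a
    by (rule bounded_linear_intro[of _ 1]) (auto simp: add nD scaleR_eq_scaleC sc)
  note lin = linear_diff[OF bounded_linear.linear[OF bl]] linear_scale[OF bounded_linear.linear[OF bl]]
  have comp: "D (a + b) x = D a (D b x)" and D0: "D 0 x = x" for a b x
    using D by (auto simp: displacement_group_def)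
  have cont: "isCont (\<lambda>a. D a x) 0" for x
    using D by (simp add: displacement_group_def continuous_on_eq_continuous_at)
  have der: "((\<lambda>a. D a x) has_vector_derivative gen x) (at 0)" if "x \<in> ladder_dom" for x
    using D that by (simp add: displacement_group_def gen_def)
  define u where "u t = D (- t) (coherent (t + b))" for t
  have "(u has_vector_derivative 0) (at t)" for t
    unfolding has_vector_derivative_alt
  proof (intro allI impI)
    fix e :: real assume e: "e > 0"
    let ?p = "coherent (t + b)"
    let ?g = "gen ?p"
    obtain d1 where d1: "d1 > 0" "\<And>h. \<bar>h\<bar> < d1 \<Longrightarrow> norm (coherent (t + b + h) - ?p - h *\<^sub>R ?g) \<le> e / 3 * \<bar>h\<bar>"
      using coherent_has_vector_derivative[of "t + b", unfolded has_vector_derivative_alt, rule_format, of "e / 3"] e by auto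
    obtain d2 where d2: "d2 > 0" "\<And>h. \<bar>h\<bar> < d2 \<Longrightarrow> norm (D h ?p - ?p - h *\<^sub>R ?g) \<le> e / 3 * \<bar>h\<bar>"
      using der[OF coherent_in_ladder_dom, of "t + b", unfolded has_vector_derivative_alt, rule_format, of "e / 3"] e
      by (auto simp: D0)
    obtain d3 where d3: "d3 > 0" "\<And>h. \<bar>h\<bar> < d3 \<Longrightarrow> norm (D h ?g - ?g) < e / 3"
      using cont[of ?g, unfolded continuous_at_eps_delta, rule_format, of "e / 3"] e
      by (auto simp: dist_norm D0)
    show "\<exists>d>0. \<forall>h. \<bar>h\<bar> < d \<longrightarrow> norm (u (t + h) - u t - h *\<^sub>R 0) \<le> e * \<bar>h\<bar>"
    proof (intro exI[of _ "min d1 (min d2 d3)"] conjI allI impI)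
      show "0 < min d1 (min d2 d3)" using d1 d2 d3 by simp
      fix h assume h: "\<bar>h\<bar> < min d1 (min d2 d3)"
      have "u (t + h) - u t = D (- t) (D (- h) (coherent (t + b + h)) - ?p)"
        by (simp add: u_def lin comp[symmetric] add.commute add.left_commute)
      \<comment> \<open>A product rule by hand, since D is differentiable only strongly and on the
        domain. The three terms are the linearization errors of the coherent curve and of the orbit,
        and the strong continuity of D at 0 applied to \<open>?g\<close>.\<close>
      also have "D (- h) (coherent (t + b + h)) - ?p =
          D (- h) (coherent (t + b + h) - ?p - h *\<^sub>R ?g) + (D (- h) ?p - ?p - (- h) *\<^sub>R ?g)
            + h *\<^sub>R (D (- h) ?g - ?g)"
        by (simp add: lin add algebra_simps)
      finally have *: "norm (u (t + h) - u t) = norm (D (- h) (coherent (t + b + h) - ?p - h *\<^sub>R ?g)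
          + (D (- h) ?p - ?p - (- h) *\<^sub>R ?g) + h *\<^sub>R (D (- h) ?g - ?g))"
        by (simp only: nD)
      have "norm (u (t + h) - u t) \<le> norm (coherent (t + b + h) - ?p - h *\<^sub>R ?g)
          + norm (D (- h) ?p - ?p - (- h) *\<^sub>R ?g) + \<bar>h\<bar> * norm (D (- h) ?g - ?g)"
        unfolding *
        by (rule order_trans[OF norm_triangle_ineq order_trans[OF add_right_mono[OF norm_triangle_ineq]]])
           (simp only: nD norm_scaleR real_norm_def order_refl)
      also have "\<dots> \<le> e / 3 * \<bar>h\<bar> + e / 3 * \<bar>h\<bar> + \<bar>h\<bar> * (e / 3)"
      proof (intro add_mono mult_left_mono)
        show "norm (coherent (t + b + h) - ?p - h *\<^sub>R ?g) \<le> e / 3 * \<bar>h\<bar>" using h by (intro d1) simp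
        show "norm (D (- h) ?p - ?p - (- h) *\<^sub>R ?g) \<le> e / 3 * \<bar>h\<bar>" using d2(2)[of "- h"] h by simp
        show "norm (D (- h) ?g - ?g) \<le> e / 3" using d3(2)[of "- h"] h by simp
      qed simp
      finally show "norm (u (t + h) - u t - h *\<^sub>R 0) \<le> e * \<bar>h\<bar>" by simp
    qed
  qed
  then obtain c where "\<And>t. u t = c"
    using has_vector_derivative_zero_constant[of UNIV u] by (auto intro: has_vector_derivative_at_within)
  then have "u a = u 0" by simp
  then have "D (- a) (coherent (a + b)) = coherent b" by (simp add: u_def D0)
  then have "D a (D (- a) (coherent (a + b))) = D a (coherent b)" by simp
  then show ?thesis by (simp add: comp[symmetric] D0)
qed

lemma displacement_group_unique:
  assumes D: "displacement_group D"
  shows "D = disp"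
proof (intro ext)
  fix a x
  have U: "unitary_op (D a)" using D by (simp add: displacement_group_def)
  have add: "D a (x + y) = D a x + D a y" and sc: "D a (c *\<^sub>C x) = c *\<^sub>C D a x"
    and ci: "cinner (D a x) (D a y) = cinner x y" for x y c
    using U by (auto simp: unitary_op_def)
  have nD: "norm (D a x) = norm x" for x
    by (simp add: norm_eq_sqrt_inner inner_eq_Re_cinner ci)
  have bl: "bounded_linear (D a)"
    by (rule bounded_linear_intro[of _ 1]) (auto simp: add nD scaleR_eq_scaleC sc)
  have "closed_csubspace {x. D a x = disp a x}"
  proof (rule closed_csubspaceI)
    show "closed {x. D a x = disp a x}"
      by (intro closed_Collect_eq linear_continuous_on bl bounded_linear_disp)
    show "0 \<in> {x. D a x = disp a x}"
      using linear_0[OF bounded_linear.linear[OF bl]] by (simp add: disp_zero_vec)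
  qed (auto simp: add sc disp_add_vec disp_scaleC)
  then have "x \<in> {x. D a x = disp a x}"
    by (rule coherent_dense) (simp add: displacement_group_coherent[OF D] disp_coherent)
  then show "D a x = disp a x" by simp
qed

lemma displacement_eq_disp: "displacement = disp"
  unfolding displacement_def
  by (rule the_equality) (auto intro: displacement_group_disp displacement_group_unique)

lemma disp_has_vector_derivative:
  assumes "x \<in> ladder_dom"
  shows "((\<lambda>a. disp a x) has_vector_derivative gen (disp s x)) (at s)"
proof -
  obtain y where y: "disp s x = damp y"
    using ladder_domE[OF disp_annihilation(1)[OF assms]] by metis
  have "((\<lambda>a. a - s) has_vector_derivative 1) (at s)"
    by (auto intro!: derivative_eq_intros)
  from vector_diff_chain_at[OF this, of "\<lambda>a. disp a (disp s x)"] disp_damp_has_vector_derivative[of y]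
  show ?thesis by (simp add: o_def disp_disp y[symmetric])
qed

section \<open>Bounded commutators of diagonal operators\<close>

text \<open>\<open>diag\<close> must map all weights to operators on square-summable sequences, so
  unbounded weights get the default 0. The estimates on \<open>diag\<close> below assume a bound,
  under which the weights are the given ones.\<close>

definition zero_unless_bounded :: "(nat \<Rightarrow> real) \<Rightarrow> nat \<Rightarrow> real" where
  "zero_unless_bounded s = (if \<exists>B. \<forall>m. \<bar>s m\<bar> \<le> B then s else (\<lambda>_. 0))"

lift_definition diag :: "(nat \<Rightarrow> real) \<Rightarrow> ell2 \<Rightarrow> ell2" is
  "\<lambda>s x n. of_real (zero_unless_bounded s n) * x n"
  subgoal for s x
  proof -
    have "\<exists>B. \<forall>m. \<bar>zero_unless_bounded s m\<bar> \<le> B" by (auto simp: zero_unless_bounded_def)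
    then obtain B where "\<forall>m. \<bar>zero_unless_bounded s m\<bar> \<le> B" by blast
    then show "summable (\<lambda>n. (cmod (x n))\<^sup>2) \<Longrightarrow> ?thesis"
      using summable_sq_bounded_mult[of x "\<lambda>n. of_real (zero_unless_bounded s n)" B] by simp
  qed
  done

lift_definition lower :: "ell2 \<Rightarrow> ell2" is "\<lambda>x n. x (Suc n)"
  by (subst summable_Suc_iff)

lift_definition raise :: "ell2 \<Rightarrow> ell2" is "\<lambda>x n. case n of 0 \<Rightarrow> 0 | Suc k \<Rightarrow> x k"
  by (subst summable_Suc_iff[symmetric]) simp

lemma coord_diag: "\<forall>m. \<bar>s m\<bar> \<le> B \<Longrightarrow> coord (diag s x) n = of_real (s n) * coord x n"
  by (auto simp: diag.rep_eq zero_unless_bounded_def)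

lemma norm_diag_le: "\<forall>m. \<bar>s m\<bar> \<le> B \<Longrightarrow> norm (diag s x) \<le> B * norm x"
proof -
  assume B: "\<forall>m. \<bar>s m\<bar> \<le> B"
  then have "0 \<le> B" using abs_ge_zero order_trans by blast
  then have "norm (diag s x) \<le> norm (B *\<^sub>R x)"
    using B by (intro norm_le_coordI) (auto simp: coord_diag coord_simps norm_mult intro: mult_right_mono)
  then show ?thesis using \<open>0 \<le> B\<close> by simp
qed

lemma diag_linear: "diag s (x + y) = diag s x + diag s y" "diag s (c *\<^sub>C x) = c *\<^sub>C diag s x"
  by (auto intro!: ell2_eqI simp: diag.rep_eq coord_simps algebra_simps)

lemma bounded_linear_diag: "\<forall>m. \<bar>s m\<bar> \<le> B \<Longrightarrow> bounded_linear (diag s)"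
  by (rule bounded_linear_intro[of _ B])
     (auto simp: diag_linear scaleR_eq_scaleC norm_diag_le mult.commute)

lemma inner_diag_swap: "inner (diag s x) y = inner x (diag s y)"
  by (rule sums_unique2[OF inner_ell2_sums])
     (use inner_ell2_sums[of x "diag s y"] in \<open>simp add: diag.rep_eq algebra_simps\<close>)

lemma inner_raise: "inner (raise x) y = inner x (lower y)"
proof (rule sums_unique2[OF inner_ell2_sums])
  show "(\<lambda>n. Re (cnj (coord (raise x) n) * coord y n)) sums inner x (lower y)"
    using inner_ell2_sums[of x "lower y"]
      sums_Suc_iff[of "\<lambda>n. Re (cnj (coord (raise x) n) * coord y n)" "inner x (lower y)"]
    by (simp add: raise.rep_eq lower.rep_eq)
qed

lemma inner_fock_left: "inner (fock n) x = Re (coord x n)"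
proof -
  have "inner (fock n) x = inner x (fock n)" by (rule inner_commute)
  then show ?thesis by (simp add: inner_eq_Re_cinner cinner_fock)
qed

text \<open>The real symmetric Jacobi matrix with zero diagonal and off-diagonal entries t; the
  commutator of a diagonal operator with \<open>gen\<close> has this shape.\<close>

definition hop :: "(nat \<Rightarrow> real) \<Rightarrow> ell2 \<Rightarrow> ell2" where
  "hop t x = diag t (lower x) + raise (diag t x)"

lemma norm_hop_le:
  assumes "\<forall>m. \<bar>t m\<bar> \<le> b"
  shows "norm (hop t x) \<le> 2 * b * norm x"
proof -
  have "norm (lower x) \<le> norm x" by (rule norm_le_coord_lowerI) (simp add: lower.rep_eq)
  moreover have "0 \<le> b" using assms abs_ge_zero order_trans by blast
  ultimately have "norm (diag t (lower x)) \<le> b * norm x"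
    using norm_diag_le[OF assms, of "lower x"] by (meson mult_left_mono order_trans)
  moreover have "norm (raise (diag t x)) \<le> norm (diag t x)"
    by (rule norm_le_coord_raiseI) (simp_all add: raise.rep_eq)
  ultimately show ?thesis
    using norm_diag_le[OF assms, of x] norm_triangle_ineq[of "diag t (lower x)" "raise (diag t x)"]
    unfolding hop_def by simp
qed

lemma hop_linear: "hop t (x + y) = hop t x + hop t y" "hop t (c *\<^sub>C x) = c *\<^sub>C hop t x"
  by (auto intro!: ell2_eqI split: nat.splits
      simp: hop_def diag_linear coord_simps raise.rep_eq lower.rep_eq diag.rep_eq algebra_simps)

lemma inner_hop_swap: "inner (hop t x) y = inner x (hop t y)"
  by (simp add: hop_def inner_add inner_diag_swap inner_raise inner_commute[of x "raise _"]
      inner_commute[of "lower _"] inner_commute[of "diag _ _" x])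

lemma inner_creation:
  assumes "x \<in> ladder_dom" "y \<in> ladder_dom"
  shows "inner (creation x) y = inner x (annihilation y)"
proof (rule sums_unique2[OF inner_ell2_sums])
  show "(\<lambda>n. Re (cnj (coord (creation x) n) * coord y n)) sums inner x (annihilation y)"
    using inner_ell2_sums[of x "annihilation y"]
      sums_Suc_iff[of "\<lambda>n. Re (cnj (coord (creation x) n) * coord y n)" "inner x (annihilation y)"]
    by (simp add: creation_coord annihilation_coord assms algebra_simps)
qed

lemma gen_skew:
  assumes "x \<in> ladder_dom" "y \<in> ladder_dom"
  shows "inner (gen x) y = - inner x (gen y)"
  using inner_creation[OF assms] inner_creation[OF assms(2,1)]
  by (simp add: gen_def inner_diff_left inner_diff_right inner_commute)

lemma gen_coord:
  assumes "x \<in> ladder_dom"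
  shows "coord (gen x) n = sqrt (real n) * coord x (n - 1) - sqrt (real (Suc n)) * coord x (Suc n)"
  by (simp add: gen_def minus_ell2.rep_eq creation_coord annihilation_coord assms)

lemma diag_ladder_dom:
  assumes "\<forall>m. \<bar>s m\<bar> \<le> B" "x \<in> ladder_dom"
  shows "diag s x \<in> ladder_dom"
proof -
  obtain y where "x = damp y" using assms(2) by (rule ladder_domE)
  then have "diag s x = damp (diag s y)"
    by (intro ell2_eqI) (simp add: coord_diag[OF assms(1)] damp.rep_eq)
  then show ?thesis by (simp add: damp_in_ladder_dom)
qed

definition jump :: "(nat \<Rightarrow> real) \<Rightarrow> nat \<Rightarrow> real" where
  "jump s m = sqrt (real (Suc m)) * (s (Suc m) - s m)"

text \<open>Each pair of neighbouring levels m, m + 1 contributes the ladder entry sqrt (m + 1)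
  times the increment of s. Increments of order 1 / sqrt m or smaller thus compensate the growth of
  the ladder operators.\<close>

lemma commutator:
  assumes s: "\<forall>m. \<bar>s m\<bar> \<le> B" and t: "\<forall>m. \<bar>jump s m\<bar> \<le> b" and x: "x \<in> ladder_dom"
  shows "diag s (gen x) - gen (diag s x) = hop (jump s) x"
proof (rule ell2_eqI)
  fix n
  show "coord (diag s (gen x) - gen (diag s x)) n = coord (hop (jump s) x) n"
    by (cases n)
      (simp_all add: coord_simps coord_diag[OF s] coord_diag[OF t] gen_coord x diag_ladder_dom[OF s x]
        hop_def raise.rep_eq lower.rep_eq jump_def algebra_simps)
qed

lemma form_derivative:
  assumes s: "\<forall>m. \<bar>s m\<bar> \<le> B" and t: "\<forall>m. \<bar>jump s m\<bar> \<le> b"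
    and x: "x \<in> ladder_dom" and y: "y \<in> ladder_dom"
  shows "((\<lambda>a. inner (disp a x) (diag s (disp a y))) has_real_derivative
    inner (disp a x) (hop (jump s) (disp a y))) (at a)"
proof -
  let ?x = "disp a x" and ?y = "disp a y"
  have dom: "?x \<in> ladder_dom" "?y \<in> ladder_dom" by (intro disp_annihilation x y)+
  have "((\<lambda>a. inner (disp a x) (diag s (disp a y))) has_vector_derivative
      inner ?x (diag s (gen ?y)) + inner (gen ?x) (diag s ?y)) (at a)"
    by (intro bounded_bilinear.has_vector_derivative[OF bounded_bilinear_inner]
        bounded_linear.has_vector_derivative[OF bounded_linear_diag[OF s]] disp_has_vector_derivative x y)
  \<comment> \<open>Skew-symmetry of \<open>gen\<close> merges the two terms of the product rule
    into a commutator.\<close>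
  also have "inner ?x (diag s (gen ?y)) + inner (gen ?x) (diag s ?y) = inner ?x (diag s (gen ?y) - gen (diag s ?y))"
    by (simp add: gen_skew dom diag_ladder_dom[OF s] inner_diff_right)
  finally show ?thesis
    by (simp add: commutator[OF s t] dom has_real_derivative_iff_has_vector_derivative)
qed

lemma ladder_dom_sequence: "\<exists>f. (\<forall>n. f n \<in> ladder_dom) \<and> f \<longlonglongrightarrow> x"
proof (intro exI conjI allI)
  have "0 \<in> ladder_dom" using damp_in_ladder_dom[of 0] by (simp add: damp_linear)
  then show "(\<Sum>m<n. coord x m *\<^sub>C fock m) \<in> ladder_dom" for n
    by (induction n) (auto intro: ladder_dom_closed fock_in_ladder_dom)
qed (rule fock_expansion)

text \<open>Only the bound b of the commutator enters, not the bound B of the weights, so the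
  estimate is uniform over truncations of an unbounded weight. It is a mean value estimate on
  \<open>ladder_dom\<close>, extended by density.\<close>

lemma form_bound:
  assumes s: "\<forall>m. \<bar>s m\<bar> \<le> B" and t: "\<forall>m. \<bar>jump s m\<bar> \<le> b"
  shows "\<bar>inner (disp a x) (diag s (disp a y)) - inner x (diag s y)\<bar> \<le> 2 * b * \<bar>a\<bar> * norm x * norm y"
proof -
  have dom: "\<bar>inner (disp a x) (diag s (disp a y)) - inner x (diag s y)\<bar> \<le> 2 * b * \<bar>a\<bar> * norm x * norm y"
    if x: "x \<in> ladder_dom" and y: "y \<in> ladder_dom" for x y
  proof -
    have "norm (inner (disp a x) (diag s (disp a y)) - inner (disp 0 x) (diag s (disp 0 y)))
        \<le> (norm x * (2 * b * norm y)) * norm (a - 0)"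
    proof (rule field_differentiable_bound[of UNIV])
      fix z
      show "((\<lambda>a. inner (disp a x) (diag s (disp a y))) has_real_derivative
          inner (disp z x) (hop (jump s) (disp z y))) (at z within UNIV)"
        using form_derivative[OF s t x y] by simp
      have "\<bar>inner (disp z x) (hop (jump s) (disp z y))\<bar> \<le> norm (disp z x) * norm (hop (jump s) (disp z y))"
        by (rule Cauchy_Schwarz_ineq2)
      also have "\<dots> \<le> norm x * (2 * b * norm y)"
        unfolding norm_disp using norm_hop_le[OF t, of "disp z y"]
        by (intro mult_left_mono) (simp_all add: norm_disp)
      finally show "norm (inner (disp z x) (hop (jump s) (disp z y))) \<le> norm x * (2 * b * norm y)" by simp
    qed auto
    then show ?thesis by (simp add: disp_0 mult_ac)
  qed
  obtain f where f: "\<And>n. f n \<in> ladder_dom" "f \<longlonglongrightarrow> x" using ladder_dom_sequence by metis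
  obtain g where g: "\<And>n. g n \<in> ladder_dom" "g \<longlonglongrightarrow> y" using ladder_dom_sequence by metis
  show ?thesis
  proof (rule LIMSEQ_le)
    show "(\<lambda>n. \<bar>inner (disp a (f n)) (diag s (disp a (g n))) - inner (f n) (diag s (g n))\<bar>) \<longlonglongrightarrow>
        \<bar>inner (disp a x) (diag s (disp a y)) - inner x (diag s y)\<bar>"
      by (intro tendsto_intros f g bounded_linear.tendsto[OF bounded_linear_disp]
          bounded_linear.tendsto[OF bounded_linear_diag[OF s]])
    show "(\<lambda>n. 2 * b * \<bar>a\<bar> * norm (f n) * norm (g n)) \<longlonglongrightarrow> 2 * b * \<bar>a\<bar> * norm x * norm y"
      by (intro tendsto_intros f g)
  qed (use dom f g in blast)
qed

lemma gen_fock: "gen (fock n) = of_real (sqrt (real (Suc n))) *\<^sub>C fock (Suc n) - of_real (sqrt (real n)) *\<^sub>C fock (n - 1)"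
  unfolding gen_def annihilation_fock creation_fock by (simp add: scaleR_eq_scaleC)

text \<open>Let q be the quadratic form of s along the orbit of the n-th Fock state. Then q'(0) = 0,
  since \<open>hop\<close> has zero diagonal, and q''(0) is twice the expression assumed to be at
  most - k. Hence q'(z) \<le> - k z for small z, and integration gives the claim. The threshold a0
  depends on b, k and n but not on s, so it is the same for all truncations.\<close>

lemma fock_descent:
  assumes b: "b > 0" and k: "k > 0"
  shows "\<exists>a0. 0 < a0 \<and> a0 \<le> 1 \<and> (\<forall>s B a. (\<forall>m. \<bar>s m\<bar> \<le> B) \<longrightarrow> (\<forall>m. \<bar>jump s m\<bar> \<le> b) \<longrightarrow>
     sqrt (real (Suc n)) * jump s n - sqrt (real n) * jump s (n - 1) \<le> - k \<longrightarrow> 0 \<le> a \<longrightarrow> a \<le> a0 \<longrightarrow>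
     inner (disp a (fock n)) (diag s (disp a (fock n))) \<le> s n - k / 2 * a\<^sup>2)"
proof -
  define g where "g = gen (fock n)"
  define G where "G = norm g"
  have G0: "G \<ge> 0" by (simp add: G_def)
  \<comment> \<open>Of the slope - 2 k z one can give up k z: half of this pays for the
    linearization error of the orbit (through e), the other half for the term quadratic in z
    (through a0).\<close>
  define e where "e = k / (4 * b * (2 + G))"
  have e: "e > 0" using b k G0 by (simp add: e_def)
  have "2 + G \<noteq> 0" "b \<noteq> 0" using b G0 by auto
  then have "e * (4 * b * (2 + G)) = k" by (simp add: e_def)
  then have be: "2 * b * (2 + G) * e = k / 2" by (simp add: algebra_simps)
  have der: "((\<lambda>a. disp a (fock n)) has_vector_derivative g) (at 0)"
    using disp_has_vector_derivative[OF fock_in_ladder_dom, of n 0] by (simp add: disp_0 g_def)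
  obtain d where d: "d > 0" "\<And>a. \<bar>a\<bar> < d \<Longrightarrow> norm (disp a (fock n) - fock n - a *\<^sub>R g) \<le> e * \<bar>a\<bar>"
    using der[unfolded has_vector_derivative_alt, rule_format, OF e] by (auto simp: disp_0)
  define a0 where "a0 = min 1 (min (d / 2) (k / (4 * b * (G\<^sup>2 + 1))))"
  have a0: "0 < a0" "a0 \<le> 1" "a0 < d" "2 * b * G\<^sup>2 * a0 \<le> k / 2"
  proof -
    show "0 < a0" "a0 \<le> 1" "a0 < d" using d b k by (auto simp: a0_def min_less_iff_disj add_nonneg_pos)
    have "a0 \<le> k / (4 * b * (G\<^sup>2 + 1))" by (simp add: a0_def)
    then have "2 * b * G\<^sup>2 * a0 \<le> 2 * b * (G\<^sup>2 + 1) * (k / (4 * b * (G\<^sup>2 + 1)))"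
      using b \<open>0 < a0\<close> by (intro mult_mono) auto
    also have "\<dots> = k / 2" using b by (simp add: field_simps add_nonneg_eq_0_iff)
    finally show "2 * b * G\<^sup>2 * a0 \<le> k / 2" .
  qed
  have "inner (disp a (fock n)) (diag s (disp a (fock n))) \<le> s n - k / 2 * a\<^sup>2"
    if s: "\<forall>m. \<bar>s m\<bar> \<le> B" and t: "\<forall>m. \<bar>jump s m\<bar> \<le> b"
      and curv: "sqrt (real (Suc n)) * jump s n - sqrt (real n) * jump s (n - 1) \<le> - k"
      and a: "0 \<le> a" "a \<le> a0" for s B a
  proof -
    let ?T = "hop (jump s)"
    let ?q = "\<lambda>a. inner (disp a (fock n)) (diag s (disp a (fock n)))"
    have T: "norm (?T x) \<le> 2 * b * norm x" for x by (rule norm_hop_le[OF t])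
    have IT: "\<bar>inner x (?T y)\<bar> \<le> 2 * b * norm x * norm y" for x y
    proof -
      have "\<bar>inner x (?T y)\<bar> \<le> norm x * norm (?T y)" by (rule Cauchy_Schwarz_ineq2)
      also have "\<dots> \<le> norm x * (2 * b * norm y)" by (intro mult_left_mono T) simp
      finally show ?thesis by (simp add: mult_ac)
    qed
    have Tadd: "?T (x + y) = ?T x + ?T y" "?T (r *\<^sub>R x) = r *\<^sub>R ?T x" for x y r
      by (simp_all add: hop_linear scaleR_eq_scaleC)
    have nn: "inner (fock n) (?T (fock n)) = 0"
      by (simp add: inner_fock_left hop_def coord_simps coord_diag[OF t] lower.rep_eq raise.rep_eq split: nat.splits)
    have ng: "inner (fock n) (?T g) = sqrt (real (Suc n)) * jump s n - sqrt (real n) * jump s (n - 1)"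
      by (cases n) (simp_all add: inner_fock_left hop_def coord_simps coord_diag[OF t] lower.rep_eq raise.rep_eq g_def gen_fock
          del: of_nat_Suc)
    have step: "inner (disp z (fock n)) (?T (disp z (fock n))) + k * z \<le> 0" if z: "0 \<le> z" "z \<le> a0" for z
    proof -
      define u where "u = fock n + z *\<^sub>R g"
      define r where "r = disp z (fock n) - u"
      have dz: "disp z (fock n) = u + r" by (simp add: r_def)
      have r: "norm r \<le> e * z" using d(2)[of z] z a0 by (simp add: r_def u_def algebra_simps)
      have "norm u \<le> norm (fock n) + norm (z *\<^sub>R g)" unfolding u_def by (rule norm_triangle_ineq)
      also have "\<dots> \<le> 1 + G" using z a0 G0 by (simp add: G_def mult_left_le_one_le)
      finally have u: "norm u \<le> 1 + G" .
      have "inner (u + r) (?T (u + r)) = inner u (?T u) + inner r (?T (u + r)) + inner u (?T r)"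
        by (simp add: Tadd inner_add)
      moreover have "inner r (?T (u + r)) \<le> 2 * b * (e * z) * 1"
      proof -
        have "inner r (?T (u + r)) \<le> 2 * b * norm r * norm (u + r)" using IT[of r "u + r"] by linarith
        also have "norm (u + r) = 1" unfolding dz[symmetric] by (simp add: norm_disp)
        also have "2 * b * norm r * 1 \<le> 2 * b * (e * z) * 1" using r b by simp
        finally show ?thesis .
      qed
      moreover have "inner u (?T r) \<le> 2 * b * (1 + G) * (e * z)"
      proof -
        have "inner u (?T r) \<le> 2 * b * norm u * norm r" using IT[of u r] by linarith
        also have "\<dots> \<le> 2 * b * (1 + G) * (e * z)" using r u b G0 by (intro mult_mono) auto
        finally show ?thesis .
      qed
      moreover have "inner u (?T u) \<le> - 2 * k * z + z * (k / 2)"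
      proof -
        have "inner u (?T u) = 2 * z * inner (fock n) (?T g) + z\<^sup>2 * inner g (?T g)"
          using nn inner_hop_swap[of "jump s" g "fock n"]
          by (simp add: u_def Tadd inner_add inner_commute power2_eq_square algebra_simps)
        also have "\<dots> \<le> 2 * z * (- k) + z * (z * (2 * b * G * G))"
        proof (rule add_mono)
          show "2 * z * inner (fock n) (?T g) \<le> 2 * z * (- k)"
            unfolding ng using curv z by (intro mult_left_mono) auto
          have "inner g (?T g) \<le> 2 * b * G * G" using IT[of g g] unfolding G_def by linarith
          then show "z\<^sup>2 * inner g (?T g) \<le> z * (z * (2 * b * G * G))"
            unfolding power2_eq_square mult.assoc using z by (intro mult_left_mono) auto
        qed
        also have "z * (z * (2 * b * G * G)) \<le> z * (a0 * (2 * b * G * G))"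
          using z b G0 by (intro mult_left_mono mult_right_mono) auto
        also have "z * (a0 * (2 * b * G * G)) \<le> z * (k / 2)"
          using a0(4) z by (intro mult_left_mono) (auto simp: power2_eq_square mult_ac)
        finally show ?thesis by simp
      qed
      moreover have "2 * b * (e * z) * 1 + 2 * b * (1 + G) * (e * z) = (k / 2) * z"
        unfolding be[symmetric] by (simp add: algebra_simps)
      ultimately show ?thesis unfolding dz by (simp add: algebra_simps)
    qed
    have "?q a + k / 2 * a\<^sup>2 \<le> ?q 0 + k / 2 * 0\<^sup>2"
    proof (rule DERIV_nonpos_imp_nonincreasing[OF a(1)])
      fix z assume z: "0 \<le> z" "z \<le> a"
      have "((\<lambda>z. ?q z + k / 2 * z\<^sup>2) has_real_derivative
          inner (disp z (fock n)) (?T (disp z (fock n))) + k / 2 * (2 * z)) (at z)"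
        by (intro DERIV_add form_derivative[OF s t] fock_in_ladder_dom) (auto intro!: derivative_eq_intros)
      moreover have "inner (disp z (fock n)) (?T (disp z (fock n))) + k / 2 * (2 * z) \<le> 0"
        using step[of z] z a by simp
      ultimately show "\<exists>y. ((\<lambda>z. ?q z + k / 2 * z\<^sup>2) has_real_derivative y) (at z) \<and> y \<le> 0"
        by blast
    qed
    moreover have "?q 0 = s n"
      by (simp add: disp_0 inner_fock_left coord_diag[OF s] coord_simps)
    ultimately show ?thesis by simp
  qed
  then show ?thesis using a0(1,2) by blast
qed

section \<open>The weights of the Lyapunov function\<close>

lemma sigma_step:
  assumes "nbar \<ge> 2"
  shows "sigma nbar (Suc n) - sigma nbar n =
    (if n = 0 then - 1 / 8
     else if n < nbar then - (1 / real (Suc n) - 1 / (real (Suc n))\<^sup>2)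
     else 1 / real (Suc n) + 1 / (real (Suc n))\<^sup>2)"
proof -
  consider "n = 0" | "n > 0" "n < nbar" | "n \<ge> nbar" by linarith
  then show ?thesis
  proof cases
    case 1
    \<comment> \<open>The summand for k = 1 is 1 - 1 = 0, so the weights of the levels 0 and 1
      differ by exactly 1/8.\<close>
    have "(\<Sum>k = 1..nbar. 1 / real k - 1 / (real k)\<^sup>2) = 0 + (\<Sum>k = Suc 1..nbar. 1 / real k - 1 / (real k)\<^sup>2)"
      using assms by (subst sum.atLeast_Suc_atMost) auto
    then show ?thesis using 1 assms by (simp add: sigma_def)
  next
    case 2
    have "(\<Sum>k = n + 1..nbar. 1 / real k - 1 / (real k)\<^sup>2)
        = (1 / real (Suc n) - 1 / (real (Suc n))\<^sup>2) + (\<Sum>k = Suc (n + 1)..nbar. 1 / real k - 1 / (real k)\<^sup>2)"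
      using 2 by (subst sum.atLeast_Suc_atMost) auto
    then show ?thesis using 2 by (simp add: sigma_def)
  next
    case 3
    have "(\<Sum>k = nbar + 1..Suc n. 1 / real k + 1 / (real k)\<^sup>2)
        = (\<Sum>k = nbar + 1..n. 1 / real k + 1 / (real k)\<^sup>2) + (1 / real (Suc n) + 1 / (real (Suc n))\<^sup>2)"
      using 3 by simp
    then show ?thesis using 3 assms by (simp add: sigma_def)
  qed
qed

lemma inverse_square_le: "1 / (real k)\<^sup>2 \<le> 1 / real k"
  by (cases "k = 0") (auto simp: power2_eq_square divide_simps)

lemma sigma_nonneg: "sigma nbar n \<ge> 0"
  unfolding sigma_def
  by (auto intro!: sum_nonneg add_nonneg_nonneg simp: inverse_square_le)

lemma sigma_mono:
  assumes "nbar \<ge> 2" "nbar \<le> m" "m \<le> n"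
  shows "sigma nbar m \<le> sigma nbar n"
  using assms(3)
proof (induction n rule: dec_induct)
  case (step n)
  then have "sigma nbar (Suc n) - sigma nbar n \<ge> 0"
    using assms by (subst sigma_step[OF assms(1)]) auto
  then show ?case using step by simp
qed simp

lemma sigma_pos_bound:
  assumes "nbar \<ge> 2"
  shows "\<exists>c>0. \<forall>n. n \<noteq> nbar \<longrightarrow> c \<le> sigma nbar n"
proof -
  have pos: "1 / real nbar - 1 / (real nbar)\<^sup>2 > 0"
    using assms by (simp add: power2_eq_square divide_simps)
  define c where "c = min (1 / 8) (min (1 / real nbar - 1 / (real nbar)\<^sup>2) (sigma nbar (Suc nbar)))"
  have "sigma nbar (Suc nbar) > 0" using assms by (simp add: sigma_def add_pos_pos)
  then have "c > 0" using pos by (simp add: c_def)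
  moreover have "c \<le> sigma nbar n" if "n \<noteq> nbar" for n
  proof -
    consider "n = 0" | "n > 0" "n < nbar" | "n > nbar" using \<open>n \<noteq> nbar\<close> by linarith
    then show ?thesis
    proof cases
      case 1
      have "(\<Sum>k = 1..nbar. 1 / real k - 1 / (real k)\<^sup>2) \<ge> 0"
        by (intro sum_nonneg) (simp add: inverse_square_le)
      then show ?thesis using 1 by (simp add: sigma_def c_def)
    next
      case 2
      have "1 / real nbar - 1 / (real nbar)\<^sup>2 \<le> (\<Sum>k = n + 1..nbar. 1 / real k - 1 / (real k)\<^sup>2)"
        using 2 by (intro member_le_sum) (auto simp: inverse_square_le)
      then show ?thesis using 2 by (simp add: sigma_def c_def)
    next
      case 3
      then show ?thesis using sigma_mono[OF assms, of "Suc nbar" n] by (simp add: c_def)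
    qed
  qed
  ultimately show ?thesis by blast
qed

lemma sigma_unbounded:
  assumes "nbar \<ge> 2"
  shows "\<exists>N\<ge>nbar. K \<le> sigma nbar N"
proof (rule ccontr)
  assume "\<not> ?thesis"
  then have bd: "sigma nbar (nbar + m) \<le> K" for m using not_le_imp_less less_imp_le by (metis le_add1)
  have low: "(\<Sum>i<m. inverse (real (i + Suc nbar))) \<le> sigma nbar (nbar + m)" for m
  proof (induction m)
    case 0
    then show ?case by (simp add: sigma_nonneg)
  next
    case (Suc m)
    have "sigma nbar (Suc (nbar + m)) - sigma nbar (nbar + m) \<ge> inverse (real (m + Suc nbar))"
      using assms by (subst sigma_step[OF assms]) (auto simp: divide_inverse add_ac)
    then show ?case using Suc by simp
  qed
  have "summable (\<lambda>i. inverse (real (i + Suc nbar)))"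
    by (rule summableI_nonneg_bounded[where x = K]) (use low bd order_trans in \<open>auto\<close>, blast)
  then have "summable (\<lambda>i. inverse (real i))" by (subst (asm) summable_iff_shift)
  then show False using not_summable_harmonic[where 'a = real] by simp
qed

text \<open>Freezing the weights beyond M makes the energy a bounded quadratic form without
  enlarging any increment, so the commutator has one bound for all M.\<close>

definition sigma_cut :: "nat \<Rightarrow> nat \<Rightarrow> nat \<Rightarrow> real" where
  "sigma_cut nbar M m = sigma nbar (min m M)"

lemma sigma_cut_bounded: "\<exists>B. \<forall>m. \<bar>sigma_cut nbar M m\<bar> \<le> B"
proof (intro exI allI)
  show "\<bar>sigma_cut nbar M m\<bar> \<le> (\<Sum>i\<le>M. \<bar>sigma nbar i\<bar>)" for m
    unfolding sigma_cut_def by (rule member_le_sum) auto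
qed

lemma jump_sigma_cut: "jump (sigma_cut nbar M) m =
    (if m < M then sqrt (real (Suc m)) * (sigma nbar (Suc m) - sigma nbar m) else 0)"
  by (auto simp: jump_def sigma_cut_def min_def)

lemma jump_sigma_cut_bounded:
  assumes "nbar \<ge> 2"
  shows "\<forall>m. \<bar>jump (sigma_cut nbar M) m\<bar> \<le> 2"
proof
  fix m
  let ?r = "real (Suc m)"
  have i: "1 / ?r\<^sup>2 \<le> 1 / ?r" by (rule inverse_square_le)
  have "\<bar>sigma nbar (Suc m) - sigma nbar m\<bar> \<le> 2 / ?r"
  proof (cases "m = 0")
    case False
    have *: "0 \<le> 1 / ?r\<^sup>2" "2 / ?r = 1 / ?r + 1 / ?r" "0 \<le> 1 / ?r" by simp_all
    show ?thesis unfolding sigma_step[OF assms] if_not_P[OF False]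
      by (cases "m < nbar"; simp only: if_True if_False; use * i in linarith)
  qed (simp add: sigma_step[OF assms])
  then have "sqrt ?r * \<bar>sigma nbar (Suc m) - sigma nbar m\<bar> \<le> sqrt ?r * (2 / ?r)"
    by (intro mult_left_mono) auto
  also have "\<dots> \<le> ?r * (2 / ?r)"
  proof (rule mult_right_mono)
    have "sqrt ?r \<le> sqrt (?r * ?r)" by (intro real_sqrt_le_mono) simp
    then show "sqrt ?r \<le> ?r" by simp
  qed simp
  also have "\<dots> = 2" by (simp del: of_nat_Suc)
  finally show "\<bar>jump (sigma_cut nbar M) m\<bar> \<le> 2" unfolding jump_sigma_cut by (simp add: abs_mult del: of_nat_Suc)
qed

text \<open>Half the second derivative at a = 0 of the energy along the orbit
  \<open>disp a (fock n)\<close>; equivalently, the quadratic form of \<sigma> - \<sigma>_n at the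
  vector \<open>gen (fock n)\<close>.\<close>

definition curvature :: "nat \<Rightarrow> nat \<Rightarrow> real" where
  "curvature nbar n = real (Suc n) * (sigma nbar (Suc n) - sigma nbar n)
     - real n * (sigma nbar n - sigma nbar (n - 1))"

text \<open>The weights are designed for this. The scaled increments k (\<sigma>_k - \<sigma>_(k-1))
  are - (1 - 1/k) for 2 \<le> k \<le> nbar and 1 + 1/k for k > nbar, so they strictly decrease
  except from k = nbar to k = nbar + 1. For k = 1 the first formula would give 0 and no descent at
  the level 0; the value - 1/8 lies strictly between 0 and the value - 1/2 at k = 2.\<close>

lemma curvature_neg:
  assumes nb: "nbar \<ge> 2" and n: "n \<noteq> nbar"
  shows "curvature nbar n < 0"
proof -
  have step_low: "real (Suc m) * (sigma nbar (Suc m) - sigma nbar m) = - (1 - 1 / real (Suc m))" if "0 < m" "m < nbar" for m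
    unfolding sigma_step[OF nb] using that by (simp add: power2_eq_square right_diff_distrib del: of_nat_Suc)
  have step_high: "real (Suc m) * (sigma nbar (Suc m) - sigma nbar m) = 1 + 1 / real (Suc m)" if "m \<ge> nbar" for m
    unfolding sigma_step[OF nb] using that nb by (simp add: power2_eq_square distrib_left del: of_nat_Suc)
  have step_0: "sigma nbar (Suc 0) - sigma nbar 0 = - 1 / 8" unfolding sigma_step[OF nb] by simp
  have less: "1 / real (Suc (Suc k)) < 1 / real (Suc k)" for k by (simp add: divide_strict_left_mono)
  consider "n = 0" | "n = 1" | k where "n = Suc k" "k > 0" "n < nbar" | k where "n = Suc k" "k \<ge> nbar"
    using n by (cases n; cases "n - 1") force+
  then show ?thesis
  proof cases
    case 1
    then show ?thesis using step_0 by (simp add: curvature_def)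
  next
    case 2
    then show ?thesis using step_0 step_low[of 1] nb by (simp add: curvature_def)
  next
    case 3
    then show ?thesis using step_low[of n] step_low[of k] less[of k] by (simp add: curvature_def del: of_nat_Suc)
  next
    case 4
    then show ?thesis using step_high[of n] step_high[of k] less[of k] by (simp add: curvature_def del: of_nat_Suc)
  qed
qed

lemma curvature_jump:
  assumes "n < M"
  shows "sqrt (real (Suc n)) * jump (sigma_cut nbar M) n - sqrt (real n) * jump (sigma_cut nbar M) (n - 1) = curvature nbar n"
proof -
  have sq: "sqrt (real k) * (sqrt (real k) * z) = real k * z" for k z
    by (simp add: mult.assoc[symmetric])
  show ?thesis
    using assms by (cases n) (simp_all add: jump_sigma_cut curvature_def sq del: of_nat_Suc)
qed

section \<open>The energy and its truncations\<close>

definition population :: "ell2 \<Rightarrow> nat \<Rightarrow> real" where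
  "population x n = (cmod (coord x n))\<^sup>2"

lemma population_nonneg [simp]: "0 \<le> population x n"
  by (simp add: population_def)

lemma population_sums: "population x sums (norm x)\<^sup>2"
  using norm_ell2_sums[of x] by (simp add: population_def[abs_def])

definition energy :: "nat \<Rightarrow> ell2 \<Rightarrow> ennreal" where
  "energy nbar x = (\<Sum>n. ennreal (sigma nbar n * population x n))"

definition energy_cut :: "nat \<Rightarrow> nat \<Rightarrow> ell2 \<Rightarrow> real" where
  "energy_cut nbar M x = inner x (diag (sigma_cut nbar M) x)"

lemma inner_diag_sums:
  assumes "\<forall>m. \<bar>s m\<bar> \<le> B"
  shows "(\<lambda>n. s n * population x n) sums inner x (diag s x)"
proof -
  have "Re (cnj (coord x n) * coord (diag s x) n) = s n * population x n" for n
  proof -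
    have "cnj (coord x n) * coord (diag s x) n = of_real (s n) * (coord x n * cnj (coord x n))"
      by (simp add: coord_diag[OF assms] mult_ac)
    also have "coord x n * cnj (coord x n) = of_real (population x n)"
      by (simp add: population_def complex_norm_square[symmetric])
    finally show ?thesis by simp
  qed
  then show ?thesis using inner_ell2_sums[of x "diag s x"] by simp
qed

lemma energy_cut_sums: "(\<lambda>n. sigma_cut nbar M n * population x n) sums energy_cut nbar M x"
  unfolding energy_cut_def using sigma_cut_bounded inner_diag_sums by blast

lemma energy_cut_le_energy:
  assumes "nbar \<ge> 2" "nbar \<le> M"
  shows "ennreal (energy_cut nbar M x) \<le> energy nbar x"
proof -
  have nn: "0 \<le> sigma_cut nbar M n * population x n" for n
    by (simp add: sigma_cut_def sigma_nonneg)
  have "ennreal (energy_cut nbar M x) = (\<Sum>n. ennreal (sigma_cut nbar M n * population x n))"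
    using energy_cut_sums[of nbar M x] nn by (intro suminf_ennreal_eq[symmetric])
  also have "\<dots> \<le> energy nbar x"
    unfolding energy_def
  proof (intro suminf_le ennreal_leI mult_right_mono)
    show "sigma_cut nbar M n \<le> sigma nbar n" for n
      using sigma_mono[OF assms(1,2), of n] by (auto simp: sigma_cut_def min_def)
  qed auto
  finally show ?thesis .
qed

text \<open>A partial sum of the energy involves finitely many levels and is dominated by any
  truncation beyond them.\<close>

lemma energy_le_of_cut:
  assumes "\<And>M. M \<ge> M0 \<Longrightarrow> ennreal (energy_cut nbar M x) \<le> B"
  shows "energy nbar x \<le> B"
  unfolding energy_def
proof (rule suminf_le_const)
  fix k
  have nn: "0 \<le> sigma_cut nbar (max k M0) n * population x n" for n
    by (simp add: sigma_cut_def sigma_nonneg)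
  have "(\<Sum>n<k. ennreal (sigma nbar n * population x n)) = ennreal (\<Sum>n<k. sigma_cut nbar (max k M0) n * population x n)"
    by (subst sum_ennreal[symmetric]) (auto simp: sigma_nonneg sigma_cut_def intro!: sum.cong)
  also have "(\<Sum>n<k. sigma_cut nbar (max k M0) n * population x n) \<le> energy_cut nbar (max k M0) x"
    using energy_cut_sums[of nbar "max k M0" x] nn
    by (simp add: sums_iff) (metis finite_lessThan sum_le_suminf)
  then have "ennreal (\<Sum>n<k. sigma_cut nbar (max k M0) n * population x n) \<le> ennreal (energy_cut nbar (max k M0) x)"
    by (rule ennreal_leI)
  also have "\<dots> \<le> B" by (rule assms) simp
  finally show "(\<Sum>n<k. ennreal (sigma nbar n * population x n)) \<le> B" .
qed auto

text \<open>By symmetry, the difference of a quadratic form at x and at y is its bilinear form at x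
  - y and x + y. Then \<open>form_bound\<close> with b = 2 and norm (x + y) \<le> 2 yields the 8. It
  is the change of the energy under \<open>disp a\<close>, not the energy, that is Lipschitz
  uniformly in M.\<close>

lemma energy_cut_shift_le:
  assumes nb: "nbar \<ge> 2" and x: "norm x \<le> 1" and y: "norm y \<le> 1"
  shows "energy_cut nbar M (disp a x) - energy_cut nbar M x
    \<le> energy_cut nbar M (disp a y) - energy_cut nbar M y + 8 * \<bar>a\<bar> * norm (x - y)"
proof -
  obtain B where s: "\<forall>m. \<bar>sigma_cut nbar M m\<bar> \<le> B" using sigma_cut_bounded by blast
  let ?S = "diag (sigma_cut nbar M)"
  let ?P = "\<lambda>x y. inner (disp a x) (?S (disp a y)) - inner x (?S y)"
  note lin = linear_diff[OF bounded_linear.linear[OF bounded_linear_disp]] 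
    linear_diff[OF bounded_linear.linear[OF bounded_linear_diag[OF s]]]
  have sym: "inner u (?S v) = inner v (?S u)" for u v
    using inner_diag_swap[of "sigma_cut nbar M" u v] by (simp add: inner_commute)
  have "?P x x - ?P y y = ?P (x - y) (x + y)"
    unfolding disp_add_vec diag_linear lin inner_diff_left inner_add_right
    using sym[of x y] sym[of "disp a x" "disp a y"] by simp
  also have "\<dots> \<le> 2 * 2 * \<bar>a\<bar> * norm (x - y) * norm (x + y)"
    using form_bound[OF s jump_sigma_cut_bounded[OF nb], of a "x - y" "x + y"] by linarith
  also have "\<dots> \<le> 2 * 2 * \<bar>a\<bar> * norm (x - y) * 2"
    using norm_triangle_ineq[of x y] x y by (intro mult_left_mono) auto
  finally show ?thesis by (simp add: energy_cut_def)
qed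

lemma energy_cut_phase:
  assumes "cmod c = 1"
  shows "energy_cut nbar M (c *\<^sub>C x) = energy_cut nbar M x"
proof -
  have "population (c *\<^sub>C x) = population x"
    by (auto simp: population_def coord_simps norm_mult assms)
  then show ?thesis
    using energy_cut_sums[of nbar M x] energy_cut_sums[of nbar M "c *\<^sub>C x"] by (simp add: sums_unique2)
qed

text \<open>The descent at the Fock state is transferred to x at a price linear in the distance,
  first for the truncations and then for the energy. The gain is a summand on the left because the
  energies may be infinite.\<close>

lemma energy_descent:
  assumes nb: "nbar \<ge> 2" and n: "n \<noteq> nbar" and k: "k > 0" "curvature nbar n \<le> - k"
  shows "\<exists>a0. 0 < a0 \<and> a0 \<le> 1 \<and> (\<forall>a x c. 0 \<le> a \<longrightarrow> a \<le> a0 \<longrightarrow> norm x = 1 \<longrightarrow> cmod c = 1 \<longrightarrow>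
    energy nbar (disp a x) + ennreal (k / 2 * a\<^sup>2) \<le> energy nbar x + ennreal (8 * a * norm (x - c *\<^sub>C fock n)))"
proof -
  have two: "(2::real) > 0" by simp
  obtain a0 where a0: "0 < a0" "a0 \<le> 1" and
    desc: "\<And>s B a. (\<forall>m. \<bar>s m\<bar> \<le> B) \<Longrightarrow> (\<forall>m. \<bar>jump s m\<bar> \<le> 2) \<Longrightarrow>
     sqrt (real (Suc n)) * jump s n - sqrt (real n) * jump s (n - 1) \<le> - k \<Longrightarrow> 0 \<le> a \<Longrightarrow> a \<le> a0 \<Longrightarrow>
     inner (disp a (fock n)) (diag s (disp a (fock n))) \<le> s n - k / 2 * a\<^sup>2"
    using fock_descent[OF two k(1), of n] by blast
  have "energy nbar (disp a x) + ennreal (k / 2 * a\<^sup>2) \<le> energy nbar x + ennreal (8 * a * norm (x - c *\<^sub>C fock n))"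
    if a: "0 \<le> a" "a \<le> a0" and x: "norm x = 1" and c: "cmod c = 1" for a x c
  proof (cases "energy nbar x = \<infinity>")
    case False
    then obtain e where e: "e \<ge> 0" "energy nbar x = ennreal e" by (cases "energy nbar x") auto
    let ?d = "norm (x - c *\<^sub>C fock n)"
    have cut: "energy_cut nbar M (disp a x) \<le> e - k / 2 * a\<^sup>2 + 8 * a * ?d" if M: "M \<ge> Suc (max nbar n)" for M
    proof -
      obtain B where s: "\<forall>m. \<bar>sigma_cut nbar M m\<bar> \<le> B" using sigma_cut_bounded by blast
      have "energy_cut nbar M (disp a (fock n)) \<le> sigma_cut nbar M n - k / 2 * a\<^sup>2"
        unfolding energy_cut_def
        by (rule desc[OF s jump_sigma_cut_bounded[OF nb]]) (use curvature_jump[of n M nbar] M k a in auto)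
      moreover have "energy_cut nbar M (fock n) = sigma_cut nbar M n"
        by (simp add: energy_cut_def inner_fock_left coord_diag[OF s] coord_simps)
      moreover have "energy_cut nbar M (disp a x) - energy_cut nbar M x
        \<le> energy_cut nbar M (disp a (c *\<^sub>C fock n)) - energy_cut nbar M (c *\<^sub>C fock n) + 8 * \<bar>a\<bar> * ?d"
        by (rule energy_cut_shift_le[OF nb]) (simp_all add: x norm_scaleC c)
      moreover have "energy_cut nbar M x \<le> e"
        using energy_cut_le_energy[OF nb, of M x] M e by (simp add: ennreal_le_iff)
      ultimately show ?thesis
        using a by (simp add: disp_scaleC energy_cut_phase[OF c])
    qed
    have "energy nbar (disp a x) \<le> ennreal (e - k / 2 * a\<^sup>2 + 8 * a * ?d)"
      by (rule energy_le_of_cut[of "Suc (max nbar n)"]) (intro ennreal_leI cut)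
    moreover have "0 \<le> e - k / 2 * a\<^sup>2 + 8 * a * ?d"
    proof -
      have "0 \<le> energy_cut nbar (Suc (max nbar n)) (disp a x)"
        by (rule sums_le[OF _ sums_zero energy_cut_sums]) (simp add: sigma_cut_def sigma_nonneg)
      then show ?thesis using cut[of "Suc (max nbar n)"] by linarith
    qed
    ultimately have "energy nbar (disp a x) + ennreal (k / 2 * a\<^sup>2) \<le> ennreal (e - k / 2 * a\<^sup>2 + 8 * a * ?d + k / 2 * a\<^sup>2)"
      using k by (subst ennreal_plus) (auto intro: add_right_mono)
    also have "\<dots> = ennreal e + ennreal (8 * a * ?d)"
      using e a by (simp add: ennreal_plus[symmetric] del: ennreal_plus)
    finally show ?thesis by (simp add: e)
  qed simp
  then show ?thesis using a0 by blast
qed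

section \<open>The Lyapunov function under displacement\<close>

lemma fourth_power: "x ^ 4 = (x\<^sup>2)\<^sup>2" for x :: real
  by (simp add: power_mult[symmetric])

lemma meas_op_sums:
  "(\<lambda>n. (angle_fun s (\<theta> + real n * \<phi>))\<^sup>2 * population x n) sums (norm (meas_op \<theta> \<phi> s x))\<^sup>2"
  using norm_ell2_sums[of "meas_op \<theta> \<phi> s x"]
  by (simp add: meas_op.rep_eq population_def norm_mult power_mult_distrib)

lemma meas_op_linear:
  "meas_op \<theta> \<phi> s (x + y) = meas_op \<theta> \<phi> s x + meas_op \<theta> \<phi> s y"
  "meas_op \<theta> \<phi> s (x - y) = meas_op \<theta> \<phi> s x - meas_op \<theta> \<phi> s y"
  "meas_op \<theta> \<phi> s (r *\<^sub>R x) = r *\<^sub>R meas_op \<theta> \<phi> s x"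
  by (auto intro!: ell2_eqI simp: meas_op.rep_eq coord_simps algebra_simps)

lemma angle_fun_abs_le: "\<bar>angle_fun s t\<bar> \<le> 1"
  by (cases s) auto

lemma norm_meas_op_le: "norm (meas_op \<theta> \<phi> s x) \<le> norm x"
  by (rule norm_le_coordI)
    (use angle_fun_abs_le in \<open>auto simp: meas_op.rep_eq norm_mult mult_left_le_one_le\<close>)

lemma bounded_linear_meas_op: "bounded_linear (meas_op \<theta> \<phi> s)"
  by (rule bounded_linear_intro[of _ 1]) (auto simp: meas_op_linear norm_meas_op_le)

definition ground_prob :: "real \<Rightarrow> real \<Rightarrow> ell2 \<Rightarrow> real" where
  "ground_prob \<theta> \<phi> x = (norm (meas_op \<theta> \<phi> Ground x))\<^sup>2"

lemma ground_prob_sums: "(\<lambda>n. (cos (\<theta> + real n * \<phi>))\<^sup>2 * population x n) sums ground_prob \<theta> \<phi> x"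
  unfolding ground_prob_def using meas_op_sums[of Ground] by simp

lemma excited_prob: "norm x = 1 \<Longrightarrow> (norm (meas_op \<theta> \<phi> Excited x))\<^sup>2 = 1 - ground_prob \<theta> \<phi> x"
proof -
  assume x: "norm x = 1"
  have "(\<lambda>n. (cos (\<theta> + real n * \<phi>))\<^sup>2 * population x n + (sin (\<theta> + real n * \<phi>))\<^sup>2 * population x n) sums
      (ground_prob \<theta> \<phi> x + (norm (meas_op \<theta> \<phi> Excited x))\<^sup>2)"
    by (intro sums_add ground_prob_sums) (use meas_op_sums[of Excited] in simp)
  then have "population x sums (ground_prob \<theta> \<phi> x + (norm (meas_op \<theta> \<phi> Excited x))\<^sup>2)"
    by (simp add: distrib_right[symmetric])
  then show ?thesis
    using sums_unique2[OF population_sums[of x]] x by force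
qed

lemma ground_prob_bounds: "norm x = 1 \<Longrightarrow> 0 \<le> ground_prob \<theta> \<phi> x \<and> ground_prob \<theta> \<phi> x \<le> 1"
  using norm_meas_op_le[of \<theta> \<phi> Ground x] by (simp add: ground_prob_def power_le_one)

definition gap :: "real \<Rightarrow> real \<Rightarrow> nat \<Rightarrow> ell2 \<Rightarrow> real" where
  "gap \<theta> \<phi> nbar x = cos (\<theta> + real nbar * \<phi>) ^ 4 + sin (\<theta> + real nbar * \<phi>) ^ 4
     - norm (meas_op \<theta> \<phi> Ground x) ^ 4 - norm (meas_op \<theta> \<phi> Excited x) ^ 4"

lemma gap_eq:
  assumes "norm x = 1"
  shows "gap \<theta> \<phi> nbar x =
    ((cos (\<theta> + real nbar * \<phi>))\<^sup>2)\<^sup>2 + (1 - (cos (\<theta> + real nbar * \<phi>))\<^sup>2)\<^sup>2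
     - (ground_prob \<theta> \<phi> x)\<^sup>2 - (1 - ground_prob \<theta> \<phi> x)\<^sup>2"
proof -
  have "sin t ^ 4 = (1 - (cos t)\<^sup>2)\<^sup>2" for t :: real
    unfolding fourth_power by (simp add: sin_squared_eq)
  then show ?thesis
    unfolding gap_def fourth_power[of "norm _"] fourth_power[of "cos _"] excited_prob[OF assms]
    by (simp add: ground_prob_def)
qed

lemma two_outcome_lipschitz:
  fixes g h :: real
  assumes "0 \<le> g" "g \<le> 1" "0 \<le> h" "h \<le> 1"
  shows "\<bar>(g\<^sup>2 + (1 - g)\<^sup>2) - (h\<^sup>2 + (1 - h)\<^sup>2)\<bar> \<le> 2 * \<bar>g - h\<bar>"
proof -
  have "(g\<^sup>2 + (1 - g)\<^sup>2) - (h\<^sup>2 + (1 - h)\<^sup>2) = (2 * (g - h)) * (g + h - 1)"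
    by (simp add: power2_eq_square algebra_simps)
  then have "\<bar>(g\<^sup>2 + (1 - g)\<^sup>2) - (h\<^sup>2 + (1 - h)\<^sup>2)\<bar> = 2 * \<bar>g - h\<bar> * \<bar>g + h - 1\<bar>"
    by (simp only: abs_mult abs_numeral)
  also have "\<dots> \<le> 2 * \<bar>g - h\<bar> * 1"
    using assms by (intro mult_left_mono) auto
  finally show ?thesis by simp
qed

lemma cos_sq_bounds: "0 \<le> (cos (t::real))\<^sup>2" "(cos (t::real))\<^sup>2 \<le> 1"
  by (auto simp: abs_square_le_1)

lemma gap_diff_le:
  assumes "norm x = 1" "norm y = 1"
  shows "\<bar>gap \<theta> \<phi> nbar x - gap \<theta> \<phi> nbar y\<bar> \<le> 2 * \<bar>ground_prob \<theta> \<phi> x - ground_prob \<theta> \<phi> y\<bar>"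
  using two_outcome_lipschitz[of "ground_prob \<theta> \<phi> y" "ground_prob \<theta> \<phi> x"]
    ground_prob_bounds[OF assms(1), of \<theta> \<phi>] ground_prob_bounds[OF assms(2), of \<theta> \<phi>]
  unfolding gap_eq[OF assms(1)] gap_eq[OF assms(2)] by (simp add: abs_minus_commute)

lemma gap_abs_le:
  assumes "norm x = 1"
  shows "\<bar>gap \<theta> \<phi> nbar x\<bar> \<le> 2 * \<bar>ground_prob \<theta> \<phi> x - (cos (\<theta> + real nbar * \<phi>))\<^sup>2\<bar>"
  using two_outcome_lipschitz[of "(cos (\<theta> + real nbar * \<phi>))\<^sup>2" "ground_prob \<theta> \<phi> x"]
    ground_prob_bounds[OF assms, of \<theta> \<phi>] cos_sq_bounds
  unfolding gap_eq[OF assms] by (simp add: abs_minus_commute)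

lemma gap_bounds:
  assumes "norm x = 1"
  shows "- 1 \<le> gap \<theta> \<phi> nbar x \<and> gap \<theta> \<phi> nbar x \<le> 1"
proof -
  have sq: "0 \<le> t\<^sup>2 + (1 - t)\<^sup>2 \<and> t\<^sup>2 + (1 - t)\<^sup>2 \<le> 1" if "0 \<le> t" "t \<le> 1" for t :: real
  proof -
    have "t\<^sup>2 + (1 - t)\<^sup>2 = 1 - 2 * (t * (1 - t))" by (simp add: power2_eq_square algebra_simps)
    moreover have "0 \<le> t * (1 - t)" using that by simp
    moreover have "2 * (t * (1 - t)) \<le> 1"
      using zero_le_power2[of "2 * t - 1"] by (simp add: power2_eq_square algebra_simps)
    ultimately show ?thesis by simp
  qed
  show ?thesis
    using sq[of "ground_prob \<theta> \<phi> x"] ground_prob_bounds[OF assms, of \<theta> \<phi>]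
      sq[OF cos_sq_bounds, of "\<theta> + real nbar * \<phi>"]
    unfolding gap_eq[OF assms] by linarith
qed

text \<open>\<open>ground_prob\<close> averages numbers in [0, 1] with the populations as weights,
  and only the mass 1 - \<open>population x n\<close> sits on levels other than n.\<close>

lemma ground_prob_near_fock:
  assumes "norm x = 1"
  shows "\<bar>ground_prob \<theta> \<phi> x - (cos (\<theta> + real n * \<phi>))\<^sup>2\<bar> \<le> 1 - population x n"
proof -
  let ?c = "\<lambda>m. (cos (\<theta> + real m * \<phi>))\<^sup>2"
  have p: "population x sums 1" using population_sums[of x] assms by simp
  have rest: "(\<lambda>m. population x m - (if m = n then population x m else 0)) sums (1 - population x n)"
    by (intro sums_diff p sums_single)
  have d: "(\<lambda>m. ?c m * population x m - ?c n * population x m) sums (ground_prob \<theta> \<phi> x - ?c n * 1)"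
    by (intro sums_diff ground_prob_sums sums_mult p)
  have *: "\<bar>?c m * population x m - ?c n * population x m\<bar>
      \<le> population x m - (if m = n then population x m else 0)" for m
  proof (cases "m = n")
    case False
    have "\<bar>?c m - ?c n\<bar> \<le> 1"
      using cos_sq_bounds[of "\<theta> + real m * \<phi>"] cos_sq_bounds[of "\<theta> + real n * \<phi>"] by linarith
    then have "\<bar>?c m - ?c n\<bar> * population x m \<le> 1 * population x m"
      by (intro mult_right_mono) auto
    then show ?thesis using False by (simp add: left_diff_distrib[symmetric] abs_mult)
  qed simp
  have "ground_prob \<theta> \<phi> x - ?c n * 1 \<le> 1 - population x n"
    by (rule sums_le[OF _ d rest]) (use * abs_le_D1 in blast)
  moreover have "- (ground_prob \<theta> \<phi> x - ?c n * 1) \<le> 1 - population x n"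
    by (rule sums_le[OF _ sums_minus[OF d] rest]) (use * abs_le_D2 in blast)
  ultimately show ?thesis by simp
qed

lemma ground_prob_lipschitz:
  assumes "norm x = 1" "norm y = 1"
  shows "\<bar>ground_prob \<theta> \<phi> x - ground_prob \<theta> \<phi> y\<bar> \<le> 2 * norm (x - y)"
proof -
  let ?u = "norm (meas_op \<theta> \<phi> Ground x)" and ?v = "norm (meas_op \<theta> \<phi> Ground y)"
  have "\<bar>ground_prob \<theta> \<phi> x - ground_prob \<theta> \<phi> y\<bar> = \<bar>?u - ?v\<bar> * (?u + ?v)"
    by (simp add: ground_prob_def power2_eq_square square_diff_square_factored abs_mult)
  also have "\<dots> \<le> norm (x - y) * (1 + 1)"
  proof (intro mult_mono add_mono)
    have "\<bar>?u - ?v\<bar> \<le> norm (meas_op \<theta> \<phi> Ground (x - y))"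
      unfolding meas_op_linear by (rule norm_triangle_ineq3)
    then show "\<bar>?u - ?v\<bar> \<le> norm (x - y)" using norm_meas_op_le order_trans by blast
  qed (use norm_meas_op_le[of \<theta> \<phi> Ground x] norm_meas_op_le[of \<theta> \<phi> Ground y] assms in auto)
  finally show ?thesis by simp
qed

section \<open>Distances to the Fock states\<close>

lemma norm_disp_diff_le:
  assumes "x \<in> ladder_dom"
  shows "norm (disp a x - x) \<le> \<bar>a\<bar> * norm (gen x)"
proof -
  have der: "((\<lambda>a. disp a x) has_derivative (\<lambda>h. h *\<^sub>R disp s (gen x))) (at s)" for s
    using disp_has_vector_derivative_at[OF disp_has_vector_derivative[OF assms, of 0]]
    by (simp add: disp_0 has_vector_derivative_def)
  have "norm (disp a x - disp 0 x) \<le> norm (gen x) * norm (a - 0)"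
  proof (rule differentiable_bound[of UNIV])
    show "((\<lambda>a. disp a x) has_derivative (\<lambda>h. h *\<^sub>R disp s (gen x))) (at s within UNIV)" for s
      using der by simp
    show "onorm (\<lambda>h. h *\<^sub>R disp s (gen x)) \<le> norm (gen x)" for s
      by (rule onorm_le) (simp add: norm_disp mult.commute)
  qed auto
  then show ?thesis by (simp add: disp_0 mult.commute)
qed

lemma norm_diff_phase_fock:
  assumes x: "norm x = 1" and c: "cmod c = 1"
  shows "(norm (x - c *\<^sub>C fock n))\<^sup>2 = 2 - 2 * Re (c * cnj (coord x n))"
proof -
  have "(norm (x - c *\<^sub>C fock n))\<^sup>2 = (norm x)\<^sup>2 + (norm (c *\<^sub>C fock n))\<^sup>2 - 2 * inner x (c *\<^sub>C fock n)"
    unfolding power2_norm_eq_inner by (simp add: inner_diff inner_commute)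
  also have "inner x (c *\<^sub>C fock n) = Re (c * cnj (coord x n))"
    by (simp add: inner_eq_Re_cinner cinner_scaleC_right cinner_fock)
  finally show ?thesis by (simp add: norm_scaleC c x)
qed

lemma population_le_1: "norm x = 1 \<Longrightarrow> population x n \<le> 1"
  using coord_le_norm[of x n] by (simp add: population_def power_le_one)

lemma population_near:
  assumes x: "norm x = 1" and c: "cmod c = 1"
  shows "1 - population x n \<le> (norm (x - c *\<^sub>C fock n))\<^sup>2"
proof -
  let ?r = "cmod (coord x n)"
  have "Re (c * cnj (coord x n)) \<le> ?r"
    using complex_Re_le_cmod[of "c * cnj (coord x n)"] c by (simp add: norm_mult)
  moreover have "1 - ?r\<^sup>2 \<le> 2 - 2 * ?r"
    using zero_le_power2[of "1 - ?r"] by (simp add: power2_eq_square algebra_simps)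
  ultimately show ?thesis unfolding norm_diff_phase_fock[OF x c] population_def by linarith
qed

text \<open>The best phase is that of \<open>coord x n\<close>: with r its modulus, the squared
  distance is 2 - 2 r, and r^2 \<le> r. Together with \<open>population_near\<close>, a population
  close to 1 amounts to being close to a unit multiple of \<open>fock n\<close>.\<close>

lemma near_phase_fock:
  assumes x: "norm x = 1" and n: "coord x n \<noteq> 0"
  shows "(norm (x - (coord x n / cmod (coord x n)) *\<^sub>C fock n))\<^sup>2 \<le> 2 * (1 - population x n)"
proof -
  let ?r = "cmod (coord x n)"
  let ?c = "coord x n / ?r"
  have c: "cmod ?c = 1" using n by (simp add: norm_divide)
  have "coord x n * cnj (coord x n) = complex_of_real (?r\<^sup>2)"
    by (simp only: complex_norm_square)
  then have "?c * cnj (coord x n) = complex_of_real (?r\<^sup>2 / ?r)"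
    by (simp add: of_real_divide)
  then have "?c * cnj (coord x n) = complex_of_real ?r"
    using n by (simp add: power2_eq_square)
  then have "Re (?c * cnj (coord x n)) = ?r" by simp
  moreover have "?r\<^sup>2 \<le> ?r"
    using coord_le_norm[of x n] x by (simp add: power2_eq_square mult_left_le)
  ultimately show ?thesis unfolding norm_diff_phase_fock[OF x c] population_def by simp
qed

text \<open>V + \<delta> on the sphere. The gap is at least - 1 there, so this is a nonnegative
  extended number and its integrals always make sense.\<close>

definition shifted_lyapunov :: "real \<Rightarrow> real \<Rightarrow> nat \<Rightarrow> real \<Rightarrow> ell2 \<Rightarrow> ennreal" where
  "shifted_lyapunov \<theta> \<phi> nbar \<delta> x = energy nbar x + ennreal (\<delta> * (1 + gap \<theta> \<phi> nbar x))"

lemma lyapunov_eq: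
  "lyapunov \<theta> \<phi> nbar \<delta> x = enn2ereal (energy nbar x) + ereal (\<delta> * gap \<theta> \<phi> nbar x)"
proof -
  have "ereal (sigma nbar n * (cmod (cinner x (fock n)))\<^sup>2) = enn2ereal (ennreal (sigma nbar n * population x n))" for n
    by (simp add: cinner_fock population_def sigma_nonneg)
  then have "(\<Sum>n. ereal (sigma nbar n * (cmod (cinner x (fock n)))\<^sup>2)) = enn2ereal (energy nbar x)"
    unfolding energy_def by simp
  then show ?thesis by (simp add: lyapunov_def gap_def)
qed

lemma shifted_lyapunov_eq:
  assumes "norm x = 1" "\<delta> \<ge> 0"
  shows "enn2ereal (shifted_lyapunov \<theta> \<phi> nbar \<delta> x) = lyapunov \<theta> \<phi> nbar \<delta> x + ereal \<delta>"
proof -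
  have "0 \<le> \<delta> * (1 + gap \<theta> \<phi> nbar x)" using gap_bounds[OF assms(1), of \<theta> \<phi> nbar] assms(2) by simp
  then show ?thesis
    unfolding shifted_lyapunov_def lyapunov_eq
    by (simp add: plus_ennreal.rep_eq distrib_left add.assoc) (simp add: add.commute)
qed

lemma shifted_lyapunov_mono:
  assumes "norm x = 1" "norm y = 1" "\<delta> \<ge> 0" "lyapunov \<theta> \<phi> nbar \<delta> x \<le> lyapunov \<theta> \<phi> nbar \<delta> y"
  shows "shifted_lyapunov \<theta> \<phi> nbar \<delta> x \<le> shifted_lyapunov \<theta> \<phi> nbar \<delta> y"
  unfolding less_eq_ennreal.rep_eq shifted_lyapunov_eq[OF assms(1,3)] shifted_lyapunov_eq[OF assms(2,3)]
  by (rule add_right_mono[OF assms(4)])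

lemma shifted_lyapunov_eq_e2ennreal:
  assumes "norm x = 1" "\<delta> \<ge> 0" "0 \<le> lyapunov \<theta> \<phi> nbar \<delta> x"
  shows "shifted_lyapunov \<theta> \<phi> nbar \<delta> x = e2ennreal (lyapunov \<theta> \<phi> nbar \<delta> x) + ennreal \<delta>"
  unfolding enn2ereal_inject[symmetric] shifted_lyapunov_eq[OF assms(1,2)] plus_ennreal.rep_eq
  using assms(2,3) by (simp add: enn2ereal_e2ennreal)

lemma energy_lower_bound:
  assumes "0 \<le> c" "\<And>n. n \<noteq> nbar \<Longrightarrow> c \<le> sigma nbar n" "norm x = 1"
  shows "ennreal (c * (1 - population x nbar)) \<le> energy nbar x"
proof -
  have "(\<lambda>n. c * (population x n - (if n = nbar then population x n else 0))) sums (c * (1 - population x nbar))"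
    by (intro sums_mult sums_diff sums_single) (use population_sums[of x] assms(3) in simp)
  then have "ennreal (c * (1 - population x nbar)) = (\<Sum>n. ennreal (c * (population x n - (if n = nbar then population x n else 0))))"
    using assms(1) by (intro suminf_ennreal_eq[symmetric]) auto
  also have "\<dots> \<le> energy nbar x"
    unfolding energy_def
    by (intro suminf_le ennreal_leI) (auto intro: mult_right_mono assms simp: sigma_nonneg)
  finally show ?thesis .
qed

text \<open>Both terms are controlled by the mass 1 - \<open>population x nbar\<close> missing from
  the target: the energy is at least c times this mass, the gap at most twice this mass in absolute
  value.\<close>

lemma lyapunov_nonneg:
  assumes c: "0 \<le> c" "\<And>n. n \<noteq> nbar \<Longrightarrow> c \<le> sigma nbar n" and x: "norm x = 1" and d: "0 \<le> \<delta>" "2 * \<delta> \<le> c"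
  shows "0 \<le> lyapunov \<theta> \<phi> nbar \<delta> x"
proof -
  let ?p = "1 - population x nbar"
  have p: "0 \<le> ?p" using population_le_1[OF x] by simp
  have "enn2ereal (ennreal (c * ?p)) \<le> enn2ereal (energy nbar x)"
    using energy_lower_bound[OF c x] by (simp add: less_eq_ennreal.rep_eq)
  then have 1: "ereal (c * ?p) \<le> enn2ereal (energy nbar x)"
    using c(1) p by simp
  have "\<bar>gap \<theta> \<phi> nbar x\<bar> \<le> 2 * ?p"
    by (intro order_trans[OF gap_abs_le[OF x]] mult_left_mono ground_prob_near_fock[OF x]) simp
  then have "- gap \<theta> \<phi> nbar x \<le> 2 * ?p" by (rule abs_le_D2)
  then have "\<delta> * (- gap \<theta> \<phi> nbar x) \<le> \<delta> * (2 * ?p)" by (rule mult_left_mono) (rule d)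
  also have "\<dots> = (2 * \<delta>) * ?p" by simp
  also have "\<dots> \<le> c * ?p" using d p by (intro mult_right_mono)
  finally have "0 \<le> ereal (c * ?p) + ereal (\<delta> * gap \<theta> \<phi> nbar x)" by simp
  also have "\<dots> \<le> lyapunov \<theta> \<phi> nbar \<delta> x"
    unfolding lyapunov_eq using 1 by (rule add_right_mono)
  finally show ?thesis .
qed

lemma ennreal_cancel_slack:
  fixes A B :: ennreal
  assumes "A + ennreal p \<le> B + ennreal q" "q + r \<le> p" "0 \<le> q" "0 \<le> r"
  shows "A + ennreal r \<le> B"
proof -
  have "ennreal q + (A + ennreal r) = A + ennreal (q + r)"
    using assms by (simp add: ennreal_plus add_ac)
  also have "\<dots> \<le> A + ennreal p" by (intro add_left_mono ennreal_leI assms)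
  also have "\<dots> \<le> ennreal q + B" using assms(1) by (simp add: add.commute)
  finally show ?thesis by (simp add: ennreal_add_left_cancel_le)
qed

text \<open>Displacing a Fock state by a changes the ground probability by at most a^2 times the
  squared norm of \<open>gen (fock n)\<close>. The condition on \<delta> therefore compares
  second-order terms only and does not involve a.\<close>

lemma lyapunov_descent:
  assumes nb: "nbar \<ge> 2" and n: "n \<noteq> nbar" and k: "k > 0" "curvature nbar n \<le> - k"
    and d: "0 \<le> \<delta>" "\<delta> \<le> 1" "\<delta> * (16 * (norm (gen (fock n)))\<^sup>2) \<le> k"
  shows "\<exists>a \<eta> c. 0 < a \<and> a \<le> 1 \<and> 0 < \<eta> \<and> 0 < c \<and> (\<forall>x. norm x = 1 \<longrightarrow> 1 - \<eta> < population x n \<longrightarrow>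
    shifted_lyapunov \<theta> \<phi> nbar \<delta> (disp a x) + ennreal c \<le> shifted_lyapunov \<theta> \<phi> nbar \<delta> x)"
proof -
  obtain a where a: "0 < a" "a \<le> 1" and desc: "\<And>x c. norm x = 1 \<Longrightarrow> cmod c = 1 \<Longrightarrow>
    energy nbar (disp a x) + ennreal (k / 2 * a\<^sup>2) \<le> energy nbar x + ennreal (8 * a * norm (x - c *\<^sub>C fock n))"
    using energy_descent[OF nb n k] by (meson less_imp_le order_refl)
  \<comment> \<open>Budget for the gain k a^2 / 2: the terms 8 a d and 8 d with d \<le> r cost at
    most k a^2 / 8 together, the second-order change of the gap costs another k a^2 / 8, and k a^2 /
    4 is left.\<close>
  define r where "r = k * a\<^sup>2 / 128"
  have r: "r > 0" using k a by (simp add: r_def)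
  define \<eta> where "\<eta> = min 1 (r\<^sup>2 / 2)"
  have eta: "\<eta> > 0" "\<eta> \<le> 1" "2 * \<eta> \<le> r\<^sup>2" using r by (auto simp: \<eta>_def)
  have "shifted_lyapunov \<theta> \<phi> nbar \<delta> (disp a x) + ennreal (k / 4 * a\<^sup>2) \<le> shifted_lyapunov \<theta> \<phi> nbar \<delta> x"
    if x: "norm x = 1" and px: "1 - \<eta> < population x n" for x
  proof -
    have nz: "coord x n \<noteq> 0" using px eta by (auto simp: population_def)
    define c where "c = coord x n / cmod (coord x n)"
    have c: "cmod c = 1" using nz by (simp add: c_def norm_divide)
    define y where "y = c *\<^sub>C fock n"
    have y: "norm y = 1" by (simp add: y_def norm_scaleC c)
    define d where "d = norm (x - y)"
    have "d\<^sup>2 \<le> 2 * (1 - population x n)"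
      using near_phase_fock[OF x nz] by (simp add: d_def y_def c_def)
    also have "\<dots> \<le> r\<^sup>2" using px eta by simp
    finally have dr: "d \<le> r" using less_imp_le[OF r] by (rule power2_le_imp_le)
    have d0: "0 \<le> d" by (simp add: d_def)
    let ?g = "ground_prob \<theta> \<phi>"
    let ?E = "(norm (gen (fock n)))\<^sup>2"
    have "\<bar>?g (disp a x) - ?g (disp a y)\<bar> \<le> 2 * d"
      using ground_prob_lipschitz[of "disp a x" "disp a y" \<theta> \<phi>] dist_disp[of a x y]
      by (simp add: norm_disp x y d_def dist_norm)
    moreover have "\<bar>?g x - ?g y\<bar> \<le> 2 * d"
      using ground_prob_lipschitz[OF x y] by (simp add: d_def)
    moreover have "?g y = (cos (\<theta> + real n * \<phi>))\<^sup>2"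
      using ground_prob_near_fock[OF y, of \<theta> \<phi> n] by (simp add: y_def population_def coord_simps c)
    moreover have "\<bar>?g (disp a y) - (cos (\<theta> + real n * \<phi>))\<^sup>2\<bar> \<le> a\<^sup>2 * ?E"
    proof -
      have "\<bar>?g (disp a y) - (cos (\<theta> + real n * \<phi>))\<^sup>2\<bar> \<le> 1 - population (disp a y) n"
        by (rule ground_prob_near_fock) (simp add: norm_disp y)
      also have "\<dots> \<le> (norm (disp a y - c *\<^sub>C fock n))\<^sup>2"
        by (rule population_near) (simp_all add: norm_disp y c)
      also have "disp a y - c *\<^sub>C fock n = c *\<^sub>C (disp a (fock n) - fock n)"
        by (simp add: y_def disp_scaleC scaleC_simps)
      also have "(norm (c *\<^sub>C (disp a (fock n) - fock n)))\<^sup>2 \<le> (\<bar>a\<bar> * norm (gen (fock n)))\<^sup>2"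
        using norm_disp_diff_le[OF fock_in_ladder_dom, of a n] by (intro power_mono) (auto simp: norm_scaleC c)
      finally show ?thesis by (simp add: power_mult_distrib)
    qed
    ultimately have "\<bar>?g (disp a x) - ?g x\<bar> \<le> 4 * d + a\<^sup>2 * ?E" by linarith
    then have "2 * \<bar>?g (disp a x) - ?g x\<bar> \<le> 2 * (4 * d + a\<^sup>2 * ?E)" by simp
    moreover have "norm (disp a x) = 1" by (simp add: norm_disp x)
    ultimately have "gap \<theta> \<phi> nbar (disp a x) \<le> gap \<theta> \<phi> nbar x + 2 * (4 * d + a\<^sup>2 * ?E)"
      using gap_diff_le[OF _ x, of "disp a x" \<theta> \<phi> nbar] by linarith
    then have "\<delta> * (1 + gap \<theta> \<phi> nbar (disp a x)) \<le> \<delta> * (1 + gap \<theta> \<phi> nbar x + 2 * (4 * d + a\<^sup>2 * ?E))"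
      using assms(5) by (intro mult_left_mono) auto
    also have "\<dots> = \<delta> * (1 + gap \<theta> \<phi> nbar x) + (\<delta> * (8 * d) + a\<^sup>2 * (\<delta> * (16 * ?E)) / 8)"
      by (simp add: algebra_simps)
    also have "\<dots> \<le> \<delta> * (1 + gap \<theta> \<phi> nbar x) + (1 * (8 * d) + a\<^sup>2 * k / 8)"
      using assms(5-7) d0 by (intro add_left_mono add_mono mult_right_mono divide_right_mono mult_left_mono) auto
    finally have "ennreal (\<delta> * (1 + gap \<theta> \<phi> nbar (disp a x))) \<le> ennreal (\<delta> * (1 + gap \<theta> \<phi> nbar x) + (8 * d + a\<^sup>2 * k / 8))"
      by (intro ennreal_leI) simp
    also have "\<dots> = ennreal (\<delta> * (1 + gap \<theta> \<phi> nbar x)) + ennreal (8 * d + a\<^sup>2 * k / 8)"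
      using gap_bounds[OF x, of \<theta> \<phi> nbar] assms(5) d0 k by (intro ennreal_plus) auto
    finally have "shifted_lyapunov \<theta> \<phi> nbar \<delta> (disp a x) + ennreal (k / 2 * a\<^sup>2)
        \<le> (energy nbar (disp a x) + ennreal (k / 2 * a\<^sup>2)) + (ennreal (\<delta> * (1 + gap \<theta> \<phi> nbar x)) + ennreal (8 * d + a\<^sup>2 * k / 8))"
      unfolding shifted_lyapunov_def by (simp add: add_ac add_left_mono)
    also have "\<dots> \<le> (energy nbar x + ennreal (8 * a * d)) + (ennreal (\<delta> * (1 + gap \<theta> \<phi> nbar x)) + ennreal (8 * d + a\<^sup>2 * k / 8))"
      using desc[OF x c] by (intro add_right_mono) (simp add: d_def y_def)
    also have "\<dots> = shifted_lyapunov \<theta> \<phi> nbar \<delta> x + ennreal (8 * a * d + (8 * d + a\<^sup>2 * k / 8))"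
      unfolding shifted_lyapunov_def using a d0 k by (simp add: ennreal_plus add_ac)
    finally show ?thesis
    proof (rule ennreal_cancel_slack)
      have "8 * a * d \<le> 8 * 1 * d" using a d0 by (intro mult_right_mono) auto
      then show "8 * a * d + (8 * d + a\<^sup>2 * k / 8) + k / 4 * a\<^sup>2 \<le> k / 2 * a\<^sup>2"
        using dr by (simp add: r_def algebra_simps)
    qed (use a d0 k in auto)
  qed
  moreover have "k / 4 * a\<^sup>2 > 0" using k a by simp
  ultimately show ?thesis using a eta by blast
qed

section \<open>The transition kernel\<close>

lemma space_sphere_borel [simp]: "space sphere_borel = unit_sphere"
  by (simp add: sphere_borel_def space_restrict_space)

lemma measurable_sphere_borelI:
  assumes "f \<in> borel_measurable borel" 
  shows "f \<in> borel_measurable sphere_borel"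
  unfolding sphere_borel_def using assms by (rule measurable_restrict_space1)

lemma measurable_into_sphere:
  assumes "f \<in> borel_measurable M" "\<And>x. x \<in> space M \<Longrightarrow> norm (f x) = 1"
  shows "f \<in> measurable M sphere_borel"
  unfolding sphere_borel_def by (rule measurable_restrict_space2) (use assms in auto)

lemma measurable_population: "(\<lambda>x. population x n) \<in> borel_measurable borel"
  unfolding population_def
  by (intro borel_measurable_continuous_onI continuous_intros continuous_on_coord)

lemma measurable_energy: "energy nbar \<in> borel_measurable borel"
  unfolding energy_def[abs_def] using measurable_population by measurable

lemma continuous_meas_op: "continuous_on A (meas_op \<theta> \<phi> s)"
  by (rule linear_continuous_on[OF bounded_linear_meas_op])

lemma continuous_ground_prob: "continuous_on A (ground_prob \<theta> \<phi>)"
  unfolding ground_prob_def[abs_def] by (intro continuous_intros continuous_meas_op)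

lemma continuous_gap: "continuous_on A (gap \<theta> \<phi> nbar)"
  unfolding gap_def[abs_def] by (intro continuous_intros continuous_meas_op)

lemma measurable_shifted_lyapunov: "shifted_lyapunov \<theta> \<phi> nbar \<delta> \<in> borel_measurable borel"
proof -
  have [measurable]: "gap \<theta> \<phi> nbar \<in> borel_measurable borel"
    by (intro borel_measurable_continuous_onI continuous_gap)
  note [measurable] = measurable_energy
  show ?thesis unfolding shifted_lyapunov_def[abs_def] by measurable
qed

lemma measurable_post_meas: "post_meas \<theta> \<phi> s \<in> borel_measurable borel"
proof -
  let ?A = "{x. meas_op \<theta> \<phi> s x = 0}"
  have "closed ?A"
    by (intro closed_Collect_eq continuous_meas_op continuous_on_const)
  then have "?A \<in> sets borel" by simp
  then have "(\<lambda>x. if x \<in> ?A then x else meas_op \<theta> \<phi> s x /\<^sub>R norm (meas_op \<theta> \<phi> s x)) \<in> borel_measurable borel"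
    by (rule borel_measurable_continuous_on_if) (auto intro!: continuous_intros continuous_meas_op)
  then show ?thesis by (simp add: post_meas_def[abs_def])
qed

lemma norm_post_meas: "norm x = 1 \<Longrightarrow> norm (post_meas \<theta> \<phi> s x) = 1"
  by (simp add: post_meas_def)

text \<open>The displacement is rounded down to multiples of 1 / (k + 1). The rounded parameter has
  countably many values, each giving a continuous map, and strong continuity in the parameter gives
  the limit as k grows.\<close>

lemma measurable_disp_feedback:
  assumes f: "f \<in> borel_measurable sphere_borel"
  shows "(\<lambda>x. disp (f x) x) \<in> measurable sphere_borel sphere_borel"
proof (rule measurable_into_sphere)
  define r where "r k x = real_of_int \<lfloor>f x * real (Suc k)\<rfloor> / real (Suc k)" for k x
  have rx: "(\<lambda>k. r k x) \<longlonglongrightarrow> f x" for x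
  proof -
    have b: "\<bar>r k x - f x\<bar> \<le> 1 / real (Suc k)" for k
    proof -
      have "\<bar>(real_of_int \<lfloor>f x * real (Suc k)\<rfloor> - f x * real (Suc k)) / real (Suc k)\<bar> \<le> 1 / real (Suc k)"
        unfolding abs_divide by (intro frac_le) (auto simp del: of_nat_Suc, linarith+)
      moreover have "(real_of_int \<lfloor>f x * real (Suc k)\<rfloor> - f x * real (Suc k)) / real (Suc k) = r k x - f x"
        by (simp add: r_def diff_divide_distrib del: of_nat_Suc)
      ultimately show ?thesis by (simp only:)
    qed
    have "(\<lambda>k. r k x - f x) \<longlonglongrightarrow> 0"
      by (rule Lim_null_comparison[OF always_eventually LIMSEQ_Suc[OF lim_1_over_n]]) (use b in auto)
    then show ?thesis by (simp add: LIM_zero_iff)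
  qed
  show "(\<lambda>x. disp (f x) x) \<in> borel_measurable sphere_borel"
  proof (rule borel_measurable_LIMSEQ_metric[where f = "\<lambda>k x. disp (r k x) x"])
    fix k
    have "(\<lambda>x. disp (real_of_int \<lfloor>f x * real (Suc k)\<rfloor> / real (Suc k)) x) \<in> borel_measurable sphere_borel"
    proof (rule measurable_compose_countable[where f = "\<lambda>i. disp (real_of_int i / real (Suc k))"
          and g = "\<lambda>x. \<lfloor>f x * real (Suc k)\<rfloor>"])
      show "disp (real_of_int i / real (Suc k)) \<in> borel_measurable sphere_borel" for i
        by (intro measurable_sphere_borelI borel_measurable_continuous_onI linear_continuous_on bounded_linear_disp)
      show "(\<lambda>x. \<lfloor>f x * real (Suc k)\<rfloor>) \<in> measurable sphere_borel (count_space UNIV)"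
        using f by measurable
    qed
    then show "(\<lambda>x. disp (r k x) x) \<in> borel_measurable sphere_borel" by (simp add: r_def)
  next
    fix x
    have "isCont (\<lambda>a. disp a x) (f x)"
      using continuous_disp by (simp add: continuous_on_eq_continuous_at)
    then show "(\<lambda>k. disp (r k x) x) \<longlonglongrightarrow> disp (f x) x"
      using isCont_tendsto_compose[OF _ rx] by blast
  qed
qed (simp add: norm_disp)

definition step :: "real \<Rightarrow> real \<Rightarrow> (ell2 \<Rightarrow> real) \<Rightarrow> outcome \<Rightarrow> ell2 \<Rightarrow> ell2" where
  "step \<theta> \<phi> f s x = disp (f (post_meas \<theta> \<phi> s x)) (post_meas \<theta> \<phi> s x)"

lemma norm_step: "norm x = 1 \<Longrightarrow> norm (step \<theta> \<phi> f s x) = 1"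
  by (simp add: step_def norm_disp norm_post_meas)

lemma measurable_step:
  assumes "f \<in> borel_measurable sphere_borel"
  shows "step \<theta> \<phi> f s \<in> measurable sphere_borel sphere_borel"
proof -
  have "post_meas \<theta> \<phi> s \<in> measurable sphere_borel sphere_borel"
    by (intro measurable_into_sphere measurable_sphere_borelI measurable_post_meas) (simp add: norm_post_meas)
  from measurable_compose[OF this measurable_disp_feedback[OF assms]]
  show ?thesis by (simp add: step_def[abs_def])
qed

lemma UNIV_outcome: "UNIV = {Ground, Excited}"
  by (auto intro: outcome.exhaust)

lemma transition_eq: "transition \<theta> \<phi> f x =
   distr (density (count_space UNIV) (\<lambda>s. ennreal ((norm (meas_op \<theta> \<phi> s x))\<^sup>2))) sphere_borel (\<lambda>s. step \<theta> \<phi> f s x)"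
  by (simp add: transition_def step_def displacement_eq_disp)

lemma nn_integral_transition:
  assumes x: "norm x = 1" and g: "g \<in> borel_measurable sphere_borel"
  shows "(\<integral>\<^sup>+ y. g y \<partial>transition \<theta> \<phi> f x) =
    (\<Sum>s\<in>UNIV. ennreal ((norm (meas_op \<theta> \<phi> s x))\<^sup>2) * g (step \<theta> \<phi> f s x))"
proof -
  have m: "(\<lambda>s. step \<theta> \<phi> f s x) \<in> measurable (density (count_space UNIV) (\<lambda>s. ennreal ((norm (meas_op \<theta> \<phi> s x))\<^sup>2))) sphere_borel"
    by (auto simp: norm_step x)
  have fin: "finite (UNIV :: outcome set)" by (simp add: UNIV_outcome)
  show ?thesis
    unfolding transition_eq
    by (subst nn_integral_distr[OF m], simp add: g, subst nn_integral_density)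
      (auto simp: nn_integral_count_space_finite fin)
qed

lemma prob_transition:
  assumes x: "norm x = 1"
  shows "prob_space (transition \<theta> \<phi> f x)"
proof
  have "emeasure (transition \<theta> \<phi> f x) (space (transition \<theta> \<phi> f x)) = (\<integral>\<^sup>+ y. 1 \<partial>transition \<theta> \<phi> f x)"
    by simp
  also have "\<dots> = (\<Sum>s\<in>UNIV. ennreal ((norm (meas_op \<theta> \<phi> s x))\<^sup>2) * 1)"
    by (rule nn_integral_transition[OF x]) simp
  also have "\<dots> = ennreal ((norm (meas_op \<theta> \<phi> Ground x))\<^sup>2) + ennreal ((norm (meas_op \<theta> \<phi> Excited x))\<^sup>2)"
    by (simp add: UNIV_outcome)
  also have "\<dots> = 1"
    using ground_prob_bounds[OF x, of \<theta> \<phi>]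
    unfolding excited_prob[OF x] ground_prob_def[symmetric] by (simp add: ennreal_plus[symmetric] del: ennreal_plus)
  finally show "emeasure (transition \<theta> \<phi> f x) (space (transition \<theta> \<phi> f x)) = 1" .
qed

lemma sets_transition [simp]: "sets (transition \<theta> \<phi> f x) = sets sphere_borel"
  by (simp add: transition_def)

lemma measurable_transition:
  assumes f: "f \<in> borel_measurable sphere_borel"
  shows "transition \<theta> \<phi> f \<in> measurable sphere_borel (subprob_algebra sphere_borel)"
proof (rule measurable_subprob_algebra)
  show "subprob_space (transition \<theta> \<phi> f x)" if "x \<in> space sphere_borel" for x
    using that prob_transition by (auto intro!: prob_space_imp_subprob_space)
  fix A assume A: "A \<in> sets sphere_borel"
  have "(\<lambda>x. \<Sum>s\<in>UNIV. ennreal ((norm (meas_op \<theta> \<phi> s x))\<^sup>2) * indicator A (step \<theta> \<phi> f s x)) \<in> borel_measurable sphere_borel"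
  proof (intro borel_measurable_sum borel_measurable_times_ennreal)
    fix s
    show "(\<lambda>x. ennreal ((norm (meas_op \<theta> \<phi> s x))\<^sup>2)) \<in> borel_measurable sphere_borel"
      by (intro measurable_sphere_borelI measurable_compose[OF _ measurable_ennreal]
          borel_measurable_continuous_onI continuous_intros continuous_meas_op)
    show "(\<lambda>x. indicator A (step \<theta> \<phi> f s x) :: ennreal) \<in> borel_measurable sphere_borel"
      by (rule measurable_compose[OF measurable_step[OF f]]) (use A in simp)
  qed
  then show "(\<lambda>x. emeasure (transition \<theta> \<phi> f x) A) \<in> borel_measurable sphere_borel"
  proof (subst measurable_cong)
    fix x assume "x \<in> space sphere_borel"
    then have x: "norm x = 1" by simp
    have "emeasure (transition \<theta> \<phi> f x) A = (\<integral>\<^sup>+ y. indicator A y \<partial>transition \<theta> \<phi> f x)"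
      using A by simp
    then show "emeasure (transition \<theta> \<phi> f x) A = (\<Sum>s\<in>UNIV. ennreal ((norm (meas_op \<theta> \<phi> s x))\<^sup>2) * indicator A (step \<theta> \<phi> f s x))"
      using nn_integral_transition[OF x, of "indicator A" \<theta> \<phi> f] A by simp
  qed
qed simp

lemma prob_measuresD:
  assumes "\<mu> \<in> prob_measures"
  shows "prob_space \<mu>" "sets \<mu> = sets sphere_borel" "space \<mu> = unit_sphere"
    "measurable \<mu> N = measurable sphere_borel N"
  using assms sets_eq_imp_space_eq[of \<mu> sphere_borel]
  by (auto simp: prob_measures_def intro!: measurable_cong_sets)

lemma bind_transition:
  assumes f: "f \<in> borel_measurable sphere_borel" and \<mu>: "\<mu> \<in> prob_measures"
  shows "bind \<mu> (transition \<theta> \<phi> f) \<in> prob_measures"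
    and "g \<in> borel_measurable sphere_borel \<Longrightarrow>
      (\<integral>\<^sup>+ y. g y \<partial>bind \<mu> (transition \<theta> \<phi> f)) = (\<integral>\<^sup>+ x. (\<integral>\<^sup>+ y. g y \<partial>transition \<theta> \<phi> f x) \<partial>\<mu>)"
proof -
  interpret prob_space \<mu> by (rule prob_measuresD[OF \<mu>])
  note sp = prob_measuresD(3)[OF \<mu>]
  have K: "transition \<theta> \<phi> f \<in> measurable \<mu> (subprob_algebra sphere_borel)"
    unfolding prob_measuresD(4)[OF \<mu>] by (rule measurable_transition[OF f])
  have "prob_space (bind \<mu> (transition \<theta> \<phi> f))"
    by (rule prob_space_bind[OF _ K]) (auto intro!: AE_I2 prob_transition simp: sp)
  moreover have "sets (bind \<mu> (transition \<theta> \<phi> f)) = sets sphere_borel"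
    by (rule sets_bind) (auto simp: not_empty)
  ultimately show "bind \<mu> (transition \<theta> \<phi> f) \<in> prob_measures" by (simp add: prob_measures_def)
  show "(\<integral>\<^sup>+ y. g y \<partial>bind \<mu> (transition \<theta> \<phi> f)) = (\<integral>\<^sup>+ x. (\<integral>\<^sup>+ y. g y \<partial>transition \<theta> \<phi> f x) \<partial>\<mu>)"
    if "g \<in> borel_measurable sphere_borel"
    by (rule nn_integral_bind[OF that K])
qed

lemma law_prob_measures:
  assumes "\<And>k. f k \<in> borel_measurable sphere_borel" "\<mu> \<in> prob_measures"
  shows "law \<theta> \<phi> f \<mu> k \<in> prob_measures"
  by (induction k) (auto intro: bind_transition assms)

text \<open>The drift inequality telescopes along the chain; the accumulated decreases stay on the
  left because V may be infinite.\<close>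

lemma drift_summable:
  assumes f: "\<And>k. f k \<in> borel_measurable sphere_borel" and \<mu>: "\<mu> \<in> prob_measures"
    and V: "V \<in> borel_measurable sphere_borel" and \<kappa>: "\<kappa> \<in> borel_measurable sphere_borel"
    and drift: "\<And>k x. norm x = 1 \<Longrightarrow> (\<integral>\<^sup>+ y. V y \<partial>transition \<theta> \<phi> (f k) x) + \<kappa> x \<le> V x"
  shows "(\<integral>\<^sup>+ x. V x \<partial>law \<theta> \<phi> f \<mu> k) + (\<Sum>i<k. \<integral>\<^sup>+ x. \<kappa> x \<partial>law \<theta> \<phi> f \<mu> i) \<le> (\<integral>\<^sup>+ x. V x \<partial>\<mu>)"
proof (induction k)
  case (Suc k)
  let ?m = "law \<theta> \<phi> f \<mu> k"
  have m: "?m \<in> prob_measures" by (rule law_prob_measures[OF f \<mu>])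
  have "(\<integral>\<^sup>+ x. V x \<partial>law \<theta> \<phi> f \<mu> (Suc k)) + (\<integral>\<^sup>+ x. \<kappa> x \<partial>?m)
      = (\<integral>\<^sup>+ x. (\<integral>\<^sup>+ y. V y \<partial>transition \<theta> \<phi> (f k) x) \<partial>?m) + (\<integral>\<^sup>+ x. \<kappa> x \<partial>?m)"
    using bind_transition(2)[OF f m V] by simp
  also have "\<dots> = (\<integral>\<^sup>+ x. (\<integral>\<^sup>+ y. V y \<partial>transition \<theta> \<phi> (f k) x) + \<kappa> x \<partial>?m)"
  proof (rule nn_integral_add[symmetric])
    show "\<kappa> \<in> borel_measurable ?m" unfolding prob_measuresD(4)[OF m] by (rule \<kappa>)
    have "(\<lambda>M. \<integral>\<^sup>+ y. V y \<partial>M) \<in> borel_measurable (subprob_algebra sphere_borel)"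
      by (rule nn_integral_measurable_subprob_algebra[OF V])
    from measurable_compose[OF measurable_transition[OF f] this]
    show "(\<lambda>x. \<integral>\<^sup>+ y. V y \<partial>transition \<theta> \<phi> (f k) x) \<in> borel_measurable ?m"
      unfolding prob_measuresD(4)[OF m] .
  qed
  also have "\<dots> \<le> (\<integral>\<^sup>+ x. V x \<partial>?m)"
    by (rule nn_integral_mono) (use drift in \<open>simp add: prob_measuresD(3)[OF m]\<close>)
  finally have "(\<integral>\<^sup>+ x. V x \<partial>law \<theta> \<phi> f \<mu> (Suc k)) + (\<integral>\<^sup>+ x. \<kappa> x \<partial>?m) \<le> (\<integral>\<^sup>+ x. V x \<partial>?m)" .
  from order_trans[OF add_right_mono[OF this] Suc]
  show ?case by (simp add: add_ac del: law.simps)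
qed simp

lemma drift_tendsto_0:
  assumes f: "\<And>k. f k \<in> borel_measurable sphere_borel" and \<mu>: "\<mu> \<in> prob_measures"
    and V: "V \<in> borel_measurable sphere_borel" and fin: "(\<integral>\<^sup>+ x. V x \<partial>\<mu>) < \<infinity>"
    and \<kappa>: "\<kappa> \<in> borel_measurable sphere_borel" "\<And>x. norm x = 1 \<Longrightarrow> 0 \<le> \<kappa> x"
    and drift: "\<And>k x. norm x = 1 \<Longrightarrow> (\<integral>\<^sup>+ y. V y \<partial>transition \<theta> \<phi> (f k) x) + ennreal (\<kappa> x) \<le> V x"
  shows "integrable (law \<theta> \<phi> f \<mu> k) \<kappa>" "(\<lambda>k. \<integral>x. \<kappa> x \<partial>law \<theta> \<phi> f \<mu> k) \<longlonglongrightarrow> 0"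
proof -
  let ?m = "law \<theta> \<phi> f \<mu>"
  let ?I = "\<lambda>k. \<integral>\<^sup>+ x. ennreal (\<kappa> x) \<partial>?m k"
  have m: "?m k \<in> prob_measures" for k by (rule law_prob_measures[OF f \<mu>])
  have \<kappa>': "(\<lambda>x. ennreal (\<kappa> x)) \<in> borel_measurable sphere_borel" using \<kappa>(1) by measurable
  obtain B where B: "B \<ge> 0" "(\<integral>\<^sup>+ x. V x \<partial>\<mu>) = ennreal B"
    using fin by (cases "\<integral>\<^sup>+ x. V x \<partial>\<mu>") auto
  have bd: "(\<Sum>i<k. ?I i) \<le> ennreal B" for k
  proof -
    have "(\<Sum>i<k. ?I i) \<le> (\<integral>\<^sup>+ x. V x \<partial>?m k) + (\<Sum>i<k. ?I i)" by simp
    also have "\<dots> \<le> ennreal B"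
      using drift_summable[OF f \<mu> V \<kappa>' drift, where k = k] unfolding B .
    finally show ?thesis .
  qed
  have finI: "?I k < \<infinity>" for k
  proof -
    have "?I k \<le> (\<Sum>i<Suc k. ?I i)" by simp
    also have "\<dots> \<le> ennreal B" by (rule bd)
    finally show ?thesis by (simp add: le_less_trans)
  qed
  show int: "integrable (?m k) \<kappa>" for k
  proof (rule integrableI_nonneg)
    show "\<kappa> \<in> borel_measurable (?m k)" unfolding prob_measuresD(4)[OF m] by (rule \<kappa>(1))
    show "AE x in ?m k. 0 \<le> \<kappa> x" by (rule AE_I2) (simp add: prob_measuresD(3)[OF m] \<kappa>(2))
  qed (use finI in simp)
  have eq: "?I k = ennreal (\<integral>x. \<kappa> x \<partial>?m k)" for k
    by (rule nn_integral_eq_integral[OF int]) (rule AE_I2, simp add: prob_measuresD(3)[OF m] \<kappa>(2))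
  have nn: "0 \<le> (\<integral>x. \<kappa> x \<partial>?m k)" for k
    by (rule integral_nonneg_AE) (rule AE_I2, simp add: prob_measuresD(3)[OF m] \<kappa>(2))
  have "(\<Sum>i<k. \<integral>x. \<kappa> x \<partial>?m i) \<le> B" for k
    using bd[of k] unfolding eq by (subst (asm) sum_ennreal) (auto simp: nn ennreal_le_iff B)
  then have "summable (\<lambda>k. \<integral>x. \<kappa> x \<partial>?m k)"
    by (intro summableI_nonneg_bounded[where x = B] nn)
  then show "(\<lambda>k. \<integral>x. \<kappa> x \<partial>?m k) \<longlonglongrightarrow> 0" by (rule summable_LIMSEQ_zero)
qed

section \<open>Expected decrease of the Lyapunov function\<close>

text \<open>The second moment of cos^2 under the populations minus its squared mean, see
  \<open>cos_variance_sums\<close>. In this form, through norms of operators, continuity is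
  visible.\<close>

definition cos_variance :: "real \<Rightarrow> real \<Rightarrow> ell2 \<Rightarrow> real" where
  "cos_variance \<theta> \<phi> x = (norm (meas_op \<theta> \<phi> Ground (meas_op \<theta> \<phi> Ground x)))\<^sup>2 - (ground_prob \<theta> \<phi> x)\<^sup>2"

lemma cos_variance_sums:
  assumes "norm x = 1"
  shows "(\<lambda>n. ((cos (\<theta> + real n * \<phi>))\<^sup>2 - ground_prob \<theta> \<phi> x)\<^sup>2 * population x n) sums cos_variance \<theta> \<phi> x"
proof -
  let ?c = "\<lambda>n. (cos (\<theta> + real n * \<phi>))\<^sup>2" and ?g = "ground_prob \<theta> \<phi> x"
  have 4: "(\<lambda>n. ?c n * (?c n * population x n)) sums (norm (meas_op \<theta> \<phi> Ground (meas_op \<theta> \<phi> Ground x)))\<^sup>2"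
    using meas_op_sums[of Ground \<theta> \<phi> "meas_op \<theta> \<phi> Ground x"]
    by (simp add: population_def meas_op.rep_eq norm_mult power_mult_distrib)
  have p: "population x sums 1" using population_sums[of x] assms by simp
  have "(\<lambda>n. ?c n * (?c n * population x n) - 2 * ?g * (?c n * population x n) + ?g\<^sup>2 * population x n)
      sums ((norm (meas_op \<theta> \<phi> Ground (meas_op \<theta> \<phi> Ground x)))\<^sup>2 - 2 * ?g * ?g + ?g\<^sup>2 * 1)"
    by (intro sums_add sums_diff sums_mult 4 ground_prob_sums p)
  moreover have "?c n * (?c n * population x n) - 2 * ?g * (?c n * population x n) + ?g\<^sup>2 * population x n
      = (?c n - ?g)\<^sup>2 * population x n" for n
    by (simp add: power2_diff) (simp add: power2_eq_square algebra_simps)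
  ultimately show ?thesis by (simp add: cos_variance_def power2_eq_square)
qed

lemma cos_variance_nonneg: "norm x = 1 \<Longrightarrow> 0 \<le> cos_variance \<theta> \<phi> x"
  by (rule sums_le[OF _ sums_zero cos_variance_sums]) auto

lemma continuous_cos_variance: "continuous_on A (cos_variance \<theta> \<phi>)"
  unfolding cos_variance_def[abs_def]
  by (intro continuous_intros continuous_ground_prob continuous_on_compose2[OF continuous_meas_op continuous_meas_op]) auto

text \<open>Also true for an outcome of probability \<open>0\<close>, where \<^const>\<open>post_meas\<close> is a dummy value.\<close>

lemma meas_prob_post_population:
  "(norm (meas_op \<theta> \<phi> s x))\<^sup>2 * population (post_meas \<theta> \<phi> s x) n
    = (angle_fun s (\<theta> + real n * \<phi>))\<^sup>2 * population x n"
proof (cases "meas_op \<theta> \<phi> s x = 0")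
  case True
  have "coord (meas_op \<theta> \<phi> s x) n = 0" by (simp only: True zero_ell2.rep_eq)
  then have "of_real (angle_fun s (\<theta> + real n * \<phi>)) * coord x n = 0" by (simp only: meas_op.rep_eq)
  then show ?thesis using True by (auto simp: population_def)
next
  case False
  then have "(norm (meas_op \<theta> \<phi> s x))\<^sup>2 * population (post_meas \<theta> \<phi> s x) n = population (meas_op \<theta> \<phi> s x) n"
    by (simp add: post_meas_def population_def coord_simps norm_mult norm_divide power_mult_distrib power_divide field_simps)
  also have "\<dots> = (angle_fun s (\<theta> + real n * \<phi>))\<^sup>2 * population x n"
    by (simp add: population_def meas_op.rep_eq norm_mult power_mult_distrib)
  finally show ?thesis .
qed

lemma sum_outcome: "(\<Sum>s\<in>UNIV. F s) = F Ground + F Excited"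
  by (simp add: UNIV_outcome)

lemma population_martingale:
  "(\<Sum>s\<in>UNIV. (norm (meas_op \<theta> \<phi> s x))\<^sup>2 * population (post_meas \<theta> \<phi> s x) n) = population x n"
  by (simp add: sum_outcome meas_prob_post_population distrib_right[symmetric])

lemma energy_martingale:
  "(\<Sum>s\<in>UNIV. ennreal ((norm (meas_op \<theta> \<phi> s x))\<^sup>2) * energy nbar (post_meas \<theta> \<phi> s x)) = energy nbar x"
proof -
  have "ennreal ((norm (meas_op \<theta> \<phi> s x))\<^sup>2) * energy nbar (post_meas \<theta> \<phi> s x)
      = (\<Sum>n. ennreal (sigma nbar n * ((norm (meas_op \<theta> \<phi> s x))\<^sup>2 * population (post_meas \<theta> \<phi> s x) n)))" for s
    unfolding energy_def ennreal_suminf_cmult[symmetric]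
    by (rule arg_cong[where f = suminf], rule ext) (simp add: ennreal_mult[symmetric] sigma_nonneg mult_ac)
  then have "(\<Sum>s\<in>UNIV. ennreal ((norm (meas_op \<theta> \<phi> s x))\<^sup>2) * energy nbar (post_meas \<theta> \<phi> s x))
      = (\<Sum>n. ennreal (sigma nbar n * ((norm (meas_op \<theta> \<phi> Ground x))\<^sup>2 * population (post_meas \<theta> \<phi> Ground x) n)) +
           ennreal (sigma nbar n * ((norm (meas_op \<theta> \<phi> Excited x))\<^sup>2 * population (post_meas \<theta> \<phi> Excited x) n)))"
    unfolding sum_outcome by (simp only: suminf_add[OF summableI summableI])
  also have "\<dots> = energy nbar x"
    unfolding energy_def
  proof (rule arg_cong[where f = suminf], rule ext)
    fix n
    show "ennreal (sigma nbar n * ((norm (meas_op \<theta> \<phi> Ground x))\<^sup>2 * population (post_meas \<theta> \<phi> Ground x) n)) +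
           ennreal (sigma nbar n * ((norm (meas_op \<theta> \<phi> Excited x))\<^sup>2 * population (post_meas \<theta> \<phi> Excited x) n))
        = ennreal (sigma nbar n * population x n)"
      using population_martingale[of \<theta> \<phi> x n]
      by (simp add: sum_outcome ennreal_plus[symmetric] sigma_nonneg distrib_left[symmetric] del: ennreal_plus)
  qed
  finally show ?thesis .
qed

text \<open>The first product is the probability of two ground outcomes in a row, that is, the mean
  of cos^4. The second identity says that the ground probability is a martingale under the
  measurement.\<close>

lemma ground_prob_post:
  assumes "norm x = 1"
  shows "(norm (meas_op \<theta> \<phi> Ground x))\<^sup>2 * ground_prob \<theta> \<phi> (post_meas \<theta> \<phi> Ground x)
      = cos_variance \<theta> \<phi> x + (ground_prob \<theta> \<phi> x)\<^sup>2"
    and "(norm (meas_op \<theta> \<phi> Ground x))\<^sup>2 * ground_prob \<theta> \<phi> (post_meas \<theta> \<phi> Ground x)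
      + (norm (meas_op \<theta> \<phi> Excited x))\<^sup>2 * ground_prob \<theta> \<phi> (post_meas \<theta> \<phi> Excited x) = ground_prob \<theta> \<phi> x"
proof -
  let ?c = "\<lambda>n. (cos (\<theta> + real n * \<phi>))\<^sup>2"
  have s: "(\<lambda>n. ?c n * ((norm (meas_op \<theta> \<phi> s x))\<^sup>2 * population (post_meas \<theta> \<phi> s x) n)) sums
      ((norm (meas_op \<theta> \<phi> s x))\<^sup>2 * ground_prob \<theta> \<phi> (post_meas \<theta> \<phi> s x))" for s
    using sums_mult[OF ground_prob_sums, of "(norm (meas_op \<theta> \<phi> s x))\<^sup>2"] by (simp add: mult_ac)
  have 4: "(\<lambda>n. ?c n * (?c n * population x n)) sums (norm (meas_op \<theta> \<phi> Ground (meas_op \<theta> \<phi> Ground x)))\<^sup>2"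
    using meas_op_sums[of Ground \<theta> \<phi> "meas_op \<theta> \<phi> Ground x"]
    by (simp add: population_def meas_op.rep_eq norm_mult power_mult_distrib)
  show "(norm (meas_op \<theta> \<phi> Ground x))\<^sup>2 * ground_prob \<theta> \<phi> (post_meas \<theta> \<phi> Ground x)
      = cos_variance \<theta> \<phi> x + (ground_prob \<theta> \<phi> x)\<^sup>2"
    using s[of Ground] 4 unfolding meas_prob_post_population by (simp add: cos_variance_def sums_unique2)
  have "(\<lambda>n. ?c n * population x n) sums
    ((norm (meas_op \<theta> \<phi> Ground x))\<^sup>2 * ground_prob \<theta> \<phi> (post_meas \<theta> \<phi> Ground x)
      + (norm (meas_op \<theta> \<phi> Excited x))\<^sup>2 * ground_prob \<theta> \<phi> (post_meas \<theta> \<phi> Excited x))"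
    using sums_add[OF s[of Ground] s[of Excited]] population_martingale[of \<theta> \<phi> x]
    by (simp add: sum_outcome distrib_left[symmetric])
  then show "(norm (meas_op \<theta> \<phi> Ground x))\<^sup>2 * ground_prob \<theta> \<phi> (post_meas \<theta> \<phi> Ground x)
      + (norm (meas_op \<theta> \<phi> Excited x))\<^sup>2 * ground_prob \<theta> \<phi> (post_meas \<theta> \<phi> Excited x) = ground_prob \<theta> \<phi> x"
    using ground_prob_sums sums_unique2 by blast
qed

text \<open>A variable with values X and Y of probabilities g and 1 - g has variance g (1 - g) (X -
  Y)^2, and its covariance with the indicator of the first value is g (1 - g) (X - Y). The claim is
  the Cauchy-Schwarz inequality for this covariance, the indicator having variance at most
  1/4.\<close>

lemma two_point_variance:
  fixes g X Y :: real
  assumes "0 \<le> g" "g \<le> 1"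
  shows "(g * X + (1 - g) * Y)\<^sup>2 + 4 * (g * X - g * (g * X + (1 - g) * Y))\<^sup>2 \<le> g * X\<^sup>2 + (1 - g) * Y\<^sup>2"
proof -
  let ?v = "g * (1 - g)"
  have "g * X\<^sup>2 + (1 - g) * Y\<^sup>2 - (g * X + (1 - g) * Y)\<^sup>2 = ?v * (X - Y)\<^sup>2"
    by (simp add: power2_eq_square algebra_simps)
  moreover have "g * X - g * (g * X + (1 - g) * Y) = ?v * (X - Y)"
    by (simp add: algebra_simps)
  then have "4 * (g * X - g * (g * X + (1 - g) * Y))\<^sup>2 = (4 * ?v) * (?v * (X - Y)\<^sup>2)"
    by (simp add: power2_eq_square)
  moreover have "(4 * ?v) * (?v * (X - Y)\<^sup>2) \<le> 1 * (?v * (X - Y)\<^sup>2)"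
  proof (rule mult_right_mono)
    show "4 * ?v \<le> 1" using zero_le_power2[of "2 * g - 1"] by (simp add: power2_eq_square algebra_simps)
    show "0 \<le> ?v * (X - Y)\<^sup>2" using assms by simp
  qed
  ultimately show ?thesis by linarith
qed

text \<open>On the sphere the gap is 2 p - 2 p^2 plus a constant, with p the ground probability. The
  mean of p is preserved, so only the variance of its new value counts, and
  \<open>cos_variance\<close> is its covariance with the outcome; doubling the 4 of
  \<open>two_point_variance\<close> gives 8.\<close>

lemma gap_supermartingale:
  assumes x: "norm x = 1"
  shows "(\<Sum>s\<in>UNIV. (norm (meas_op \<theta> \<phi> s x))\<^sup>2 * gap \<theta> \<phi> nbar (post_meas \<theta> \<phi> s x)) + 8 * (cos_variance \<theta> \<phi> x)\<^sup>2
    \<le> gap \<theta> \<phi> nbar x"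
proof -
  let ?g = "ground_prob \<theta> \<phi> x"
  let ?X = "ground_prob \<theta> \<phi> (post_meas \<theta> \<phi> Ground x)" and ?Y = "ground_prob \<theta> \<phi> (post_meas \<theta> \<phi> Excited x)"
  define K where "K = ((cos (\<theta> + real nbar * \<phi>))\<^sup>2)\<^sup>2 + (1 - (cos (\<theta> + real nbar * \<phi>))\<^sup>2)\<^sup>2 - 1"
  have gap: "gap \<theta> \<phi> nbar y = K + 2 * ground_prob \<theta> \<phi> y - 2 * (ground_prob \<theta> \<phi> y)\<^sup>2" if "norm y = 1" for y
    unfolding gap_eq[OF that] K_def by (simp add: power2_diff)
  have w: "(norm (meas_op \<theta> \<phi> Ground x))\<^sup>2 = ?g" "(norm (meas_op \<theta> \<phi> Excited x))\<^sup>2 = 1 - ?g"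
    by (simp_all add: ground_prob_def excited_prob[OF x])
  have e: "?g * ?X + (1 - ?g) * ?Y = ?g" and v: "cos_variance \<theta> \<phi> x = ?g * ?X - ?g * (?g * ?X + (1 - ?g) * ?Y)"
    using ground_prob_post[OF x, of \<theta> \<phi>] unfolding w by (simp_all add: power2_eq_square)
  have "?g\<^sup>2 + 4 * (cos_variance \<theta> \<phi> x)\<^sup>2 \<le> ?g * ?X\<^sup>2 + (1 - ?g) * ?Y\<^sup>2"
    using two_point_variance[of ?g ?X ?Y] ground_prob_bounds[OF x, of \<theta> \<phi>] unfolding v[symmetric] by (simp add: e)
  moreover have "?g * (K + 2 * ?X - 2 * ?X\<^sup>2) + (1 - ?g) * (K + 2 * ?Y - 2 * ?Y\<^sup>2)
      = K + 2 * (?g * ?X + (1 - ?g) * ?Y) - 2 * (?g * ?X\<^sup>2 + (1 - ?g) * ?Y\<^sup>2)"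
    by (simp add: algebra_simps)
  ultimately show ?thesis
    unfolding sum_outcome w gap[OF x] gap[OF norm_post_meas[OF x]] e by simp
qed

lemma prob_outcomes_sum: "norm x = 1 \<Longrightarrow> (\<Sum>s\<in>UNIV. (norm (meas_op \<theta> \<phi> s x))\<^sup>2) = 1"
  by (simp add: sum_outcome excited_prob) (simp add: ground_prob_def)

lemma shifted_lyapunov_supermartingale:
  assumes x: "norm x = 1" and d: "0 \<le> \<delta>"
  shows "(\<Sum>s\<in>UNIV. ennreal ((norm (meas_op \<theta> \<phi> s x))\<^sup>2) * shifted_lyapunov \<theta> \<phi> nbar \<delta> (post_meas \<theta> \<phi> s x))
     + ennreal (\<delta> * (8 * (cos_variance \<theta> \<phi> x)\<^sup>2)) \<le> shifted_lyapunov \<theta> \<phi> nbar \<delta> x"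
proof -
  let ?w = "\<lambda>s. (norm (meas_op \<theta> \<phi> s x))\<^sup>2" and ?h = "\<lambda>s. gap \<theta> \<phi> nbar (post_meas \<theta> \<phi> s x)"
  have h: "0 \<le> 1 + ?h s" for s
    using gap_bounds[OF norm_post_meas[OF x, of \<theta> \<phi> s], of \<theta> \<phi> nbar] by linarith
  have "(\<Sum>s\<in>UNIV. ennreal (?w s) * ennreal (\<delta> * (1 + ?h s))) = ennreal (\<Sum>s\<in>UNIV. ?w s * (\<delta> * (1 + ?h s)))"
    using h d by (simp add: ennreal_mult[symmetric] sum_ennreal)
  moreover have "(\<Sum>s\<in>UNIV. ?w s * (\<delta> * (1 + ?h s))) = \<delta> * ((\<Sum>s\<in>UNIV. ?w s) + (\<Sum>s\<in>UNIV. ?w s * ?h s))"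
    by (simp add: sum_outcome algebra_simps)
  ultimately have 1: "(\<Sum>s\<in>UNIV. ennreal (?w s) * ennreal (\<delta> * (1 + ?h s))) = ennreal (\<delta> * (1 + (\<Sum>s\<in>UNIV. ?w s * ?h s)))"
    by (simp add: prob_outcomes_sum[OF x])
  have nn: "0 \<le> 1 + (\<Sum>s\<in>UNIV. ?w s * ?h s)"
  proof -
    have "0 \<le> (\<Sum>s\<in>UNIV. ?w s * (1 + ?h s))" using h by (intro sum_nonneg) simp
    also have "\<dots> = 1 + (\<Sum>s\<in>UNIV. ?w s * ?h s)"
      using prob_outcomes_sum[OF x, of \<theta> \<phi>] by (simp add: sum_outcome algebra_simps)
    finally show ?thesis .
  qed
  have "(\<Sum>s\<in>UNIV. ennreal (?w s) * shifted_lyapunov \<theta> \<phi> nbar \<delta> (post_meas \<theta> \<phi> s x))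
      = energy nbar x + ennreal (\<delta> * (1 + (\<Sum>s\<in>UNIV. ?w s * ?h s)))"
    unfolding shifted_lyapunov_def distrib_left[where 'a = ennreal] sum.distrib energy_martingale 1 ..
  then have "(\<Sum>s\<in>UNIV. ennreal (?w s) * shifted_lyapunov \<theta> \<phi> nbar \<delta> (post_meas \<theta> \<phi> s x))
     + ennreal (\<delta> * (8 * (cos_variance \<theta> \<phi> x)\<^sup>2))
     = energy nbar x + ennreal (\<delta> * (1 + (\<Sum>s\<in>UNIV. ?w s * ?h s)) + \<delta> * (8 * (cos_variance \<theta> \<phi> x)\<^sup>2))"
    using nn d by (simp add: ennreal_plus add.assoc)
  also have "\<dots> \<le> shifted_lyapunov \<theta> \<phi> nbar \<delta> x"
    unfolding shifted_lyapunov_def distrib_left[symmetric]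
    using gap_supermartingale[OF x, of \<theta> \<phi> nbar] d
    by (intro add_left_mono ennreal_leI mult_left_mono) auto
  finally show ?thesis .
qed

lemma feedback_minimal:
  assumes fb: "feedback \<theta> \<phi> nbar \<delta> \<alpha>bar f" and x: "norm x = 1" and a: "\<bar>a\<bar> \<le> \<alpha>bar" and d: "0 \<le> \<delta>"
  shows "shifted_lyapunov \<theta> \<phi> nbar \<delta> (disp (f x) x) \<le> shifted_lyapunov \<theta> \<phi> nbar \<delta> (disp a x)"
proof (rule shifted_lyapunov_mono)
  have "a \<in> {-\<alpha>bar..\<alpha>bar}" using a by auto
  moreover have "is_arg_min (\<lambda>\<alpha>. lyapunov \<theta> \<phi> nbar \<delta> (disp \<alpha> x)) (\<lambda>\<alpha>. \<alpha> \<in> {-\<alpha>bar..\<alpha>bar}) (f x)"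
    using fb x by (simp add: feedback_def displacement_eq_disp)
  ultimately show "lyapunov \<theta> \<phi> nbar \<delta> (disp (f x) x) \<le> lyapunov \<theta> \<phi> nbar \<delta> (disp a x)"
    unfolding is_arg_min_def by (metis not_le)
qed (simp_all add: norm_disp x d)

text \<open>Here \<gamma> is the gain of the control, a function of the state after the measurement,
  and \<kappa> is a lower bound for the total expected gain in terms of the state before it.\<close>

lemma lyapunov_drift:
  assumes f: "f \<in> borel_measurable sphere_borel" and x: "norm x = 1" and d: "0 \<le> \<delta>"
    and \<gamma>: "\<And>y. norm y = 1 \<Longrightarrow> shifted_lyapunov \<theta> \<phi> nbar \<delta> (disp (f y) y) + ennreal (\<gamma> y) \<le> shifted_lyapunov \<theta> \<phi> nbar \<delta> y"
    and \<kappa>: "ennreal (\<kappa> x) \<le> (\<Sum>s\<in>UNIV. ennreal ((norm (meas_op \<theta> \<phi> s x))\<^sup>2) * ennreal (\<gamma> (post_meas \<theta> \<phi> s x)))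
        + ennreal (\<delta> * (8 * (cos_variance \<theta> \<phi> x)\<^sup>2))"
  shows "(\<integral>\<^sup>+ y. shifted_lyapunov \<theta> \<phi> nbar \<delta> y \<partial>transition \<theta> \<phi> f x) + ennreal (\<kappa> x) \<le> shifted_lyapunov \<theta> \<phi> nbar \<delta> x"
proof -
  let ?w = "\<lambda>s. ennreal ((norm (meas_op \<theta> \<phi> s x))\<^sup>2)" and ?V = "shifted_lyapunov \<theta> \<phi> nbar \<delta>"
  have "(\<integral>\<^sup>+ y. ?V y \<partial>transition \<theta> \<phi> f x) + ennreal (\<kappa> x)
      \<le> (\<Sum>s\<in>UNIV. ?w s * ?V (step \<theta> \<phi> f s x)) + ((\<Sum>s\<in>UNIV. ?w s * ennreal (\<gamma> (post_meas \<theta> \<phi> s x)))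
        + ennreal (\<delta> * (8 * (cos_variance \<theta> \<phi> x)\<^sup>2)))"
    unfolding nn_integral_transition[OF x measurable_sphere_borelI[OF measurable_shifted_lyapunov]]
    by (rule add_left_mono[OF \<kappa>])
  also have "\<dots> = (\<Sum>s\<in>UNIV. ?w s * (?V (step \<theta> \<phi> f s x) + ennreal (\<gamma> (post_meas \<theta> \<phi> s x))))
        + ennreal (\<delta> * (8 * (cos_variance \<theta> \<phi> x)\<^sup>2))"
    by (simp add: distrib_left sum.distrib add.assoc)
  also have "\<dots> \<le> (\<Sum>s\<in>UNIV. ?w s * ?V (post_meas \<theta> \<phi> s x)) + ennreal (\<delta> * (8 * (cos_variance \<theta> \<phi> x)\<^sup>2))"
    unfolding step_def by (intro add_right_mono sum_mono mult_left_mono \<gamma> norm_post_meas x) simp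
  also have "\<dots> \<le> ?V x" by (rule shifted_lyapunov_supermartingale[OF x d])
  finally show ?thesis .
qed

lemma variance_drift:
  assumes fb: "feedback \<theta> \<phi> nbar \<delta> \<alpha>bar f" and x: "norm x = 1" and d: "0 \<le> \<delta>" and ab: "0 \<le> \<alpha>bar"
  shows "(\<integral>\<^sup>+ y. shifted_lyapunov \<theta> \<phi> nbar \<delta> y \<partial>transition \<theta> \<phi> f x) + ennreal (\<delta> * (8 * (cos_variance \<theta> \<phi> x)\<^sup>2))
    \<le> shifted_lyapunov \<theta> \<phi> nbar \<delta> x"
proof (rule lyapunov_drift[where \<gamma> = "\<lambda>_. 0" and \<kappa> = "\<lambda>x. \<delta> * (8 * (cos_variance \<theta> \<phi> x)\<^sup>2)", OF _ x d])
  show "f \<in> borel_measurable sphere_borel" using fb by (simp add: feedback_def)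
  show "shifted_lyapunov \<theta> \<phi> nbar \<delta> (disp (f y) y) + ennreal 0 \<le> shifted_lyapunov \<theta> \<phi> nbar \<delta> y" if "norm y = 1" for y
    using feedback_minimal[OF fb that, of 0] ab d by (simp add: disp_0)
qed simp

text \<open>A hinge: 0 for populations up to 1 - \<eta>, then linear, with value c at population 1.
  Convexity lets it pass through the measurement, continuity through the weak limit.\<close>

definition excess :: "real \<Rightarrow> real \<Rightarrow> nat \<Rightarrow> ell2 \<Rightarrow> real" where
  "excess c \<eta> n x = c * max 0 ((population x n - 1 + \<eta>) / \<eta>)"

lemma continuous_excess: "continuous_on A (excess c \<eta> n)"
  unfolding excess_def[abs_def] population_def divide_inverse
  by (intro continuous_intros continuous_on_coord)

lemma excess_nonneg: "0 \<le> c \<Longrightarrow> 0 \<le> excess c \<eta> n x"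
  by (simp add: excess_def)

lemma population_drift:
  assumes fb: "feedback \<theta> \<phi> nbar \<delta> \<alpha>bar f" and x: "norm x = 1" and d: "0 \<le> \<delta>" and a: "\<bar>a\<bar> \<le> \<alpha>bar"
    and c: "0 < c" and \<eta>: "0 < \<eta>"
    and desc: "\<And>y. norm y = 1 \<Longrightarrow> 1 - \<eta> < population y n \<Longrightarrow>
      shifted_lyapunov \<theta> \<phi> nbar \<delta> (disp a y) + ennreal c \<le> shifted_lyapunov \<theta> \<phi> nbar \<delta> y"
  shows "(\<integral>\<^sup>+ y. shifted_lyapunov \<theta> \<phi> nbar \<delta> y \<partial>transition \<theta> \<phi> f x) + ennreal (excess c \<eta> n x)
    \<le> shifted_lyapunov \<theta> \<phi> nbar \<delta> x"
proof (rule lyapunov_drift[where \<gamma> = "excess c \<eta> n" and \<kappa> = "excess c \<eta> n", OF _ x d])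
  show "f \<in> borel_measurable sphere_borel" using fb by (simp add: feedback_def)
  show "shifted_lyapunov \<theta> \<phi> nbar \<delta> (disp (f y) y) + ennreal (excess c \<eta> n y) \<le> shifted_lyapunov \<theta> \<phi> nbar \<delta> y"
    if y: "norm y = 1" for y
  proof (cases "1 - \<eta> < population y n")
    case True
    have "(population y n - 1 + \<eta>) / \<eta> \<le> 1" using population_le_1[OF y, of n] \<eta> by simp
    then have "c * max 0 ((population y n - 1 + \<eta>) / \<eta>) \<le> c * 1" using c by (intro mult_left_mono) auto
    then have "shifted_lyapunov \<theta> \<phi> nbar \<delta> (disp (f y) y) + ennreal (excess c \<eta> n y)
        \<le> shifted_lyapunov \<theta> \<phi> nbar \<delta> (disp a y) + ennreal c"
      by (intro add_mono feedback_minimal[OF fb y a d] ennreal_leI) (simp add: excess_def)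
    also have "\<dots> \<le> shifted_lyapunov \<theta> \<phi> nbar \<delta> y" by (rule desc[OF y True])
    finally show ?thesis .
  next
    case False
    then have "(population y n - 1 + \<eta>) / \<eta> \<le> 0" using \<eta> by (simp add: divide_le_0_iff)
    then have "excess c \<eta> n y = 0" unfolding excess_def by (simp add: max_absorb1)
    moreover have "0 \<le> \<alpha>bar" using a by linarith
    ultimately show ?thesis using feedback_minimal[OF fb y, of 0] d by (simp add: disp_0)
  qed
  let ?w = "\<lambda>s. (norm (meas_op \<theta> \<phi> s x))\<^sup>2" and ?y = "\<lambda>s. post_meas \<theta> \<phi> s x"
  \<comment> \<open>Jensen's inequality for the convex hinge, the population being a martingale
    under the measurement.\<close>
  have "excess c \<eta> n x \<le> (\<Sum>s\<in>UNIV. ?w s * excess c \<eta> n (?y s))"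
  proof -
    have "(population x n - 1 + \<eta>) / \<eta> = (\<Sum>s\<in>UNIV. ?w s * ((population (?y s) n - 1 + \<eta>) / \<eta>))"
    proof -
      have "(\<Sum>s\<in>UNIV. ?w s * ((population (?y s) n - 1 + \<eta>) / \<eta>))
          = ((\<Sum>s\<in>UNIV. ?w s * population (?y s) n) + (\<eta> - 1) * (\<Sum>s\<in>UNIV. ?w s)) / \<eta>"
        unfolding sum_outcome by (simp add: algebra_simps add_divide_distrib diff_divide_distrib)
      then show ?thesis by (simp only: population_martingale prob_outcomes_sum[OF x]) simp
    qed
    also have "\<dots> \<le> (\<Sum>s\<in>UNIV. ?w s * max 0 ((population (?y s) n - 1 + \<eta>) / \<eta>))"
      by (intro sum_mono mult_left_mono) auto
    finally have "max 0 ((population x n - 1 + \<eta>) / \<eta>) \<le> (\<Sum>s\<in>UNIV. ?w s * max 0 ((population (?y s) n - 1 + \<eta>) / \<eta>))"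
      by (simp add: sum_nonneg)
    then have "c * max 0 ((population x n - 1 + \<eta>) / \<eta>) \<le> c * (\<Sum>s\<in>UNIV. ?w s * max 0 ((population (?y s) n - 1 + \<eta>) / \<eta>))"
      using c by (intro mult_left_mono) auto
    then show ?thesis by (simp add: excess_def sum_distrib_left mult_ac)
  qed
  then have "ennreal (excess c \<eta> n x) \<le> ennreal (\<Sum>s\<in>UNIV. ?w s * excess c \<eta> n (?y s))" by (rule ennreal_leI)
  also have "\<dots> = (\<Sum>s\<in>UNIV. ennreal (?w s) * ennreal (excess c \<eta> n (?y s)))"
    using c by (simp add: ennreal_mult[symmetric] sum_ennreal excess_nonneg)
  finally show "ennreal (excess c \<eta> n x) \<le> (\<Sum>s\<in>UNIV. ennreal (?w s) * ennreal (excess c \<eta> n (?y s)))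
      + ennreal (\<delta> * (8 * (cos_variance \<theta> \<phi> x)\<^sup>2))"
    by (simp add: add_increasing2)
qed

section \<open>States of small variance\<close>

lemma nondegenerate_angle_distinct:
  assumes "nondegenerate_eigenvalues (meas_op \<theta> \<phi> s)" "n \<noteq> m"
  shows "angle_fun s (\<theta> + real n * \<phi>) \<noteq> angle_fun s (\<theta> + real m * \<phi>)"
proof
  assume eq: "angle_fun s (\<theta> + real n * \<phi>) = angle_fun s (\<theta> + real m * \<phi>)"
  let ?l = "complex_of_real (angle_fun s (\<theta> + real n * \<phi>))"
  have "meas_op \<theta> \<phi> s (fock n) = ?l *\<^sub>C fock n" "meas_op \<theta> \<phi> s (fock m) = ?l *\<^sub>C fock m"
    using eq by (simp_all add: meas_op_fock scaleR_eq_scaleC)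
  moreover have "fock n \<noteq> 0" using norm_fock[of n] by force
  ultimately obtain c where "fock m = c *\<^sub>C fock n"
    using assms(1) unfolding nondegenerate_eigenvalues_def by blast
  then have "coord (fock m) m = coord (c *\<^sub>C fock n) m" by simp
  then show False using \<open>n \<noteq> m\<close> by (simp add: coord_simps)
qed

text \<open>If \<open>cos\<^sup>2 \<phi>\<^sub>n = cos\<^sup>2 \<phi>\<^sub>m\<close> for \<open>m < n\<close>, both \<open>cos\<close> and \<open>sin\<close> change sign between \<open>m\<close> and \<open>n\<close>, so
  that \<open>(n - m) \<phi>\<close> is an odd multiple of \<open>\<pi>\<close>; then \<open>cos \<phi>\<^sub>m\<close> occurs again at the index \<open>2 n - m\<close>.\<close>

lemma cos_squared_distinct:
  assumes g: "nondegenerate_eigenvalues (meas_op \<theta> \<phi> Ground)"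
    and e: "nondegenerate_eigenvalues (meas_op \<theta> \<phi> Excited)" and nm: "n \<noteq> m"
  shows "(cos (\<theta> + real n * \<phi>))\<^sup>2 \<noteq> (cos (\<theta> + real m * \<phi>))\<^sup>2"
proof -
  have *: False if "m < n" and eq: "(cos (\<theta> + real n * \<phi>))\<^sup>2 = (cos (\<theta> + real m * \<phi>))\<^sup>2" for n m
  proof -
    let ?a = "\<theta> + real n * \<phi>" and ?b = "\<theta> + real m * \<phi>"
    have c: "cos ?a = - cos ?b"
      using nondegenerate_angle_distinct[OF g, of n m] that by (auto simp: power2_eq_iff)
    have "(sin ?a)\<^sup>2 = (sin ?b)\<^sup>2" using eq by (simp add: sin_squared_eq)
    then have s: "sin ?a = - sin ?b"
      using nondegenerate_angle_distinct[OF e, of n m] \<open>m < n\<close> by (auto simp: power2_eq_iff)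
    have "cos (?a - ?b) = - ((sin ?b)\<^sup>2 + (cos ?b)\<^sup>2)"
      unfolding cos_diff c s by (simp add: power2_eq_square)
    then have cd: "cos (?a - ?b) = - 1" by simp
    have sd: "sin (?a - ?b) = 0"
      unfolding sin_diff c s by simp
    have "\<theta> + real (n + (n - m)) * \<phi> = ?a + (?a - ?b)"
      using \<open>m < n\<close> by (simp add: of_nat_diff algebra_simps)
    then have "cos (\<theta> + real (n + (n - m)) * \<phi>) = cos ?a * cos (?a - ?b) - sin ?a * sin (?a - ?b)"
      by (simp only: cos_add)
    also have "\<dots> = cos ?b" unfolding cd sd c by simp
    finally have "cos (\<theta> + real (n + (n - m)) * \<phi>) = cos ?b" .
    moreover have "n + (n - m) \<noteq> m" using \<open>m < n\<close> by linarith
    ultimately show False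
      using nondegenerate_angle_distinct[OF g, of "n + (n - m)" m] unfolding angle_fun.simps by blast
  qed
  show ?thesis using *[of m n] *[of n m] nm by (metis linorder_neqE_nat)
qed

lemma fock_ray_iff: "x \<in> fock_ray n \<longleftrightarrow> norm x = 1 \<and> population x n = 1"
proof
  assume "x \<in> fock_ray n"
  then obtain c where "x = c *\<^sub>C fock n" "cmod c = 1" by (auto simp: fock_ray_def)
  then show "norm x = 1 \<and> population x n = 1" by (simp add: norm_scaleC population_def coord_simps)
next
  assume x: "norm x = 1 \<and> population x n = 1"
  then have nz: "coord x n \<noteq> 0" by (auto simp: population_def)
  have "(norm (x - (coord x n / cmod (coord x n)) *\<^sub>C fock n))\<^sup>2 \<le> 0"
    using near_phase_fock[OF _ nz] x by simp
  then have "x = (coord x n / cmod (coord x n)) *\<^sub>C fock n" by simp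
  moreover have "cmod (coord x n / cmod (coord x n)) = 1" using nz by (simp add: norm_divide)
  ultimately show "x \<in> fock_ray n" unfolding fock_ray_def by blast
qed

lemma sum_population_le:
  assumes "norm x = 1" "finite A"
  shows "sum (population x) A \<le> 1"
  using sum_le_suminf[of "population x" A] population_sums[of x] assms by (simp add: sums_iff)

text \<open>With variance 0, all occupied levels share the same value of cos^2, so there is only one
  of them.\<close>

lemma cos_variance_zero:
  assumes dist: "\<And>n m. n \<noteq> m \<Longrightarrow> (cos (\<theta> + real n * \<phi>))\<^sup>2 \<noteq> (cos (\<theta> + real m * \<phi>))\<^sup>2"
    and x: "norm x = 1" and v: "cos_variance \<theta> \<phi> x = 0"
  shows "x \<in> (\<Union>n. fock_ray n)"
proof -
  let ?c = "\<lambda>n. (cos (\<theta> + real n * \<phi>))\<^sup>2" and ?g = "ground_prob \<theta> \<phi> x"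
  have s: "(\<lambda>n. (?c n - ?g)\<^sup>2 * population x n) sums 0"
    using cos_variance_sums[OF x, of \<theta> \<phi>] v by simp
  then have z: "(?c n - ?g)\<^sup>2 * population x n = 0" for n
    using suminf_eq_zero_iff[of "\<lambda>n. (?c n - ?g)\<^sup>2 * population x n"] by (auto simp: sums_iff)
  have p: "population x sums 1" using population_sums[of x] x by simp
  have "\<exists>n. population x n \<noteq> 0"
  proof (rule ccontr)
    assume "\<not> ?thesis"
    then have "population x = (\<lambda>_. 0)" by auto
    then show False using p sums_unique2[OF sums_zero] by force
  qed
  then obtain n where n: "population x n \<noteq> 0" by blast
  have "population x m = 0" if "m \<noteq> n" for m
    using z[of n] z[of m] n dist[OF that] by auto
  then have "population x = (\<lambda>m. if m = n then population x m else 0)" by auto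
  then have "(\<lambda>m. if m = n then population x m else 0) sums 1"
    by (rule back_subst[of "\<lambda>f. f sums 1", OF p])
  then have "population x n = 1" using sums_single sums_unique2 by blast
  then show ?thesis using x by (auto simp: fock_ray_iff)
qed

definition tail :: "nat \<Rightarrow> ell2 \<Rightarrow> real" where
  "tail N x = 1 - (\<Sum>n\<le>N. population x n)"

lemma tail_nonneg: "norm x = 1 \<Longrightarrow> 0 \<le> tail N x"
  using sum_population_le[of x "{..N}"] by (simp add: tail_def)

lemma tail_le_1: "tail N x \<le> 1"
  by (simp add: tail_def sum_nonneg)

lemma continuous_population: "continuous_on A (\<lambda>x. population x n)"
  unfolding population_def by (intro continuous_intros continuous_on_coord)

lemma continuous_tail: "continuous_on A (tail N)"
  unfolding tail_def[abs_def] by (intro continuous_intros continuous_population)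

lemma population_le_tail:
  assumes x: "norm x = 1" and n: "n > N"
  shows "population x n \<le> tail N x"
  using sum_population_le[OF x, of "insert n {..N}"] n by (simp add: tail_def)

lemma finite_separation:
  fixes c :: "nat \<Rightarrow> real"
  assumes "\<And>n m. n \<noteq> m \<Longrightarrow> c n \<noteq> c m"
  shows "\<exists>d>0. \<forall>n\<le>N. \<forall>m\<le>N. n \<noteq> m \<longrightarrow> d \<le> \<bar>c n - c m\<bar>"
proof -
  define D where "D = insert 1 ((\<lambda>(n, m). \<bar>c n - c m\<bar>) ` {(n, m) \<in> {..N} \<times> {..N}. n \<noteq> m})"
  have fin: "finite D" unfolding D_def by (intro finite.insertI finite_imageI finite_subset[OF _ finite_cartesian_product[of "{..N}" "{..N}"]]) auto
  have ne: "D \<noteq> {}" by (simp add: D_def)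
  have "Min D > 0" unfolding Min_gr_iff[OF fin ne] using assms by (auto simp: D_def)
  moreover have "Min D \<le> \<bar>c n - c m\<bar>" if "n \<le> N" "m \<le> N" "n \<noteq> m" for n m
    by (rule Min_le[OF fin]) (use that in \<open>auto simp: D_def\<close>)
  ultimately show ?thesis by blast
qed

text \<open>Only one of the values \<open>cos\<^sup>2 \<phi>\<^sub>m\<close>, \<open>m \<le> N\<close>, can be close to their mean.\<close>

lemma small_variance_near_fock:
  assumes dist: "\<And>n m. n \<noteq> m \<Longrightarrow> (cos (\<theta> + real n * \<phi>))\<^sup>2 \<noteq> (cos (\<theta> + real m * \<phi>))\<^sup>2"
    and \<eta>: "\<eta> > 0"
  shows "\<exists>w>0. \<forall>x. norm x = 1 \<longrightarrow> (cos_variance \<theta> \<phi> x)\<^sup>2 < w \<longrightarrow> tail N x < \<eta> / 2 \<longrightarrow> (\<exists>n\<le>N. 1 - \<eta> < population x n)"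
proof -
  let ?c = "\<lambda>n. (cos (\<theta> + real n * \<phi>))\<^sup>2"
  obtain d where d: "d > 0" "\<And>n m. n \<le> N \<Longrightarrow> m \<le> N \<Longrightarrow> n \<noteq> m \<Longrightarrow> d \<le> \<bar>?c n - ?c m\<bar>"
    using finite_separation[of ?c N] dist by blast
  \<comment> \<open>If the levels whose values are at least d/2 away from the mean carried mass
    \<eta>/2, the variance would be at least v. Otherwise they and the tail carry less than \<eta>
    together.\<close>
  define v where "v = (d / 2)\<^sup>2 * (\<eta> / 2)"
  have v: "v > 0" using d \<eta> by (simp add: v_def)
  have "\<exists>n\<le>N. 1 - \<eta> < population x n"
    if x: "norm x = 1" and var: "(cos_variance \<theta> \<phi> x)\<^sup>2 < v\<^sup>2" and t: "tail N x < \<eta> / 2" for x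
  proof -
    let ?g = "ground_prob \<theta> \<phi> x"
    obtain n where n: "n \<le> N" and far: "\<And>m. m \<le> N \<Longrightarrow> m \<noteq> n \<Longrightarrow> d / 2 \<le> \<bar>?c m - ?g\<bar>"
    proof (cases "\<exists>n\<le>N. \<bar>?c n - ?g\<bar> < d / 2")
      case True
      then obtain n where n: "n \<le> N" "\<bar>?c n - ?g\<bar> < d / 2" by blast
      have "d / 2 \<le> \<bar>?c m - ?g\<bar>" if "m \<le> N" "m \<noteq> n" for m
        using d(2)[OF that(1) n(1) that(2)] n(2) by linarith
      then show ?thesis using that n(1) by blast
    next
      case False
      then show ?thesis using that[of 0] by force
    qed
    have "(d / 2)\<^sup>2 * (\<Sum>m\<in>{..N} - {n}. population x m) \<le> (\<Sum>m\<in>{..N} - {n}. (?c m - ?g)\<^sup>2 * population x m)"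
      unfolding sum_distrib_left
    proof (intro sum_mono mult_right_mono)
      fix m assume "m \<in> {..N} - {n}"
      then have "d / 2 \<le> \<bar>?c m - ?g\<bar>" using far by auto
      then have "(d / 2)\<^sup>2 \<le> \<bar>?c m - ?g\<bar>\<^sup>2" using d by (intro power_mono) auto
      then show "(d / 2)\<^sup>2 \<le> (?c m - ?g)\<^sup>2" by simp
    qed simp
    also have "\<dots> \<le> cos_variance \<theta> \<phi> x"
      using sum_le_suminf[of "\<lambda>m. (?c m - ?g)\<^sup>2 * population x m" "{..N} - {n}"] cos_variance_sums[OF x, of \<theta> \<phi>]
      by (simp add: sums_iff)
    also have "\<dots> < v" using var v cos_variance_nonneg[OF x, of \<theta> \<phi>] by (simp add: power2_less_imp_less)
    finally have "(\<Sum>m\<in>{..N} - {n}. population x m) < \<eta> / 2"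
      unfolding v_def using d by (simp add: mult_less_cancel_left)
    moreover have "(\<Sum>m\<le>N. population x m) = population x n + (\<Sum>m\<in>{..N} - {n}. population x m)"
      using n by (subst sum.remove[of _ n]) auto
    ultimately show ?thesis using t n unfolding tail_def by (intro exI[of _ n]) linarith
  qed
  moreover have "v\<^sup>2 > 0" using v by simp
  ultimately show ?thesis by blast
qed

lemma compact_fock_ray: "compact (fock_ray n)"
proof -
  have "fock_ray n = (\<lambda>c. c *\<^sub>C fock n) ` sphere 0 1" by (auto simp: fock_ray_def image_iff)
  moreover have "bounded_linear (\<lambda>c. c *\<^sub>C fock n)"
    by (rule bounded_linear_intro[of _ 1])
      (auto intro!: ell2_eqI simp: coord_simps norm_scaleC scaleR_conv_of_real algebra_simps)
  then have "continuous_on (sphere 0 1) (\<lambda>c. c *\<^sub>C fock n)" by (rule linear_continuous_on)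
  ultimately show ?thesis by (simp add: compact_continuous_image)
qed

text \<open>A continuous function on the noncompact sphere need not be uniformly continuous; a
  compact set of rays provides the uniformity for comparing a state with a nearby point of a
  ray.\<close>

lemma uniform_near_compact:
  fixes g :: "'a::metric_space \<Rightarrow> real"
  assumes g: "continuous_on S g" and K: "compact K" "K \<subseteq> S" and e: "e > 0"
  shows "\<exists>\<rho>>0. \<forall>y\<in>K. \<forall>x\<in>S. dist x y < \<rho> \<longrightarrow> \<bar>g x - g y\<bar> < e"
proof (rule ccontr)
  assume "\<not> ?thesis"
  then have "\<forall>j. \<exists>y x. y \<in> K \<and> x \<in> S \<and> dist x y < 1 / real (Suc j) \<and> e \<le> \<bar>g x - g y\<bar>"
    by (meson not_le of_nat_0_less_iff zero_less_Suc zero_less_divide_1_iff)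
  then obtain y x where y: "\<And>j. y j \<in> K" and x: "\<And>j. x j \<in> S"
    and d: "\<And>j. dist (x j) (y j) < 1 / real (Suc j)" and ge: "\<And>j. e \<le> \<bar>g (x j) - g (y j)\<bar>" by metis
  obtain l s where l: "l \<in> K" "strict_mono (s :: nat \<Rightarrow> nat)" "(y \<circ> s) \<longlonglongrightarrow> l"
    using K(1) y unfolding compact_def by metis
  have "(\<lambda>j. dist (x j) (y j)) \<longlonglongrightarrow> 0"
    by (rule tendsto_sandwich[OF _ _ tendsto_const LIMSEQ_Suc[OF lim_1_over_n]])
      (use d less_imp_le in \<open>auto intro!: always_eventually simp del: of_nat_Suc\<close>)
  from LIMSEQ_subseq_LIMSEQ[OF this l(2)] have xy: "(\<lambda>j. dist (x (s j)) (y (s j))) \<longlonglongrightarrow> 0"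
    unfolding o_def .
  then have xl: "(\<lambda>j. x (s j)) \<longlonglongrightarrow> l"
  proof -
    have "(\<lambda>j. dist (x (s j)) (y (s j)) + dist (y (s j)) l) \<longlonglongrightarrow> 0"
      by (rule tendsto_add_zero[OF xy l(3)[THEN tendsto_dist_iff[THEN iffD1], unfolded o_def]])
    then have "(\<lambda>j. dist (x (s j)) l) \<longlonglongrightarrow> 0"
      by (rule Lim_null_comparison[rotated]) (auto intro!: always_eventually dist_triangle)
    then show ?thesis by (rule tendsto_dist_iff[THEN iffD2])
  qed
  have "(\<lambda>j. g (x (s j))) \<longlonglongrightarrow> g l"
    by (rule continuous_on_tendsto_compose[OF g xl]) (use x l K in auto)
  moreover have "(\<lambda>j. g (y (s j))) \<longlonglongrightarrow> g l"
    by (rule continuous_on_tendsto_compose[OF g]) (use y l K in \<open>auto simp: o_def subset_iff\<close>)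
  ultimately have "(\<lambda>j. \<bar>g (x (s j)) - g (y (s j))\<bar>) \<longlonglongrightarrow> \<bar>g l - g l\<bar>"
    by (intro tendsto_intros)
  then have "e \<le> \<bar>g l - g l\<bar>" by (rule tendsto_lowerbound) (use ge in auto)
  then show False using e by simp
qed

section \<open>Weak convergence to the Fock states\<close>

text \<open>At most one level of a unit vector has population above 1/2. The second alternative
  ensures that the minimum exists, with value 0 if no level dominates.\<close>

definition dominant :: "ell2 \<Rightarrow> nat" where
  "dominant x = (LEAST n. 1 / 2 < population x n \<or> (\<forall>m. population x m \<le> 1 / 2))"

lemma dominant_eqI:
  assumes x: "norm x = 1" and n: "1 / 2 < population x n"
  shows "dominant x = n"
  unfolding dominant_def
proof (rule Least_equality)
  fix m assume "1 / 2 < population x m \<or> (\<forall>m. population x m \<le> 1 / 2)"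
  then have m: "1 / 2 < population x m" using n by (meson not_le)
  have "m = n"
  proof (rule ccontr)
    assume "m \<noteq> n"
    then show False using sum_population_le[OF x, of "{m, n}"] m n by simp
  qed
  then show "n \<le> m" by simp
qed (use n in simp)

lemma dominant_le:
  assumes x: "norm x = 1" and t: "tail N x < 1 / 2"
  shows "dominant x \<le> N"
proof (cases "\<exists>n. 1 / 2 < population x n")
  case True
  then obtain n where n: "1 / 2 < population x n" by blast
  then have "n \<le> N" using population_le_tail[OF x, of N n] t by (metis le_less_trans less_asym not_le)
  then show ?thesis using dominant_eqI[OF x n] by simp
next
  case False
  then have "dominant x \<le> 0"
    unfolding dominant_def by (intro Least_le) (auto simp: not_less)
  then show ?thesis by simp
qed

text \<open>A choice of argument in [0, 2 \<pi>], expressed by \<open>arccos\<close> so that it is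
  Borel measurable; the clipping to [-1, 1] makes the function of the quotient continuous on the
  whole line.\<close>

definition arg_in_circle :: "complex \<Rightarrow> real" where
  "arg_in_circle z = (let t = arccos (max (-1) (min 1 (Re z / cmod z))) in if 0 \<le> Im z then t else 2 * pi - t)"

lemma arg_in_circle_bounds: "0 \<le> arg_in_circle z" "arg_in_circle z \<le> 2 * pi"
proof -
  have "0 \<le> arccos (max (-1) (min 1 (Re z / cmod z)))" "arccos (max (-1) (min 1 (Re z / cmod z))) \<le> pi"
    by (auto intro!: arccos_lbound arccos_ubound)
  then show "0 \<le> arg_in_circle z" "arg_in_circle z \<le> 2 * pi" by (auto simp: arg_in_circle_def Let_def)
qed

lemma cis_arg_in_circle:
  assumes "z \<noteq> 0"
  shows "cis (arg_in_circle z) = z / cmod z"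
proof -
  define c where "c = Re z / cmod z"
  have r: "cmod z > 0" using assms by simp
  have "\<bar>c\<bar> \<le> 1" using abs_Re_le_cmod[of z] r by (simp add: c_def)
  then have cb: "-1 \<le> c" "c \<le> 1" by auto
  then have clip: "max (-1) (min 1 (Re z / cmod z)) = c" by (simp add: c_def)
  have "1 - c\<^sup>2 = ((cmod z)\<^sup>2 - (Re z)\<^sup>2) / (cmod z)\<^sup>2"
    using r by (simp add: c_def power_divide diff_divide_distrib)
  also have "(cmod z)\<^sup>2 - (Re z)\<^sup>2 = (Im z)\<^sup>2" by (simp add: cmod_power2)
  finally have "1 - c\<^sup>2 = (Im z / cmod z)\<^sup>2" by (simp add: power_divide)
  then have s: "sin (arccos c) = \<bar>Im z\<bar> / cmod z"
    using sin_arccos[OF cb] by (simp add: abs_divide)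
  show ?thesis
  proof (cases "0 \<le> Im z")
    case True
    then show ?thesis
      using cb s by (simp add: arg_in_circle_def Let_def clip complex_eq_iff Re_divide_of_real Im_divide_of_real) (simp add: c_def)
  next
    case False
    then have "cis (arg_in_circle z) = cnj (cis (arccos c))"
      by (simp add: arg_in_circle_def Let_def clip complex_eq_iff cos_diff sin_diff)
    then show ?thesis
      using False cb s by (simp add: complex_eq_iff Re_divide_of_real Im_divide_of_real) (simp add: c_def)
  qed
qed

lemma measurable_arg_in_circle: "arg_in_circle \<in> borel_measurable borel"
proof -
  have "continuous_on UNIV (\<lambda>t::real. arccos (max (-1) (min 1 t)))"
    by (intro continuous_on_arccos continuous_intros) auto
  then have [measurable]: "(\<lambda>t::real. arccos (max (-1) (min 1 t))) \<in> borel_measurable borel"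
    by (rule borel_measurable_continuous_onI)
  have [measurable]: "(\<lambda>z. Re z / cmod z) \<in> borel_measurable borel" by measurable
  have [measurable]: "(\<lambda>z. arccos (max (-1) (min 1 (Re z / cmod z)))) \<in> borel_measurable borel"
    by (rule measurable_compose[of "\<lambda>z. Re z / cmod z" borel borel]) measurable
  show ?thesis unfolding arg_in_circle_def[abs_def] Let_def by measurable
qed

text \<open>The disjoint union of the circles \<open>fock_ray n\<close> is laid out on the real line: the circle number
  \<open>n\<close> becomes the interval \<open>[10 n + 1, 10 n + 1 + 2 \<pi>]\<close>. The gaps keep the discontinuities of
  \<open>decode\<close>, the multiples of 10, away from all codes.\<close>

definition encode :: "ell2 \<Rightarrow> real" where
  "encode x = 10 * real (dominant x) + 1 + arg_in_circle (coord x (dominant x))"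

definition decode :: "real \<Rightarrow> ell2" where
  "decode y = cis (y - 1 - 10 * real (nat \<lfloor>y / 10\<rfloor>)) *\<^sub>C fock (nat \<lfloor>y / 10\<rfloor>)"

lemma encode_bounds: "10 * real (dominant x) + 1 \<le> encode x" "encode x \<le> 10 * real (dominant x) + 9"
  using arg_in_circle_bounds[of "coord x (dominant x)"] pi_less_4 unfolding encode_def by auto

lemma norm_decode: "norm (decode y) = 1"
  by (simp add: decode_def norm_scaleC)

lemma decode_encode: "decode (encode x) = cis (arg_in_circle (coord x (dominant x))) *\<^sub>C fock (dominant x)"
proof -
  have "\<lfloor>encode x / 10\<rfloor> = int (dominant x)"
    using encode_bounds[of x] by (intro floor_unique) auto
  then show ?thesis by (simp add: decode_def encode_def)
qed

text \<open>On states with a dominant level, \<open>decode\<close> after \<open>encode\<close> is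
  the projection to the ray of that level with the phase kept.\<close>

lemma decode_encode_near:
  assumes x: "norm x = 1" and n: "1 / 2 < population x n"
  shows "decode (encode x) \<in> fock_ray n" "(norm (x - decode (encode x)))\<^sup>2 \<le> 2 * (1 - population x n)"
proof -
  have nz: "coord x n \<noteq> 0" using n by (auto simp: population_def)
  have d: "decode (encode x) = (coord x n / cmod (coord x n)) *\<^sub>C fock n"
    unfolding decode_encode dominant_eqI[OF x n] cis_arg_in_circle[OF nz] ..
  show "decode (encode x) \<in> fock_ray n"
    unfolding d fock_ray_def using nz by (auto intro!: exI simp: norm_divide)
  show "(norm (x - decode (encode x)))\<^sup>2 \<le> 2 * (1 - population x n)"
    unfolding d by (rule near_phase_fock[OF x nz])
qed

lemma measurable_encode: "encode \<in> borel_measurable borel"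
proof -
  note [measurable] = measurable_population measurable_arg_in_circle
  have [measurable]: "dominant \<in> measurable borel (count_space UNIV)"
    unfolding dominant_def[abs_def] by measurable
  have [measurable]: "(\<lambda>x. coord x n) \<in> borel_measurable borel" for n
    by (intro borel_measurable_continuous_onI continuous_on_coord continuous_on_id)
  have "(\<lambda>x. coord x (dominant x)) \<in> borel_measurable borel"
    by (rule measurable_compose_countable[where f = "\<lambda>n x. coord x n" and g = dominant]) measurable
  from measurable_compose[OF this measurable_arg_in_circle]
  have [measurable]: "(\<lambda>x. arg_in_circle (coord x (dominant x))) \<in> borel_measurable borel" .
  show ?thesis unfolding encode_def[abs_def] by measurable
qed

lemma continuous_phase_fock: "continuous_on A (\<lambda>y. cis (y - t) *\<^sub>C fock n)"
proof -
  have bl: "bounded_linear (\<lambda>c. c *\<^sub>C fock n)"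
    by (rule bounded_linear_intro[of _ 1])
      (auto intro!: ell2_eqI simp: coord_simps norm_scaleC scaleR_conv_of_real algebra_simps)
  show ?thesis
    by (rule bounded_linear.continuous_on[OF bl]) (intro continuous_intros)
qed

lemma measurable_decode: "decode \<in> measurable borel sphere_borel"
proof (rule measurable_into_sphere)
  have "(\<lambda>y. cis (y - (1 + 10 * real n)) *\<^sub>C fock n) \<in> borel_measurable borel" for n
    by (intro borel_measurable_continuous_onI continuous_phase_fock)
  then have "(\<lambda>y. cis (y - (1 + 10 * real (nat \<lfloor>y / 10\<rfloor>))) *\<^sub>C fock (nat \<lfloor>y / 10\<rfloor>)) \<in> borel_measurable borel"
    by (rule measurable_compose_countable[where f = "\<lambda>n y. cis (y - (1 + 10 * real n)) *\<^sub>C fock n" and g = "\<lambda>y. nat \<lfloor>y / 10\<rfloor>"]) measurable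
  then show "decode \<in> borel_measurable borel"
    by (simp add: decode_def[abs_def] algebra_simps)
qed (simp add: norm_decode)

lemma isCont_decode:
  assumes g: "continuous_on unit_sphere g" and y: "y \<notin> range (\<lambda>k::int. 10 * real_of_int k)"
  shows "isCont (\<lambda>y. g (decode y) :: real) y"
proof -
  define k where "k = \<lfloor>y / 10\<rfloor>"
  let ?U = "{10 * real_of_int k <..< 10 * real_of_int k + 10}"
  have "real_of_int k \<le> y / 10" "y / 10 < real_of_int k + 1" unfolding k_def by linarith+
  moreover have "y \<noteq> 10 * real_of_int k" using y by auto
  ultimately have yU: "y \<in> ?U" by auto
  have fl: "\<lfloor>z / 10\<rfloor> = k" if "z \<in> ?U" for z
    using that by (intro floor_unique) auto
  have "continuous_on ?U (\<lambda>z. g (cis (z - (1 + 10 * real (nat k))) *\<^sub>C fock (nat k)))"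
    by (rule continuous_on_compose2[OF g continuous_phase_fock]) (auto simp: norm_scaleC)
  then have "continuous_on ?U (\<lambda>z. g (decode z))"
    by (rule continuous_on_cong[THEN iffD1, rotated -1]) (auto simp: decode_def fl algebra_simps)
  then show ?thesis using yU by (simp add: continuous_on_eq_continuous_at)
qed

lemma integrable_bounded_prob:
  fixes g :: "ell2 \<Rightarrow> real"
  assumes "\<mu> \<in> prob_measures" "g \<in> borel_measurable sphere_borel" "\<And>x. norm x = 1 \<Longrightarrow> \<bar>g x\<bar> \<le> B"
  shows "integrable \<mu> g"
proof -
  interpret prob_space \<mu> by (rule prob_measuresD[OF assms(1)])
  show ?thesis
    by (rule integrable_const_bound[where B = B])
      (use assms(2,3) in \<open>auto simp: prob_measuresD(3)[OF assms(1)] prob_measuresD(4)[OF assms(1)]\<close>)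
qed

lemma continuous_measurable_sphere:
  "continuous_on unit_sphere g \<Longrightarrow> g \<in> borel_measurable sphere_borel"
  for g :: "ell2 \<Rightarrow> real"
  unfolding sphere_borel_def by (rule borel_measurable_continuous_on_restrict)

lemma integral_mono_sphere:
  fixes f g :: "ell2 \<Rightarrow> real"
  assumes "\<mu> \<in> prob_measures" "integrable \<mu> f" "integrable \<mu> g" "\<And>x. norm x = 1 \<Longrightarrow> f x \<le> g x"
  shows "integral\<^sup>L \<mu> f \<le> integral\<^sup>L \<mu> g"
  by (rule integral_mono[OF assms(2,3)]) (simp add: prob_measuresD(3)[OF assms(1)] assms(4))

lemma integrable_tail: "\<mu> \<in> prob_measures \<Longrightarrow> integrable \<mu> (tail N)"
proof (rule integrable_bounded_prob[where B = 1])
  show "\<bar>tail N x\<bar> \<le> 1" if "norm x = 1" for x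
    using tail_nonneg[OF that] tail_le_1[of N x] by simp
qed (auto intro: continuous_measurable_sphere continuous_tail)

lemma cos_variance_le_1: "norm x = 1 \<Longrightarrow> cos_variance \<theta> \<phi> x \<le> 1"
proof -
  assume x: "norm x = 1"
  have "norm (meas_op \<theta> \<phi> Ground (meas_op \<theta> \<phi> Ground x)) \<le> 1"
    using norm_meas_op_le[of \<theta> \<phi> Ground] x by (metis order_trans)
  then have "(norm (meas_op \<theta> \<phi> Ground (meas_op \<theta> \<phi> Ground x)))\<^sup>2 \<le> 1" by (simp add: power_le_one)
  then show ?thesis unfolding cos_variance_def using zero_le_power2[of "ground_prob \<theta> \<phi> x"] by linarith
qed

lemma integrable_cos_variance: "\<mu> \<in> prob_measures \<Longrightarrow> integrable \<mu> (\<lambda>x. (cos_variance \<theta> \<phi> x)\<^sup>2)"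
  by (rule integrable_bounded_prob[where B = 1])
    (auto intro!: continuous_measurable_sphere continuous_intros continuous_cos_variance power_le_one
      cos_variance_nonneg cos_variance_le_1)

text \<open>What the compactness argument uses about the laws: the tails keep the levels bounded
  uniformly in k, and the vanishing variance drives the mass to the rays.\<close>

locale concentrating =
  fixes X :: "nat \<Rightarrow> ell2 measure" and \<theta> \<phi> :: real
  assumes dist: "\<And>n m. n \<noteq> m \<Longrightarrow> (cos (\<theta> + real n * \<phi>))\<^sup>2 \<noteq> (cos (\<theta> + real m * \<phi>))\<^sup>2"
    and X: "\<And>k. X k \<in> prob_measures"
    and tails: "\<And>e. e > 0 \<Longrightarrow> \<exists>N. \<forall>k. (\<integral>x. tail N x \<partial>X k) \<le> e"
    and variance: "(\<lambda>k. \<integral>x. (cos_variance \<theta> \<phi> x)\<^sup>2 \<partial>X k) \<longlonglongrightarrow> 0"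
begin

text \<open>In the limit, a test function may be evaluated at the decoded code instead of the state.
  The two points are close except for large mass above N0, large mass above N or large variance;
  each exception is paid for, as in Markov's inequality, by a term of the pointwise majorant
  \<open>?r\<close>.\<close>

lemma near_rays:
  fixes g :: "ell2 \<Rightarrow> real"
  assumes g: "continuous_on unit_sphere g" and B: "\<And>x. norm x = 1 \<Longrightarrow> \<bar>g x\<bar> \<le> B"
  shows "(\<lambda>k. \<integral>x. \<bar>g x - g (decode (encode x))\<bar> \<partial>X k) \<longlonglongrightarrow> 0"
proof (rule LIMSEQ_I)
  fix e :: real assume e: "0 < e"
  have "\<bar>g (fock 0)\<bar> \<le> B" by (rule B) simp
  then have B0: "B \<ge> 0" by (rule order_trans[OF abs_ge_zero])
  \<comment> \<open>2 B bounds the oscillation of g; the 1 keeps the divisors below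
    positive.\<close>
  let ?B = "2 * B + 1"
  have gm: "g \<in> borel_measurable sphere_borel" by (rule continuous_measurable_sphere[OF g])
  have de: "(\<lambda>x. decode (encode x)) \<in> measurable sphere_borel sphere_borel"
    by (rule measurable_compose[OF measurable_sphere_borelI[OF measurable_encode] measurable_decode])
  let ?h = "\<lambda>x. \<bar>g x - g (decode (encode x))\<bar>"
  have hm: "?h \<in> borel_measurable sphere_borel"
    using gm measurable_compose[OF de gm] by measurable
  have hB: "?h x \<le> ?B" if "norm x = 1" for x
    using B[OF that] B[OF norm_decode[of "encode x"]] by linarith
  have hint: "integrable (X k) ?h" for k
    by (rule integrable_bounded_prob[OF X hm, of ?B]) (use hB in simp)
  \<comment> \<open>N0 determines the compact set of rays and with it \<rho> and \<eta>. The cutoff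
    N depends on \<eta>, so it has to be a second one.\<close>
  obtain N0 where N0: "\<And>k. (\<integral>x. tail N0 x \<partial>X k) \<le> e / (32 * ?B)"
    using tails[of "e / (32 * ?B)"] e B0 by auto
  define K where "K = (\<Union>n\<le>N0. fock_ray n)"
  have K: "compact K" "K \<subseteq> unit_sphere"
    unfolding K_def by (intro compact_UN compact_fock_ray finite_atMost) (auto simp: fock_ray_iff)
  obtain \<rho> where \<rho>: "\<rho> > 0" "\<And>y x. y \<in> K \<Longrightarrow> norm x = 1 \<Longrightarrow> dist x y < \<rho> \<Longrightarrow> \<bar>g x - g y\<bar> < e / 4"
    using uniform_near_compact[OF g K, of "e / 4"] e by auto
  define \<eta> where "\<eta> = min (1 / 4) (\<rho>\<^sup>2 / 4)"
  have \<eta>: "\<eta> > 0" "\<eta> \<le> 1 / 4" "2 * \<eta> < \<rho>\<^sup>2" using \<rho>(1) by (auto simp: \<eta>_def min_def)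
  obtain N where N: "\<And>k. (\<integral>x. tail N x \<partial>X k) \<le> e * \<eta> / (16 * ?B)"
    using tails[of "e * \<eta> / (16 * ?B)"] e B0 \<eta> by auto
  obtain w where w: "w > 0" "\<And>x. norm x = 1 \<Longrightarrow> (cos_variance \<theta> \<phi> x)\<^sup>2 < w \<Longrightarrow> tail N x < \<eta> / 2 \<Longrightarrow> \<exists>n\<le>N. 1 - \<eta> < population x n"
    using small_variance_near_fock[OF dist \<eta>(1), of N] by blast
  let ?v = "\<lambda>x. (cos_variance \<theta> \<phi> x)\<^sup>2"
  let ?r = "\<lambda>x. e / 4 + (4 * ?B * tail N0 x + (2 * ?B / \<eta> * tail N x + ?B / w * ?v x))"
  have point: "?h x \<le> ?r x" if x: "norm x = 1" for x
  proof -
    have nn: "0 \<le> 4 * ?B * tail N0 x" "0 \<le> 2 * ?B / \<eta> * tail N x" "0 \<le> ?B / w * ?v x"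
      using tail_nonneg[OF x] B0 \<eta> w by auto
    consider "tail N0 x \<ge> 1 / 4" | "tail N x \<ge> \<eta> / 2" | "?v x \<ge> w"
      | "tail N0 x < 1 / 4" "tail N x < \<eta> / 2" "?v x < w" by linarith
    then show ?thesis
    proof cases
      case 1
      then have "4 * ?B * (1 / 4) \<le> 4 * ?B * tail N0 x" using B0 by (intro mult_left_mono) auto
      then have "?B \<le> 4 * ?B * tail N0 x" by simp
      then show ?thesis using hB[OF x] nn e by linarith
    next
      case 2
      then have "2 * ?B / \<eta> * (\<eta> / 2) \<le> 2 * ?B / \<eta> * tail N x" using B0 \<eta> by (intro mult_left_mono) auto
      then have "?B \<le> 2 * ?B / \<eta> * tail N x" using \<eta> by simp
      then show ?thesis using hB[OF x] nn e by linarith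
    next
      case 3
      then have "?B / w * w \<le> ?B / w * ?v x" using B0 w by (intro mult_left_mono) auto
      then have "?B \<le> ?B / w * ?v x" using w by simp
      then show ?thesis using hB[OF x] nn e by linarith
    next
      case 4
      then obtain n where n: "1 - \<eta> < population x n" using w(2)[OF x] by blast
      then have half: "1 / 2 < population x n" using \<eta> by linarith
      have "n \<le> N0"
      proof (rule ccontr)
        assume "\<not> n \<le> N0"
        then have "population x n \<le> tail N0 x" by (intro population_le_tail[OF x]) simp
        then show False using 4(1) half by linarith
      qed
      then have inK: "decode (encode x) \<in> K" using decode_encode_near(1)[OF x half] by (auto simp: K_def)
      have "(dist x (decode (encode x)))\<^sup>2 \<le> 2 * (1 - population x n)"
        using decode_encode_near(2)[OF x half] by (simp add: dist_norm)
      also have "\<dots> < \<rho>\<^sup>2" using n \<eta> by simp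
      finally have "dist x (decode (encode x)) < \<rho>" by (rule power2_less_imp_less) (use \<rho> in simp)
      then have "?h x < e / 4" using \<rho>(2)[OF inK x] by simp
      then show ?thesis using nn by linarith
    qed
  qed
  obtain k0 where k0: "\<And>k. k \<ge> k0 \<Longrightarrow> norm ((\<integral>x. ?v x \<partial>X k) - 0) < e * w / (8 * ?B)"
    using LIMSEQ_D[OF variance, of "e * w / (8 * ?B)"] e w B0 by auto
  show "\<exists>k0. \<forall>k\<ge>k0. norm ((\<integral>x. ?h x \<partial>X k) - 0) < e"
  proof (intro exI allI impI)
    fix k assume k: "k \<ge> k0"
    interpret prob_space "X k" by (rule prob_measuresD[OF X])
    note ints = integrable_tail[OF X, of k] integrable_cos_variance[OF X, of k \<theta> \<phi>]
    have rint: "integrable (X k) ?r"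
      by (intro Bochner_Integration.integrable_add integrable_mult_right ints integrable_const)
    have "(\<integral>x. ?h x \<partial>X k) \<le> (\<integral>x. ?r x \<partial>X k)"
      by (rule integral_mono_sphere[OF X hint rint]) (rule point)
    also have "\<dots> = e / 4 + (4 * ?B * (\<integral>x. tail N0 x \<partial>X k) + (2 * ?B / \<eta> * (\<integral>x. tail N x \<partial>X k) + ?B / w * (\<integral>x. ?v x \<partial>X k)))"
      by (simp add: ints prob_space)
    also have "\<dots> \<le> e / 4 + (4 * ?B * (e / (32 * ?B)) + (2 * ?B / \<eta> * (e * \<eta> / (16 * ?B)) + ?B / w * (e * w / (8 * ?B))))"
      using N0[of k] N[of k] k0[OF k] B0 \<eta> w by (intro add_mono mult_left_mono) auto
    also have "\<dots> = e / 4 + (e / 8 + (e / 8 + e / 8))"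
    proof -
      have "4 * ?B * (e / (32 * ?B)) = e / 8" "2 * ?B / \<eta> * (e * \<eta> / (16 * ?B)) = e / 8" "?B / w * (e * w / (8 * ?B)) = e / 8"
        using B0 \<eta> w by (auto simp: divide_simps)
      then show ?thesis by (simp only:)
    qed
    also have "\<dots> < e" using e by simp
    finally have "(\<integral>x. ?h x \<partial>X k) < e" .
    moreover have "0 \<le> (\<integral>x. ?h x \<partial>X k)" by simp
    ultimately show "norm ((\<integral>x. ?h x \<partial>X k) - 0) < e" by simp
  qed
qed

lemma tight_encode: "tight (\<lambda>k. distr (X k) borel encode)"
proof -
  have em: "encode \<in> measurable (X k) borel" for k
    unfolding prob_measuresD(4)[OF X] by (rule measurable_sphere_borelI[OF measurable_encode])
  have "\<exists>a b. a < b \<and> (\<forall>k. measure (distr (X k) borel encode) {a<..b} > 1 - e)" if e: "e > 0" for e :: real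
  proof -
    obtain N where N: "\<And>k. (\<integral>x. tail N x \<partial>X k) \<le> e / 4" using tails[of "e / 4"] e by auto
    have "measure (distr (X k) borel encode) {0<..10 * real N + 9} > 1 - e" for k
    proof -
      interpret prob_space "X k" by (rule prob_measuresD[OF X])
      let ?A = "encode -` {0<..10 * real N + 9} \<inter> space (X k)"
      have A: "?A \<in> sets (X k)" using em by (rule measurable_sets) simp
      have "1 - 2 * (\<integral>x. tail N x \<partial>X k) = (\<integral>x. 1 - 2 * tail N x \<partial>X k)"
        by (simp add: integrable_tail[OF X] prob_space)
      \<comment> \<open>A tail below 1/2 forces the dominant level, and with it the code, to be
        bounded in terms of N.\<close>
      also have "\<dots> \<le> (\<integral>x. indicator ?A x \<partial>X k)"
      proof (rule integral_mono_sphere[OF X])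
        fix x :: ell2 assume x: "norm x = 1"
        have "0 < encode x" using encode_bounds(1)[of x] by linarith
        moreover have "encode x \<le> 10 * real N + 9" if "tail N x < 1 / 2"
          using encode_bounds(2)[of x] dominant_le[OF x that] by simp
        ultimately show "1 - 2 * tail N x \<le> indicator ?A x"
          using x tail_nonneg[OF x, of N] by (cases "tail N x < 1 / 2") (auto simp: indicator_def prob_measuresD(3)[OF X])
      qed (use A in \<open>auto intro!: integrable_tail[OF X] integrable_real_indicator simp: emeasure_eq_measure\<close>)
      also have "\<dots> = measure (X k) ?A" using A by simp
      also have "\<dots> = measure (distr (X k) borel encode) {0<..10 * real N + 9}"
        by (rule measure_distr[symmetric, OF em]) simp
      finally show ?thesis using N[of k] e by linarith
    qed
    then show ?thesis by (intro exI[of _ 0] exI[of _ "10 * real N + 9"]) auto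
  qed
  moreover have "real_distribution (distr (X k) borel encode)" for k
    using prob_space.prob_space_distr[OF prob_measuresD(1)[OF X] em]
    by (simp add: real_distribution_def real_distribution_axioms_def)
  ultimately show ?thesis by (simp add: tight_def)
qed

lemma decode_weak_limit:
  assumes s: "strict_mono s" and M: "real_distribution M"
    and w: "weak_conv_m (\<lambda>k. distr (X (s k)) borel encode) M"
  shows "weak_star_conv (X \<circ> s) (distr M sphere_borel decode)"
  unfolding weak_star_conv_def
proof (intro allI impI, elim conjE)
  fix g :: "ell2 \<Rightarrow> real"
  assume g: "continuous_on unit_sphere g" and "bounded (g ` unit_sphere)"
  then obtain B where "\<forall>y\<in>g ` unit_sphere. norm y \<le> B" unfolding bounded_iff by blast
  then have B: "\<bar>g x\<bar> \<le> B" if "norm x = 1" for x using that by simp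
  interpret M: real_distribution M by fact
  let ?\<nu> = "\<lambda>k. distr (X (s k)) borel encode"
  have em: "encode \<in> measurable (X k) borel" for k
    unfolding prob_measuresD(4)[OF X] by (rule measurable_sphere_borelI[OF measurable_encode])
  have \<nu>: "real_distribution (?\<nu> k)" for k using tight_encode by (simp add: tight_def)
  have gm: "g \<in> borel_measurable sphere_borel" by (rule continuous_measurable_sphere[OF g])
  have gd: "(\<lambda>y. g (decode y)) \<in> borel_measurable borel" by (rule measurable_compose[OF measurable_decode gm])
  let ?S = "range (\<lambda>k::int. 10 * real_of_int k)"
  have null: "M ?S = 0"
  proof -
    \<comment> \<open>A continuous bump around the multiples of 10. Codes keep distance at least 1
      from them, so its integral is 0 along the sequence and hence in the limit; thus M gives no
      mass to the possible discontinuities of \<open>decode\<close>.\<close>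
    let ?h = "\<lambda>y. max 0 (1 - infdist y ?S)"
    have hc: "isCont ?h y" for y
      by (intro continuous_intros continuous_infdist)
    have hz: "?h (encode x) = 0" for x
    proof -
      have "1 \<le> infdist (encode x) ?S"
      proof -
        have "1 \<le> dist (encode x) (10 * real_of_int k)" for k
        proof (cases "k \<le> int (dominant x)")
          case True
          then have "10 * real_of_int k \<le> 10 * real (dominant x)" by simp
          then show ?thesis using encode_bounds[of x] by (simp add: dist_real_def)
        next
          case False
          then have "real_of_int (int (dominant x) + 1) \<le> real_of_int k" by (intro of_int_le_iff[THEN iffD2]) simp
          then have "10 * real (dominant x) + 10 \<le> 10 * real_of_int k" by simp
          then show ?thesis using encode_bounds[of x] by (simp add: dist_real_def)
        qed
        then show ?thesis unfolding infdist_def by (auto intro!: cINF_greatest)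
      qed
      then show ?thesis by simp
    qed
    have hm: "?h \<in> borel_measurable borel"
      by (intro borel_measurable_continuous_onI continuous_at_imp_continuous_on ballI hc)
    have hb: "norm (?h y) \<le> 1" for y using infdist_nonneg[of y ?S] by auto
    have "(\<lambda>k. integral\<^sup>L (?\<nu> k) ?h) \<longlonglongrightarrow> integral\<^sup>L M ?h"
      by (rule weak_conv_imp_bdd_ae_continuous_conv[OF \<nu> M w _ hb hm]) (simp add: hc)
    moreover have "integral\<^sup>L (?\<nu> k) ?h = 0" for k
      by (subst integral_distr[OF em hm]) (simp only: hz, simp)
    ultimately have "integral\<^sup>L M ?h = 0" by (simp add: LIMSEQ_const_iff)
    moreover have S: "?S \<in> sets M"
    proof -
      have "countable ?S" by simp
      then show ?thesis unfolding M.events_eq_borel by (rule sets.countable[rotated]) auto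
    qed
    moreover have "integral\<^sup>L M (indicator ?S) \<le> integral\<^sup>L M ?h"
    proof (rule integral_mono)
      show "integrable M (indicator ?S :: real \<Rightarrow> real)" using S by (simp add: M.emeasure_eq_measure)
      show "integrable M ?h"
        by (rule M.integrable_const_bound[where B = 1]) (use hb hm in auto)
      show "indicator ?S y \<le> ?h y" for y by (auto simp: indicator_def)
    qed
    ultimately have "measure M ?S \<le> 0" by simp
    then show ?thesis by (simp add: M.emeasure_eq_measure measure_le_0_iff)
  qed
  have disc: "M {y. \<not> isCont (\<lambda>y. g (decode y)) y} = 0"
  proof -
    have sub: "{y. \<not> isCont (\<lambda>y. g (decode y)) y} \<subseteq> ?S" using isCont_decode[OF g] by auto
    have "countable ?S" by simp
    then have "countable {y. \<not> isCont (\<lambda>y. g (decode y)) y}" using sub countable_subset by blast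
    have S: "?S \<in> sets M" unfolding M.events_eq_borel by (rule sets.countable) auto
    show ?thesis using emeasure_mono[OF sub S] null by simp
  qed
  have 1: "(\<lambda>k. \<integral>y. g (decode y) \<partial>?\<nu> k) \<longlonglongrightarrow> (\<integral>y. g (decode y) \<partial>M)"
    by (rule weak_conv_imp_bdd_ae_continuous_conv[OF \<nu> M w disc _ gd, of B]) (use B norm_decode in auto)
  have enc: "(\<integral>y. g (decode y) \<partial>?\<nu> k) = (\<integral>x. g (decode (encode x)) \<partial>X (s k))" for k
    by (rule integral_distr[OF em gd])
  have ged: "(\<lambda>x. g (decode (encode x))) \<in> borel_measurable sphere_borel"
    by (rule measurable_compose[OF measurable_sphere_borelI[OF measurable_encode] gd])
  have i1: "integrable (X k) g" for k by (rule integrable_bounded_prob[OF X gm B])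
  have i2: "integrable (X k) (\<lambda>x. g (decode (encode x)))" for k
    by (rule integrable_bounded_prob[OF X ged]) (rule B[OF norm_decode])
  have "\<bar>(\<integral>x. g x \<partial>X k) - (\<integral>x. g (decode (encode x)) \<partial>X k)\<bar> \<le> (\<integral>x. \<bar>g x - g (decode (encode x))\<bar> \<partial>X k)" for k
    using integral_abs_bound[of "X k" "\<lambda>x. g x - g (decode (encode x))"] by (simp add: i1 i2)
  then have "(\<lambda>k. (\<integral>x. g x \<partial>X k) - (\<integral>x. g (decode (encode x)) \<partial>X k)) \<longlonglongrightarrow> 0"
    by (intro Lim_null_comparison[OF always_eventually near_rays[OF g B]]) auto
  from LIMSEQ_subseq_LIMSEQ[OF this s]
  have "(\<lambda>k. (\<integral>x. g x \<partial>X (s k)) - (\<integral>x. g (decode (encode x)) \<partial>X (s k))) \<longlonglongrightarrow> 0" by (simp add: o_def)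
  from tendsto_add[OF this 1[unfolded enc]]
  have "(\<lambda>k. \<integral>x. g x \<partial>X (s k)) \<longlonglongrightarrow> (\<integral>y. g (decode y) \<partial>M)" by simp
  moreover have "(\<integral>y. g (decode y) \<partial>M) = (\<integral>x. g x \<partial>distr M sphere_borel decode)"
  proof (rule integral_distr[symmetric])
    show "decode \<in> measurable M sphere_borel" using measurable_decode by (simp cong: measurable_cong_sets)
  qed (rule gm)
  ultimately show "(\<lambda>n. \<integral>x. g x \<partial>(X \<circ> s) n) \<longlonglongrightarrow> (\<integral>x. g x \<partial>distr M sphere_borel decode)"
    by (simp add: o_def)
qed

lemma converges: "converges_to_limit_set X"
  unfolding converges_to_limit_set_def
proof (intro allI impI)
  fix r :: "nat \<Rightarrow> nat" assume r: "strict_mono r"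
  obtain s M where s: "strict_mono s" and M: "real_distribution M"
    and w: "weak_conv_m ((\<lambda>k. distr (X k) borel encode) \<circ> r \<circ> s) M"
    using tight_imp_convergent_subsubsequence[OF tight_encode r] by blast
  have rs: "strict_mono (r \<circ> s)" using r s by (rule strict_mono_o)
  let ?\<mu> = "distr M sphere_borel decode"
  have conv: "weak_star_conv (X \<circ> (r \<circ> s)) ?\<mu>"
    by (rule decode_weak_limit[OF rs M]) (use w in \<open>simp add: o_def\<close>)
  have "decode \<in> measurable M sphere_borel"
    using measurable_decode real_distribution.events_eq_borel[OF M] by (simp cong: measurable_cong_sets)
  then have "?\<mu> \<in> prob_measures"
    using prob_space.prob_space_distr[of M] M by (simp add: prob_measures_def real_distribution_def)
  then have "?\<mu> \<in> limit_set X" using conv rs by (auto simp: limit_set_def)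
  then show "\<exists>s. strict_mono s \<and> (\<exists>\<mu>\<in>limit_set X. weak_star_conv (X \<circ> r \<circ> s) \<mu>)"
    using s conv by (auto simp: o_assoc)
qed

end

section \<open>The limit measures\<close>

lemma tail_le_energy:
  assumes nb: "nbar \<ge> 2" and N: "nbar \<le> N" and x: "norm x = 1"
  shows "ennreal (sigma nbar N * tail N x) \<le> energy nbar x"
proof -
  have "(\<lambda>n. if n \<in> {..N} then population x n else 0) sums (\<Sum>n\<le>N. population x n)"
    by (rule sums_If_finite_set) simp
  from sums_mult[OF sums_diff[OF population_sums[of x] this], of "sigma nbar N"]
  have s: "(\<lambda>n. sigma nbar N * (population x n - (if n \<in> {..N} then population x n else 0))) sums (sigma nbar N * tail N x)"
    by (simp add: tail_def x)
  then have "ennreal (sigma nbar N * tail N x) = (\<Sum>n. ennreal (sigma nbar N * (population x n - (if n \<in> {..N} then population x n else 0))))"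
    by (intro suminf_ennreal_eq[symmetric]) (auto simp: sigma_nonneg)
  also have "\<dots> \<le> energy nbar x"
    unfolding energy_def
    by (intro suminf_le ennreal_leI) (auto intro!: mult_right_mono sigma_mono[OF nb N] simp: sigma_nonneg)
  finally show ?thesis .
qed

lemma weak_star_limit_integral:
  fixes g :: "ell2 \<Rightarrow> real"
  assumes "weak_star_conv (X \<circ> r) \<mu>" "continuous_on unit_sphere g" "\<And>x. norm x = 1 \<Longrightarrow> \<bar>g x\<bar> \<le> B"
  shows "(\<lambda>k. \<integral>x. g x \<partial>X (r k)) \<longlonglongrightarrow> (\<integral>x. g x \<partial>\<mu>)"
proof -
  have "bounded (g ` unit_sphere)" unfolding bounded_iff by (intro exI[of _ B] ballI) (use assms(3) in auto)
  then show ?thesis using assms(1,2) unfolding weak_star_conv_def by (simp add: o_def)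
qed

text \<open>Turns a decrease of V whose expectations tend to 0 into a statement about almost every
  point of the limit measure.\<close>

lemma weak_star_limit_zero:
  fixes g :: "ell2 \<Rightarrow> real"
  assumes r: "strict_mono r" and w: "weak_star_conv (X \<circ> r) \<mu>" and \<mu>: "\<mu> \<in> prob_measures"
    and g: "continuous_on unit_sphere g" "\<And>x. norm x = 1 \<Longrightarrow> 0 \<le> g x" "\<And>x. norm x = 1 \<Longrightarrow> g x \<le> B"
    and lim: "(\<lambda>k. \<integral>x. g x \<partial>X k) \<longlonglongrightarrow> 0"
  shows "AE x in \<mu>. g x = 0"
proof -
  have B: "\<bar>g x\<bar> \<le> B" if "norm x = 1" for x using g(2,3)[OF that] by simp
  have "(\<lambda>k. \<integral>x. g x \<partial>X (r k)) \<longlonglongrightarrow> (\<integral>x. g x \<partial>\<mu>)"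
    by (rule weak_star_limit_integral[OF w g(1) B])
  moreover have "(\<lambda>k. \<integral>x. g x \<partial>X (r k)) \<longlonglongrightarrow> 0"
    using LIMSEQ_subseq_LIMSEQ[OF lim r] by (simp add: o_def)
  ultimately have "(\<integral>x. g x \<partial>\<mu>) = 0" by (rule LIMSEQ_unique)
  moreover have "AE x in \<mu>. 0 \<le> g x" by (rule AE_I2) (simp add: prob_measuresD(3)[OF \<mu>] g(2))
  moreover have "integrable \<mu> g"
    by (rule integrable_bounded_prob[OF \<mu> continuous_measurable_sphere[OF g(1)] B])
  ultimately show ?thesis by (simp add: integral_nonneg_eq_0_iff_AE)
qed

lemma finite_small_multiple:
  fixes k E :: "nat \<Rightarrow> real"
  assumes "finite A" "\<And>n. n \<in> A \<Longrightarrow> 0 < k n" "\<And>n. n \<in> A \<Longrightarrow> 0 \<le> E n"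
  shows "\<exists>d>0. \<forall>n\<in>A. d * E n \<le> k n"
  using assms
proof (induction A rule: finite_induct)
  case empty
  show ?case by (intro exI[of _ 1]) simp
next
  case (insert a A)
  then obtain d where d: "d > 0" "\<And>n. n \<in> A \<Longrightarrow> d * E n \<le> k n" by auto
  define d' where "d' = min d (k a / (E a + 1))"
  have ka: "0 < k a" "0 \<le> E a" using insert.prems by auto
  have "d' > 0" using d ka by (simp add: d'_def)
  moreover have "d' * E n \<le> k n" if "n \<in> insert a A" for n
  proof (cases "n = a")
    case True
    have "d' * E a \<le> k a / (E a + 1) * (E a + 1)"
      using ka \<open>d' > 0\<close> by (intro mult_mono) (auto simp: d'_def)
    then show ?thesis using True ka by simp
  next
    case False
    then have n: "n \<in> A" using that by simp
    have "d' * E n \<le> d * E n" using insert.prems(2)[of n] n by (intro mult_right_mono) (auto simp: d'_def)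
    then show ?thesis using d(2)[OF n] by linarith
  qed
  ultimately show ?case by blast
qed

theorem theorem3p1:
  fixes \<theta> \<phi> \<epsilon> C :: real and nbar :: nat
  assumes "nbar \<ge> 2"
    and "nondegenerate_eigenvalues (meas_op \<theta> \<phi> Ground)"
    and "nondegenerate_eigenvalues (meas_op \<theta> \<phi> Excited)"
    and "\<epsilon> > 0" and "C > 0"
  shows "\<exists>\<delta>>0. \<exists>\<alpha>bar>0.
    (\<forall>\<psi>\<in>unit_sphere. lyapunov \<theta> \<phi> nbar \<delta> \<psi> \<ge> 0) \<and>
    (\<forall>f \<mu>. (\<forall>k. feedback \<theta> \<phi> nbar \<delta> \<alpha>bar (f k)) \<and> \<mu> \<in> prob_measures \<and>
        (\<integral>\<^sup>+ \<psi>. e2ennreal (lyapunov \<theta> \<phi> nbar \<delta> \<psi>) \<partial>\<mu>) \<le> ennreal C \<longrightarrow>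
      converges_to_limit_set (law \<theta> \<phi> f \<mu>) \<and>
      (\<forall>\<mu>inf\<in>limit_set (law \<theta> \<phi> f \<mu>).
         supp \<mu>inf \<subseteq> (\<Union>n. fock_ray n) \<and>
         measure \<mu>inf (fock_ray nbar) \<ge> 1 - \<epsilon>))"
proof -
  note nb = assms(1)
  have dist: "(cos (\<theta> + real n * \<phi>))\<^sup>2 \<noteq> (cos (\<theta> + real m * \<phi>))\<^sup>2" if "n \<noteq> m" for n m
    by (rule cos_squared_distinct[OF assms(2,3) that])
  obtain c0 where c0: "c0 > 0" "\<And>n. n \<noteq> nbar \<Longrightarrow> c0 \<le> sigma nbar n"
    using sigma_pos_bound[OF nb] by blast
  \<comment> \<open>N depends on C and \<epsilon> only, so the later choice of \<delta> faces
    finitely many levels. The 1 in C + 1 absorbs the shift of V by \<delta> \<le> 1.\<close>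
  obtain N where N: "nbar \<le> N" "(C + 1) / \<epsilon> \<le> sigma nbar N"
    using sigma_unbounded[OF nb] by blast
  have sN: "sigma nbar N > 0"
    using N(2) assms(4,5) by (meson add_pos_pos divide_pos_pos less_le_trans zero_less_one)
  define k where "k n = - curvature nbar n" for n
  have k: "k n > 0" if "n \<noteq> nbar" for n using curvature_neg[OF nb that] by (simp add: k_def)
  define E where "E n = 16 * (norm (gen (fock n)))\<^sup>2" for n
  obtain d0 where d0: "d0 > 0" "\<And>n. n \<in> {..N} - {nbar} \<Longrightarrow> d0 * E n \<le> k n"
    using finite_small_multiple[of "{..N} - {nbar}" k E] k by (auto simp: E_def)
  \<comment> \<open>The three bounds serve the descent at the levels n \<le> N, the shift by
    \<delta>, and the nonnegativity of V.\<close>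
  define \<delta> where "\<delta> = min d0 (min 1 (c0 / 2))"
  have \<delta>: "\<delta> > 0" "\<delta> \<le> 1" "2 * \<delta> \<le> c0" "\<delta> \<le> d0" using d0 c0 by (auto simp: \<delta>_def)
  have \<delta>E: "\<delta> * (16 * (norm (gen (fock n)))\<^sup>2) \<le> k n" if "n \<le> N" "n \<noteq> nbar" for n
  proof -
    have "\<delta> * E n \<le> d0 * E n" using \<delta> by (intro mult_right_mono) (simp_all add: E_def)
    also have "\<dots> \<le> k n" using that by (intro d0) auto
    finally show ?thesis by (simp add: E_def)
  qed
  have nonneg: "0 \<le> lyapunov \<theta> \<phi> nbar \<delta> x" if "norm x = 1" for x
    by (rule lyapunov_nonneg[OF _ c0(2) that]) (use c0 \<delta> in auto)
  let ?V = "shifted_lyapunov \<theta> \<phi> nbar \<delta>"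
  have Vm: "?V \<in> borel_measurable sphere_borel"
    by (rule measurable_sphere_borelI[OF measurable_shifted_lyapunov])
  \<comment> \<open>The bound 1 for the feedback suffices because \<open>lyapunov_descent\<close>
    provides displacements a \<le> 1.\<close>
  have main: "converges_to_limit_set (law \<theta> \<phi> f \<mu>) \<and>
      (\<forall>\<mu>inf\<in>limit_set (law \<theta> \<phi> f \<mu>). supp \<mu>inf \<subseteq> (\<Union>n. fock_ray n) \<and> measure \<mu>inf (fock_ray nbar) \<ge> 1 - \<epsilon>)"
    if fb: "\<And>k. feedback \<theta> \<phi> nbar \<delta> 1 (f k)" and \<mu>: "\<mu> \<in> prob_measures"
      and bound: "(\<integral>\<^sup>+ \<psi>. e2ennreal (lyapunov \<theta> \<phi> nbar \<delta> \<psi>) \<partial>\<mu>) \<le> ennreal C" for f \<mu>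
  proof -
    let ?X = "law \<theta> \<phi> f \<mu>"
    have f: "f k \<in> borel_measurable sphere_borel" for k using fb by (simp add: feedback_def)
    have X: "?X k \<in> prob_measures" for k by (rule law_prob_measures[OF f \<mu>])
    have V0: "(\<integral>\<^sup>+ x. ?V x \<partial>\<mu>) \<le> ennreal (C + 1)"
    proof -
      interpret prob_space \<mu> by (rule prob_measuresD[OF \<mu>])
      have le: "e2ennreal (lyapunov \<theta> \<phi> nbar \<delta> x) + ennreal \<delta> = ?V x" if "x \<in> space \<mu>" for x
        using shifted_lyapunov_eq_e2ennreal[of x \<delta> \<theta> \<phi> nbar] nonneg that \<delta> by (simp add: prob_measuresD(3)[OF \<mu>])
      have em: "(\<lambda>x. e2ennreal (lyapunov \<theta> \<phi> nbar \<delta> x)) \<in> borel_measurable \<mu>"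
      proof -
        have "(\<lambda>x. ?V x - ennreal \<delta>) \<in> borel_measurable \<mu>"
          unfolding prob_measuresD(4)[OF \<mu>] using Vm by measurable
        moreover have "?V x - ennreal \<delta> = e2ennreal (lyapunov \<theta> \<phi> nbar \<delta> x)" if "x \<in> space \<mu>" for x
          using le[OF that] by (metis ennreal_add_diff_cancel_right ennreal_neq_top)
        ultimately show ?thesis by (subst measurable_cong[of \<mu> _ "\<lambda>x. ?V x - ennreal \<delta>"]) auto
      qed
      have "(\<integral>\<^sup>+ x. ?V x \<partial>\<mu>) = (\<integral>\<^sup>+ x. e2ennreal (lyapunov \<theta> \<phi> nbar \<delta> x) + ennreal \<delta> \<partial>\<mu>)"
        by (rule nn_integral_cong) (simp add: le)
      also have "\<dots> = (\<integral>\<^sup>+ x. e2ennreal (lyapunov \<theta> \<phi> nbar \<delta> x) \<partial>\<mu>) + ennreal \<delta>"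
        by (subst nn_integral_add[OF em]) (auto simp: emeasure_space_1)
      also have "\<dots> \<le> ennreal C + ennreal 1" by (intro add_mono bound ennreal_leI \<delta>)
      also have "\<dots> = ennreal (C + 1)" using assms(5) by (simp add: ennreal_plus)
      finally show ?thesis .
    qed
    have Vfin: "(\<integral>\<^sup>+ x. ?V x \<partial>\<mu>) < \<infinity>" using V0 by (simp add: le_less_trans)
    note var_drift = variance_drift[OF fb _ less_imp_le[OF \<delta>(1)] zero_le_one]
    have Vk: "(\<integral>\<^sup>+ x. ?V x \<partial>?X k) \<le> ennreal (C + 1)" for k
    proof -
      have vm: "(\<lambda>x. ennreal (\<delta> * (8 * (cos_variance \<theta> \<phi> x)\<^sup>2))) \<in> borel_measurable sphere_borel"
        by (intro measurable_compose[OF _ measurable_ennreal] continuous_measurable_sphere continuous_intros continuous_cos_variance)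
      have "(\<integral>\<^sup>+ x. ?V x \<partial>?X k) \<le> (\<integral>\<^sup>+ x. ?V x \<partial>?X k) + (\<Sum>i<k. \<integral>\<^sup>+ x. ennreal (\<delta> * (8 * (cos_variance \<theta> \<phi> x)\<^sup>2)) \<partial>?X i)"
        by simp
      also have "\<dots> \<le> (\<integral>\<^sup>+ x. ?V x \<partial>\<mu>)" by (rule drift_summable[OF f \<mu> Vm vm var_drift])
      also note V0
      finally show ?thesis .
    qed
    have tail_bound: "(\<integral>x. tail M x \<partial>?X k) \<le> (C + 1) / sigma nbar M" if M: "nbar \<le> M" "sigma nbar M > 0" for M k
    proof -
      have "ennreal (\<integral>x. sigma nbar M * tail M x \<partial>?X k) = (\<integral>\<^sup>+ x. ennreal (sigma nbar M * tail M x) \<partial>?X k)"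
        by (rule nn_integral_eq_integral[symmetric])
          (use M tail_nonneg in \<open>auto intro!: integrable_tail[OF X] AE_I2 simp: prob_measuresD(3)[OF X]\<close>)
      also have "\<dots> \<le> (\<integral>\<^sup>+ x. ?V x \<partial>?X k)"
      proof (rule nn_integral_mono)
        fix x assume "x \<in> space (?X k)"
        then have "ennreal (sigma nbar M * tail M x) \<le> energy nbar x"
          by (intro tail_le_energy[OF nb M(1)]) (simp add: prob_measuresD(3)[OF X])
        then show "ennreal (sigma nbar M * tail M x) \<le> ?V x"
          unfolding shifted_lyapunov_def by (rule order_trans) simp
      qed
      also note Vk
      finally have "(\<integral>x. sigma nbar M * tail M x \<partial>?X k) \<le> C + 1"
        using assms(5) by (subst (asm) ennreal_le_iff) auto
      then show ?thesis using M by (simp add: field_simps)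
    qed
    have variance: "(\<lambda>k. \<integral>x. (cos_variance \<theta> \<phi> x)\<^sup>2 \<partial>?X k) \<longlonglongrightarrow> 0"
    proof -
      have "(\<lambda>k. \<integral>x. \<delta> * (8 * (cos_variance \<theta> \<phi> x)\<^sup>2) \<partial>?X k) \<longlonglongrightarrow> 0"
        by (rule drift_tendsto_0(2)[OF f \<mu> Vm Vfin _ _ var_drift])
          (use \<delta> in \<open>auto intro!: continuous_measurable_sphere continuous_intros continuous_cos_variance\<close>)
      then have "(\<lambda>k. inverse (8 * \<delta>) * (\<integral>x. \<delta> * (8 * (cos_variance \<theta> \<phi> x)\<^sup>2) \<partial>?X k)) \<longlonglongrightarrow> inverse (8 * \<delta>) * 0"
        by (intro tendsto_intros)
      then show ?thesis using \<delta> by simp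
    qed
    interpret concentrating ?X \<theta> \<phi>
    proof
      show "\<exists>M. \<forall>k. (\<integral>x. tail M x \<partial>?X k) \<le> e" if e: "e > 0" for e
      proof -
        obtain M where M: "nbar \<le> M" "(C + 1) / e \<le> sigma nbar M" using sigma_unbounded[OF nb] by blast
        have "0 < (C + 1) / e" using e assms(5) by simp
        then have s: "sigma nbar M > 0" using M(2) by linarith
        have "(C + 1) / sigma nbar M \<le> e" using M(2) s e by (simp add: field_simps)
        then show ?thesis using tail_bound[OF M(1) s] order_trans by blast
      qed
    qed (use dist X variance in auto)
    have "supp \<nu> \<subseteq> (\<Union>n. fock_ray n) \<and> measure \<nu> (fock_ray nbar) \<ge> 1 - \<epsilon>" if lim: "\<nu> \<in> limit_set ?X" for \<nu>
    proof
      obtain r where \<nu>: "\<nu> \<in> prob_measures" and r: "strict_mono r" and w: "weak_star_conv (?X \<circ> r) \<nu>"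
        using lim by (auto simp: limit_set_def)
      interpret \<nu>: prob_space \<nu> by (rule prob_measuresD[OF \<nu>])
      note sp = prob_measuresD(3)[OF \<nu>]
      have var0: "AE x in \<nu>. (cos_variance \<theta> \<phi> x)\<^sup>2 = 0"
        by (rule weak_star_limit_zero[OF r w \<nu> _ _ _ variance, of 1])
          (auto intro!: continuous_intros continuous_cos_variance power_le_one cos_variance_nonneg cos_variance_le_1)
      show "supp \<nu> \<subseteq> (\<Union>n. fock_ray n)"
      proof
        fix x assume x: "x \<in> supp \<nu>"
        then have nx: "norm x = 1" by (simp add: supp_def)
        show "x \<in> (\<Union>n. fock_ray n)"
        proof (rule ccontr)
          assume "x \<notin> (\<Union>n. fock_ray n)"
          then have "cos_variance \<theta> \<phi> x \<noteq> 0" using cos_variance_zero[OF dist nx] by blast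
          moreover define W where "W = unit_sphere \<inter> {y. cos_variance \<theta> \<phi> y \<noteq> 0}"
          ultimately have "x \<in> W" using nx by simp
          have "open {y. cos_variance \<theta> \<phi> y \<noteq> 0}"
            by (intro open_Collect_neq continuous_cos_variance continuous_on_const)
          then have "openin (top_of_set unit_sphere) W" unfolding W_def by (rule openin_open_Int)
          then have "emeasure \<nu> W > 0" using x \<open>x \<in> W\<close> by (simp add: supp_def)
          moreover have "emeasure \<nu> W = 0"
          proof -
            have "AE x in \<nu>. x \<notin> W" using var0 by eventually_elim (simp add: W_def)
            moreover have "W \<in> sets \<nu>"
              unfolding prob_measuresD(2)[OF \<nu>] sphere_borel_def sets_restrict_space W_def
              using \<open>open {y. cos_variance \<theta> \<phi> y \<noteq> 0}\<close> by (intro imageI borel_open)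
            ultimately show ?thesis using AE_iff_null_sets null_setsD1 by blast
          qed
          ultimately show False by simp
        qed
      qed
      \<comment> \<open>On the ray the function \<open>excess\<close> equals c > 0, yet it vanishes
        almost everywhere for the limit measure.\<close>
      have not_ray: "AE x in \<nu>. x \<notin> fock_ray n" if n: "n \<le> N" "n \<noteq> nbar" for n
      proof -
        obtain a \<eta> c where a: "0 < a" "a \<le> 1" and \<eta>: "0 < \<eta>" and c: "0 < c"
          and desc: "\<And>x. norm x = 1 \<Longrightarrow> 1 - \<eta> < population x n \<Longrightarrow> ?V (disp a x) + ennreal c \<le> ?V x"
          using lyapunov_descent[OF nb n(2) k[OF n(2)] _ less_imp_le[OF \<delta>(1)] \<delta>(2) \<delta>E[OF n], of \<theta> \<phi>]
          by (auto simp: k_def)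
        have drift: "(\<integral>\<^sup>+ y. ?V y \<partial>transition \<theta> \<phi> (f k) x) + ennreal (excess c \<eta> n x) \<le> ?V x" if "norm x = 1" for k x
          by (rule population_drift[OF fb that less_imp_le[OF \<delta>(1)] _ c \<eta> desc]) (use a in auto)
        have "(\<lambda>k. \<integral>x. excess c \<eta> n x \<partial>?X k) \<longlonglongrightarrow> 0"
          by (rule drift_tendsto_0(2)[OF f \<mu> Vm Vfin _ _ drift])
            (use c in \<open>auto intro!: continuous_measurable_sphere continuous_excess excess_nonneg\<close>)
        then have "AE x in \<nu>. excess c \<eta> n x = 0"
        proof (rule weak_star_limit_zero[OF r w \<nu> continuous_excess, rotated 2])
          show "excess c \<eta> n x \<le> c * 1" if x: "norm x = 1" for x
            unfolding excess_def using c \<eta> population_le_1[OF x, of n] by (intro mult_left_mono) auto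
        qed (use c in \<open>simp add: excess_nonneg\<close>)
        then show ?thesis
          by eventually_elim (use c \<eta> in \<open>auto simp: fock_ray_iff excess_def\<close>)
      qed
      have ray_meas: "fock_ray nbar \<in> sets \<nu>"
      proof -
        have "closed (fock_ray nbar)" by (rule compact_imp_closed[OF compact_fock_ray])
        then have "unit_sphere \<inter> fock_ray nbar \<in> sets sphere_borel"
          unfolding sphere_borel_def sets_restrict_space by (intro imageI borel_closed)
        moreover have "unit_sphere \<inter> fock_ray nbar = fock_ray nbar" by (auto simp: fock_ray_iff)
        ultimately show ?thesis by (simp add: prob_measuresD(2)[OF \<nu>])
      qed
      have "AE x in \<nu>. \<forall>n\<in>{..N} - {nbar}. x \<notin> fock_ray n"
        by (rule AE_finite_allI) (use not_ray in auto)
      moreover have "AE x in \<nu>. norm x = 1" by (rule AE_I2) (simp add: sp)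
      \<comment> \<open>Almost every state lies on a ray. The rays n \<le> N other than nbar are
        excluded, and on a ray n > N the tail equals 1.\<close>
      ultimately have ae: "AE x in \<nu>. 1 - indicator (fock_ray nbar) x \<le> tail N x"
        using var0
      proof eventually_elim
        fix x assume far: "\<forall>n\<in>{..N} - {nbar}. x \<notin> fock_ray n" and v: "(cos_variance \<theta> \<phi> x)\<^sup>2 = 0" and nx: "norm x = 1"
        then obtain n where n: "x \<in> fock_ray n" using cos_variance_zero[OF dist nx] by auto
        show "1 - indicator (fock_ray nbar) x \<le> tail N x"
        proof (cases "n = nbar")
          case True
          then show ?thesis using n tail_nonneg[OF nx, of N] by simp
        next
          case False
          then have "n > N" using far n by (meson Diff_iff atMost_iff not_le singletonD)
          then have "1 \<le> tail N x" using population_le_tail[OF nx] n by (metis fock_ray_iff)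
          then show ?thesis by (simp add: indicator_def)
        qed
      qed
      have "1 - measure \<nu> (fock_ray nbar) = (\<integral>x. 1 - indicator (fock_ray nbar) x \<partial>\<nu>)"
        using ray_meas by (simp add: \<nu>.prob_space \<nu>.emeasure_eq_measure)
      also have "\<dots> \<le> (\<integral>x. tail N x \<partial>\<nu>)"
        by (rule integral_mono_AE[OF _ integrable_tail[OF \<nu>] ae]) (use ray_meas in \<open>simp add: \<nu>.emeasure_eq_measure\<close>)
      \<comment> \<open>\<open>tail N\<close> is bounded and continuous, so the bound on its
        expectations, uniform in k, passes to the weak limit.\<close>
      also have "\<dots> \<le> (C + 1) / sigma nbar N"
      proof (rule tendsto_upperbound)
        show "(\<lambda>k. \<integral>x. tail N x \<partial>?X (r k)) \<longlonglongrightarrow> (\<integral>x. tail N x \<partial>\<nu>)"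
        proof (rule weak_star_limit_integral[OF w continuous_tail])
          show "\<bar>tail N x\<bar> \<le> 1" if "norm x = 1" for x
            using tail_nonneg[OF that] tail_le_1[of N x] by simp
        qed
      qed (use tail_bound[OF N(1) sN] in auto)
      also have "\<dots> \<le> \<epsilon>" using N(2) sN assms(4) by (simp add: field_simps)
      finally show "measure \<nu> (fock_ray nbar) \<ge> 1 - \<epsilon>" by simp
    qed
    then show ?thesis using converges by blast
  qed
  show ?thesis
    by (intro exI[of _ \<delta>] exI[of _ 1] conjI allI impI ballI main) (use \<delta> nonneg in auto)
qed

end
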